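(* Let $\mathcal{G}$ be one of the Lie algebras $sl(n,\mathbb{R})$, $sp(2n,\mathbb{R})$, $o(n)$, $u(n)$, $so(n)$. Let $d\ge 2$, $h>0$, let $\mu\in\mathbb{T}^{d-1}$ be such that $(1,\mu)$ is rationally independent, let $A\in\mathcal{G}$ be a constant matrix and let $G\in C^\omega_h(\mathbb{T}^{d-1},\mathcal{G})$. Then there exist $\epsilon=\epsilon(A,h,|\mu|)>0$ and $c=c(A,h,|\mu|)>0$ such that, whenever $\|G\|_h=\varepsilon<\epsilon$, there exist a constant $\widetilde{A}\in\mathcal{G}$ and $F\in C^\omega_{h/(1+|\mu|)}(\mathbb{T}^d,\mathcal{G})$ with $\|F\|_{h/(1+|\mu|)}\le c\,\varepsilon^{1/2}$ such that the quasi-periodic cocycle $(\mu,e^{A}e^{G(\cdot)})$ is the Poincaré map of the quasi-periodic linear system $$\dot x=(\widetilde{A}+F(\theta))x,\qquad \dot\theta=\omega=(1,\mu),$$ i.e. $\Phi^1(0,\widetilde\theta)=e^{A}e^{G(\widetilde\theta)}$ for all $\widetilde\theta\in\mathbb{T}^{d-1}$, where $\Phi^t(\theta)$ is the fundamental matrix solution of $\frac{d}{dt}\Phi^t(\theta)=(\widetilde A+F(\theta+t\omega))\Phi^t(\theta)$, $\Phi^0(\theta)=I$, for $\theta=(\theta_1,\widetilde\theta)\in\mathbb{T}\times\mathbb{T}^{d-1}$.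
   Context: $\mathbb{T}=\mathbb{R}/\mathbb{Z}$. For $h>0$, $C^\omega_h(\mathbb{T}^m,\ast)$ denotes the set of real-analytic $\ast$-valued functions on $\mathbb{T}^m$ which extend holomorphically and boundedly to the complex strip $\{|\mathrm{Im}\,\theta|<h\}$, with $\|F\|_h=\sup_{|\mathrm{Im}\,\theta|<h}\|F(\theta)\|$ (a fixed matrix norm). For $\mu=(\mu_1,\dots,\mu_{d-1})$, $|\mu|=|\mu_1|+\dots+|\mu_{d-1}|$. The quasi-periodic cocycle $(\mu,\mathcal{A})$ is the map $(\widetilde\theta,v)\mapsto(\widetilde\theta+\mu,\mathcal{A}(\widetilde\theta)v)$ on $\mathbb{T}^{d-1}\times\mathbb{R}^n$ (or $\mathbb{C}^n$). *)

theory Defs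
  imports "HOL-Analysis.Analysis"
begin

(* Matrices are complex matrices indexed by a finite enumerated type 'n
   (n = CARD('n)); real Lie algebras are the subsets with real entries.
   Matrix product is (**), identity is mat 1. The matrix norm is the
   library norm on complex^'n^'n (Frobenius norm). *)

type_synonym 'n cmat = "complex^'n^'n"

fun mpow :: "'n::finite cmat \<Rightarrow> nat \<Rightarrow> 'n cmat" where
  "mpow M 0 = mat 1"
| "mpow M (Suc k) = M ** mpow M k"

definition mexp :: "'n::finite cmat \<Rightarrow> 'n cmat" where
  "mexp M = (\<Sum>k. (1 / fact k) *\<^sub>R mpow M k)"

definition real_mat :: "'n::finite cmat \<Rightarrow> bool" where
  "real_mat M \<longleftrightarrow> (\<forall>i j. Im (M$i$j) = 0)"

definition ctranspose :: "'n::finite cmat \<Rightarrow> 'n cmat" where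
  "ctranspose M = (\<chi> i j. cnj (M$j$i))"

definition idx :: "'n::enum \<Rightarrow> nat" where
  "idx i = (THE k. k < length (enum_class.enum :: 'n list) \<and> enum_class.enum ! k = i)"

(* standard symplectic matrix J = [[0, I],[-I, 0]] w.r.t. the enumeration order,
   meaningful when CARD('n) = 2m is even *)
definition symp_J :: "'n::enum cmat" where
  "symp_J = (\<chi> i j. if idx j = idx i + CARD('n) div 2 then 1
                    else if idx i = idx j + CARD('n) div 2 then -1 else 0)"

datatype lie_kind = LSL | LSP | LO | LU | LSO

fun lie_alg :: "lie_kind \<Rightarrow> ('n::enum cmat) set" where
  "lie_alg LSL = {A. real_mat A \<and> (\<Sum>i\<in>UNIV. A$i$i) = 0}"
| "lie_alg LSP = {A. real_mat A \<and> transpose A ** symp_J + symp_J ** A = 0}"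
| "lie_alg LO  = {A. real_mat A \<and> transpose A = - A}"
| "lie_alg LU  = {A. ctranspose A = - A}"
| "lie_alg LSO = {A. real_mat A \<and> transpose A = - A}"

definition cscaleV :: "complex \<Rightarrow> complex^'d \<Rightarrow> complex^'d" where
  "cscaleV c v = (\<chi> j. c * v$j)"

definition cscaleM :: "complex \<Rightarrow> 'n::finite cmat \<Rightarrow> 'n cmat" where
  "cscaleM c M = (\<chi> i j. c * M$i$j)"

definition holo_on1 :: "(complex^'d \<Rightarrow> 'n::finite cmat) \<Rightarrow> (complex^'d) set \<Rightarrow> bool" where
  "holo_on1 f S \<longleftrightarrow> (\<forall>z\<in>S. \<exists>D. (f has_derivative D) (at z) \<and>
        (\<forall>c v. D (cscaleV c v) = cscaleM c (D v)))"

definition holo_on2 :: "(complex \<times> (complex^'d) \<Rightarrow> 'n::finite cmat) \<Rightarrow> (complex \<times> (complex^'d)) set \<Rightarrow> bool" where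
  "holo_on2 f S \<longleftrightarrow> (\<forall>z\<in>S. \<exists>D. (f has_derivative D) (at z) \<and>
        (\<forall>c a v. D (c * a, cscaleV c v) = cscaleM c (D (a, v))))"

definition strip1 :: "real \<Rightarrow> (complex^'d) set" where
  "strip1 h = {z. \<forall>j. \<bar>Im (z$j)\<bar> < h}"

definition strip2 :: "real \<Rightarrow> (complex \<times> (complex^'d)) set" where
  "strip2 h = {(a, z). \<bar>Im a\<bar> < h \<and> (\<forall>j. \<bar>Im (z$j)\<bar> < h)}"

definition cvec :: "real^'d \<Rightarrow> complex^'d" where
  "cvec x = (\<chi> j. complex_of_real (x$j))"

(* Gc is the bounded holomorphic extension to the strip of width h of the
   function G on T^m (m = CARD('d)), i.e. G \<in> C^omega_h(T^m, matrices) *)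
definition comega1 :: "real \<Rightarrow> (real^'d \<Rightarrow> 'n::finite cmat) \<Rightarrow> (complex^'d \<Rightarrow> 'n cmat) \<Rightarrow> bool" where
  "comega1 h G Gc \<longleftrightarrow>
     holo_on1 Gc (strip1 h) \<and> bounded (Gc ` strip1 h) \<and>
     (\<forall>x. Gc (cvec x) = G x) \<and>
     (\<forall>z j. Gc (z + axis j 1) = Gc z)"

definition comega2 :: "real \<Rightarrow> (real \<times> (real^'d) \<Rightarrow> 'n::finite cmat) \<Rightarrow> (complex \<times> (complex^'d) \<Rightarrow> 'n cmat) \<Rightarrow> bool" where
  "comega2 h F Fc \<longleftrightarrow>
     holo_on2 Fc (strip2 h) \<and> bounded (Fc ` strip2 h) \<and>
     (\<forall>t x. Fc (complex_of_real t, cvec x) = F (t, x)) \<and>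
     (\<forall>a z. Fc (a + 1, z) = Fc (a, z)) \<and>
     (\<forall>a z j. Fc (a, z + axis j 1) = Fc (a, z))"

definition l1norm :: "real^'d \<Rightarrow> real" where
  "l1norm v = (\<Sum>j\<in>UNIV. \<bar>v$j\<bar>)"

definition rat_indep :: "real^'d \<Rightarrow> bool" where
  "rat_indep mu \<longleftrightarrow> (\<forall>(k0::int) (k::'d \<Rightarrow> int).
      of_int k0 + (\<Sum>j\<in>UNIV. of_int (k j) * mu$j) = 0 \<longrightarrow> k0 = 0 \<and> (\<forall>j. k j = 0))"

end

theory Submission
  imports Defs "HOL-Complex_Analysis.Complex_Analysis"
begin

text \<open>
  Write \<open>M = e\<^sup>A e\<^sup>G\<close> and let \<open>M\<^sub>l\<close> be the \<open>l\<close>-th iterate of the cocycle.  Take an entire function \<open>\<rho>\<close>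
  with faster than exponential decay on horizontal strips, \<open>\<rho>(n) = \<delta>\<^sub>0\<^sub>n\<close> at the integers and
  \<open>\<Sum>\<^sub>l \<rho>(t - l) = 1\<close>.  The blended matrix \<open>B(a, z) = \<Sum>\<^sub>l \<rho>(a - l) e\<^bsup>(a - l)A\<^esup> M\<^sub>l(z - a\<mu>)\<close> satisfies
  \<open>B(0, z) = 1\<close>, \<open>B(1, x + \<mu>) = M(x)\<close> and \<open>B(a + 1, z) = B(a, z) M(z - (a + 1)\<mu>)\<close>, and it is
  \<open>O(\<epsilon>)\<close>-close to \<open>e\<^bsup>aA\<^esup>\<close>.  So the logarithmic derivative of \<open>B\<close> along the flow is one-periodic in all
  variables and \<open>O(\<epsilon>)\<close>-close to \<open>A\<close>; one may take the constant part of the system to be \<open>A\<close> itself.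
  The strip shrinks by the factor \<open>1 + |\<mu>|\<close> only because of the argument \<open>z - a\<mu>\<close>.

  To stay inside the group, let \<open>B\<^sup>s\<close> be the analogous blend of the inverse iterates.  Then \<open>B B\<^sup>s\<close> is
  periodic and close to the identity, and \<open>\<Phi> = (B B\<^sup>s)\<^bsup>-1/2\<^esup> B\<close> has right inverse \<open>B\<^sup>s (B B\<^sup>s)\<^bsup>-1/2\<^esup>\<close>.  For
  an algebra defined by an anti-automorphism, \<open>B\<^sup>s\<close> is the adjoint of \<open>B\<close> at real points and \<open>\<Phi>\<close> is the
  polar part of \<open>B\<close>.  For \<open>sl(n)\<close> the trace of the generator is subtracted; by Liouville's formula
  this multiplies the solution by a scalar that equals one at time one.
\<close>

text \<open>The obstacle is analyticity. A path from the identity to \<open>exp A * exp G\<close>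
  switched on by a cutoff function would be smooth at best, whereas the generator has to extend
  holomorphically to a strip of prescribed width. An entire weight has no bounded support, so all
  iterates of the cocycle, forward and backward, enter the blend; they grow exponentially in the
  index, and this is what the decay of \<rho> has to beat. The two normalisations of \<rho> do
  different work. The values at the integers make the time-one map exact rather than approximate.
  The sum of the translates makes the blend equal to the flow of \<open>A\<close> when
  \<open>G = 0\<close>, so that every deviation is linear in the size of \<open>G\<close>; the
  square root in the theorem is then reached from a linear bound with \<open>G\<close> of size at
  most 1. The adjoint of a holomorphic function is not holomorphic. Hence the second blend: it is
  holomorphic by construction and only coincides with the adjoint on the real torus, where
  membership in the Lie algebra is tested.\<close>

no_notation fps_nth (infixl "$" 75)

section \<open>Matrices as a Banach algebra\<close>

text \<open>On vectors of vectors \<open>*\<close> acts componentwise. This copy carries the matrix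
  product and the operator norm, which is submultiplicative with \<open>norm 1 = 1\<close>; as a
  Banach algebra it has \<open>exp\<close> and power series at its disposal.\<close>

typedef (overloaded) 'n opmat = "UNIV :: (complex^'n::finite^'n) set"
  morphisms mat_of opmat_of by simp

setup_lifting type_definition_opmat

lemmas mat_of_inverses [simp] = mat_of_inverse opmat_of_inverse[OF UNIV_I]

instantiation opmat :: (finite) real_normed_vector
begin

lift_definition norm_opmat :: "'a opmat \<Rightarrow> real" is "\<lambda>M. onorm ((*v) M)" .
lift_definition minus_opmat :: "'a opmat \<Rightarrow> 'a opmat \<Rightarrow> 'a opmat" is "(-)" .
lift_definition uminus_opmat :: "'a opmat \<Rightarrow> 'a opmat" is "uminus" .
lift_definition zero_opmat :: "'a opmat" is 0 .
lift_definition plus_opmat :: "'a opmat \<Rightarrow> 'a opmat \<Rightarrow> 'a opmat" is "(+)" .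
lift_definition scaleR_opmat :: "real \<Rightarrow> 'a opmat \<Rightarrow> 'a opmat" is scaleR .
definition dist_opmat :: "'a opmat \<Rightarrow> 'a opmat \<Rightarrow> real" where "dist_opmat a b = norm (a - b)"
definition uniformity_opmat :: "('a opmat \<times> 'a opmat) filter"
  where "uniformity_opmat = (INF e\<in>{0 <..}. principal {(x, y). dist x y < e})"
definition open_opmat :: "'a opmat set \<Rightarrow> bool"
  where "open_opmat S = (\<forall>x\<in>S. \<forall>\<^sub>F (x', y) in uniformity. x' = x \<longrightarrow> y \<in> S)"
definition sgn_opmat :: "'a opmat \<Rightarrow> 'a opmat" where "sgn_opmat x = scaleR (inverse (norm x)) x"

lemma bounded_linear_matvec: "bounded_linear ((*v) (M::complex^'k::finite^'k))"
  by (simp add: linear_conv_bounded_linear[symmetric] linear_iff matrix_vector_right_distrib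
      matrix_vector_mult_def vec_eq_iff sum.distrib sum_distrib_left scaleR_right.sum algebra_simps)

instance
proof
  fix x y :: "'a opmat" and r :: real
  show "norm x = 0 \<longleftrightarrow> x = 0"
    by transfer (simp add: onorm_eq_0[OF bounded_linear_matvec] matrix_eq)
  show "norm (x + y) \<le> norm x + norm y"
  proof transfer
    fix x y :: "complex^'a^'a"
    show "onorm ((*v) (x + y)) \<le> onorm ((*v) x) + onorm ((*v) y)"
      using onorm_triangle[OF bounded_linear_matvec bounded_linear_matvec, of x y]
      unfolding matrix_vector_mult_add_rdistrib .
  qed
  show "norm (r *\<^sub>R x) = \<bar>r\<bar> * norm x"
  proof transfer
    fix x :: "complex^'a^'a" and r
    have "(*v) (r *\<^sub>R x) = (\<lambda>v. r *\<^sub>R (x *v v))"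
      by (rule ext) (simp add: matrix_vector_mult_def vec_eq_iff scaleR_right.sum algebra_simps)
    then show "onorm ((*v) (r *\<^sub>R x)) = \<bar>r\<bar> * onorm ((*v) x)"
      using onorm_scaleR[OF bounded_linear_matvec, of r x] by simp
  qed
qed (simp_all add: dist_opmat_def uniformity_opmat_def open_opmat_def sgn_opmat_def,
    (transfer, simp add: algebra_simps)+)

end

instantiation opmat :: (finite) real_normed_algebra_1
begin

lift_definition times_opmat :: "'a opmat \<Rightarrow> 'a opmat \<Rightarrow> 'a opmat" is "(**)" .
lift_definition one_opmat :: "'a opmat" is "mat 1" .

instance
proof
  fix x y z :: "'a opmat" and r :: real
  show "x * y * z = x * (y * z)" by transfer (simp add: matrix_mul_assoc)
  show "1 * x = x" "x * 1 = x" by (transfer, simp)+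
  show "(x + y) * z = x * z + y * z" "x * (y + z) = x * y + x * z"
    by (transfer, simp add: matrix_matrix_mult_def vec_eq_iff sum.distrib algebra_simps)+
  show "r *\<^sub>R x * y = r *\<^sub>R (x * y)" "x * r *\<^sub>R y = r *\<^sub>R (x * y)"
    by (transfer, simp add: matrix_matrix_mult_def vec_eq_iff scaleR_right.sum)+
  show "norm (x * y) \<le> norm x * norm y"
  proof transfer
    fix x y :: "complex^'a^'a"
    show "onorm ((*v) (x ** y)) \<le> onorm ((*v) x) * onorm ((*v) y)"
      using onorm_compose[OF bounded_linear_matvec bounded_linear_matvec, of x y]
      by (simp add: o_def matrix_vector_mul_assoc)
  qed
  show "norm (1::'a opmat) = 1"
  proof transfer
    have "(*v) (mat 1) = (\<lambda>v::complex^'a. v)" by (rule ext) simp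
    then show "onorm ((*v) (mat 1 :: complex^'a^'a)) = 1" by (simp add: onorm_id)
  qed
  show "(0::'a opmat) \<noteq> 1"
    by transfer (auto simp: mat_def vec_eq_iff)
qed

end


text \<open>An entry is a coordinate of the image of a basis vector. With the converse estimate
  below, scalar complex analysis can be applied entry by entry.\<close>

lemma norm_entry_le: "norm (mat_of M $ i $ j) \<le> norm M"
proof transfer
  fix M :: "complex^'a^'a" and i j :: 'a
  have "norm (M $ i $ j) = norm ((M *v axis j 1) $ i)"
    by (simp add: matrix_vector_mult_def axis_def if_distrib[of "(*) _"] cong: if_cong)
  also have "\<dots> \<le> norm (M *v axis j 1)" by (rule Finite_Cartesian_Product.norm_nth_le)
  also have "\<dots> \<le> onorm ((*v) M) * norm (axis j (1::complex))"
    by (rule onorm[OF bounded_linear_matvec])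
  also have "norm (axis j (1::complex)) = 1" by simp
  finally show "norm (M $ i $ j) \<le> onorm ((*v) M)" by simp
qed

lemma norm_opmat_le_sum: "norm M \<le> (\<Sum>i\<in>UNIV. \<Sum>j\<in>UNIV. norm (mat_of M $ i $ j))"
proof transfer
  fix M :: "complex^'a^'a"
  show "onorm ((*v) M) \<le> (\<Sum>i\<in>UNIV. \<Sum>j\<in>UNIV. norm (M $ i $ j))"
  proof (rule onorm_le)
    fix v :: "complex^'a"
    have "norm (M *v v) \<le> (\<Sum>i\<in>UNIV. norm ((M *v v) $ i))"
      unfolding norm_vec_def by (rule L2_set_le_sum) simp
    also have "\<dots> \<le> (\<Sum>i\<in>UNIV. \<Sum>j\<in>UNIV. norm (M $ i $ j) * norm v)"
    proof (intro sum_mono)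
      fix i
      have "norm ((M *v v) $ i) \<le> (\<Sum>j\<in>UNIV. norm (M $ i $ j * v $ j))"
        unfolding matrix_vector_mult_def by (simp add: sum_norm_le)
      also have "\<dots> \<le> (\<Sum>j\<in>UNIV. norm (M $ i $ j) * norm v)"
        by (intro sum_mono) (simp add: norm_mult mult_left_mono Finite_Cartesian_Product.norm_nth_le)
      finally show "norm ((M *v v) $ i) \<le> (\<Sum>j\<in>UNIV. norm (M $ i $ j) * norm v)" .
    qed
    finally show "norm (M *v v) \<le> (\<Sum>i\<in>UNIV. \<Sum>j\<in>UNIV. norm (M $ i $ j)) * norm v"
      by (simp add: sum_distrib_right)
  qed
qed

lemma bounded_linear_opmat_of: "bounded_linear (opmat_of :: complex^'n::finite^'n \<Rightarrow> _)"
proof (rule bounded_linear_intro)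
  fix M N :: "complex^'n^'n" and r :: real
  show "opmat_of (M + N) = opmat_of M + opmat_of N" by (simp add: plus_opmat_def)
  show "opmat_of (r *\<^sub>R M) = r *\<^sub>R opmat_of M" by (simp add: scaleR_opmat_def)
  have "norm (opmat_of M) \<le> (\<Sum>i\<in>UNIV. \<Sum>j\<in>UNIV. norm (M $ i $ j))"
    using norm_opmat_le_sum[of "opmat_of M"] by simp
  also have "\<dots> \<le> (\<Sum>i\<in>(UNIV::'n set). \<Sum>j\<in>(UNIV::'n set). norm M)"
    by (intro sum_mono) (meson Finite_Cartesian_Product.norm_nth_le order_trans)
  finally show "norm (opmat_of M) \<le> norm M * (\<Sum>i\<in>(UNIV::'n set). \<Sum>j\<in>(UNIV::'n set). 1)"
    by (simp add: mult_ac)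
qed

lemma bounded_linear_mat_of: "bounded_linear (mat_of :: 'n::finite opmat \<Rightarrow> _)"
proof (rule bounded_linear_intro)
  fix M N :: "'n opmat" and r :: real
  show "mat_of (M + N) = mat_of M + mat_of N" by transfer simp
  show "mat_of (r *\<^sub>R M) = r *\<^sub>R mat_of M" by transfer simp
  have "norm (mat_of M) \<le> (\<Sum>i\<in>UNIV. norm (mat_of M $ i))"
    unfolding norm_vec_def by (rule L2_set_le_sum) simp
  also have "\<dots> \<le> (\<Sum>i\<in>UNIV. \<Sum>j\<in>UNIV. norm (mat_of M $ i $ j))"
    by (intro sum_mono, subst norm_vec_def) (rule L2_set_le_sum, simp)
  also have "\<dots> \<le> (\<Sum>i\<in>(UNIV::'n set). \<Sum>j\<in>(UNIV::'n set). norm M)"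
    by (intro sum_mono norm_entry_le)
  finally show "norm (mat_of M) \<le> norm M * (\<Sum>i\<in>(UNIV::'n set). \<Sum>j\<in>(UNIV::'n set). 1)"
    by (simp add: mult_ac)
qed

instance opmat :: (finite) banach
proof
  fix X :: "nat \<Rightarrow> 'a opmat"
  assume "Cauchy X"
  then have "Cauchy (\<lambda>n. mat_of (X n))"
    by (rule bounded_linear.Cauchy[OF bounded_linear_mat_of])
  then obtain L where "(\<lambda>n. mat_of (X n)) \<longlonglongrightarrow> L"
    using Cauchy_convergent_iff convergent_def by blast
  from bounded_linear.tendsto[OF bounded_linear_opmat_of this] show "convergent X"
    by (auto simp: convergent_def)
qed

text \<open>Dimension is finite, so a right inverse is an inverse; it is enough to compute products
  in one order.\<close>

lemma opmat_inverse_commute: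
  fixes x y :: "'n::finite opmat"
  assumes "x * y = 1" shows "y * x = 1"
  using assms by transfer (simp add: matrix_left_right_inverse)

text \<open>The algebra is declared over the reals, so complex scalars enter as scalar matrices.
  Complex linearity becomes compatibility with left multiplication by the central elements
  \<open>csm c\<close>.\<close>

lift_definition csm :: "complex \<Rightarrow> 'n::finite opmat" is "\<lambda>c. mat c" .

lemma csm_mult: "csm (c * d) = csm c * csm d"
  by transfer (auto simp: mat_def matrix_matrix_mult_def vec_eq_iff if_distrib[of "(*) _"] cong: if_cong)

lemma csm_add: "csm (c + d) = csm c + csm d"
  by transfer (auto simp: mat_def vec_eq_iff)

lemma csm_of_real: "csm (of_real r) = (of_real r :: 'n::finite opmat)"
proof -
  have "csm (of_real r) = r *\<^sub>R (1 :: 'n opmat)"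
    by transfer (auto simp: mat_def vec_eq_iff of_real_def)
  then show ?thesis by (simp add: of_real_def)
qed

lemma csm_0 [simp]: "csm 0 = 0" and csm_1 [simp]: "csm 1 = 1"
  by (transfer, auto simp: mat_def vec_eq_iff)+

lemma csm_minus: "csm (- c) = - csm c"
  by transfer (auto simp: mat_def vec_eq_iff)

lemma csm_commute: "csm c * x = x * csm c"
  by transfer (auto simp: mat_def matrix_matrix_mult_def vec_eq_iff mult_ac
      if_distrib[of "(*) _"] if_distrib[of "\<lambda>x. x * _"] cong: if_cong)

lemma mat_of_csm_mult: "mat_of (csm c * x) $ i $ j = c * mat_of x $ i $ j"
  by transfer (auto simp: mat_def matrix_matrix_mult_def 
      if_distrib[of "(*) _"] if_distrib[of "\<lambda>x. x * _"] cong: if_cong)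

lemma csm_scaleR: "csm (r *\<^sub>R c) = r *\<^sub>R csm c"
  by transfer (auto simp: mat_def vec_eq_iff)

lemma norm_csm_mult_le: "norm (csm c * x) \<le> cmod c * norm x"
proof transfer
  fix c and x :: "complex^'a^'a"
  show "onorm ((*v) (mat c ** x)) \<le> cmod c * onorm ((*v) x)"
  proof (rule onorm_le)
    fix v
    have "(mat c ** x) *v v = (\<chi> i. c * (x *v v) $ i)"
      by (auto simp: mat_def matrix_matrix_mult_def matrix_vector_mult_def vec_eq_iff sum_distrib_left mult_ac
      if_distrib[of "(*) _"] if_distrib[of "\<lambda>x. x * _"] cong: if_cong)
    then have "norm ((mat c ** x) *v v) = cmod c * norm (x *v v)"
      by (simp add: norm_vec_def norm_mult L2_set_right_distrib)
    also have "\<dots> \<le> cmod c * (onorm ((*v) x) * norm v)"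
      by (intro mult_left_mono onorm[OF bounded_linear_matvec]) auto
    finally show "norm ((mat c ** x) *v v) \<le> cmod c * onorm ((*v) x) * norm v" by simp
  qed
qed

lemma norm_csm_le: "norm (csm c :: 'n::finite opmat) \<le> cmod c"
  using norm_csm_mult_le[of c "1 :: 'n opmat"] by simp

lemma bounded_linear_csm: "bounded_linear csm"
  by (rule bounded_linear_intro[where K=1]) (auto simp: csm_add csm_scaleR norm_csm_le)

section \<open>Holomorphic functions with prescribed derivative along the flow\<close>

definition smul :: "complex \<Rightarrow> complex \<times> (complex^'d) \<Rightarrow> complex \<times> (complex^'d)"
  where "smul c w = (c * fst w, cscaleV c (snd w))"

text \<open>Holomorphy packed with a derivative along the flow: \<open>f'\<close> is the value of
  the complex linear derivative in the direction \<open>(1, \<mu>)\<close>, the part that enters the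
  differential equation.\<close>

definition fhol :: "real^'d \<Rightarrow> (complex \<times> (complex^'d) \<Rightarrow> 'n::finite opmat)
    \<Rightarrow> (complex \<times> (complex^'d) \<Rightarrow> 'n opmat) \<Rightarrow> (complex \<times> (complex^'d)) set \<Rightarrow> bool"
  where "fhol \<mu> f f' S \<longleftrightarrow> (\<forall>z\<in>S. \<exists>D. (f has_derivative D) (at z) \<and>
    (\<forall>c v. D (smul c v) = csm c * D v) \<and> D (1, cvec \<mu>) = f' z)"

lemma fholI:
  assumes "\<And>z. z \<in> S \<Longrightarrow> (f has_derivative D z) (at z)"
    and "\<And>z c v. z \<in> S \<Longrightarrow> D z (smul c v) = csm c * D z v"
    and "\<And>z. z \<in> S \<Longrightarrow> D z (1, cvec \<mu>) = f' z"
  shows "fhol \<mu> f f' S"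
  using assms unfolding fhol_def by blast

lemma fholE:
  assumes "fhol \<mu> f f' S"
  obtains D where "\<And>z. z \<in> S \<Longrightarrow> (f has_derivative D z) (at z)"
    and "\<And>z c v. z \<in> S \<Longrightarrow> D z (smul c v) = csm c * D z v"
    and "\<And>z. z \<in> S \<Longrightarrow> D z (1, cvec \<mu>) = f' z"
  using assms unfolding fhol_def by metis

lemma fhol_subset: "fhol \<mu> f f' S \<Longrightarrow> T \<subseteq> S \<Longrightarrow> fhol \<mu> f f' T"
  unfolding fhol_def by blast

lemma fhol_UN: "(\<And>i. i \<in> I \<Longrightarrow> fhol \<mu> f f' (S i)) \<Longrightarrow> fhol \<mu> f f' (\<Union>i\<in>I. S i)"
  unfolding fhol_def by blast

lemma fhol_cong:
  assumes "fhol \<mu> f f' S" "open S" "\<And>z. z \<in> S \<Longrightarrow> f z = g z" "\<And>z. z \<in> S \<Longrightarrow> f' z = g' z"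
  shows "fhol \<mu> g g' S"
  using assms unfolding fhol_def
  by (metis (no_types, lifting) has_derivative_transform_within_open)

lemma fhol_const: "fhol \<mu> (\<lambda>z. c) (\<lambda>z. 0) S"
  unfolding fhol_def by (auto intro!: exI[of _ "\<lambda>_. 0"])

lemma fhol_add:
  assumes "fhol \<mu> f f' S" "fhol \<mu> g g' S"
  shows "fhol \<mu> (\<lambda>z. f z + g z) (\<lambda>z. f' z + g' z) S"
proof -
  from assms(1) obtain D where D: "\<And>z. z \<in> S \<Longrightarrow> (f has_derivative D z) (at z)"
    "\<And>z c v. z \<in> S \<Longrightarrow> D z (smul c v) = csm c * D z v" "\<And>z. z \<in> S \<Longrightarrow> D z (1, cvec \<mu>) = f' z"
    by (rule fholE) blast
  from assms(2) obtain E where E: "\<And>z. z \<in> S \<Longrightarrow> (g has_derivative E z) (at z)"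
    "\<And>z c v. z \<in> S \<Longrightarrow> E z (smul c v) = csm c * E z v" "\<And>z. z \<in> S \<Longrightarrow> E z (1, cvec \<mu>) = g' z"
    by (rule fholE) blast
  show ?thesis
    by (rule fholI[where D="\<lambda>z v. D z v + E z v"])
      (auto intro!: has_derivative_add D E simp: D(2,3) E(2,3) algebra_simps)
qed

lemma fhol_mult:
  assumes "fhol \<mu> f f' S" "fhol \<mu> g g' S"
  shows "fhol \<mu> (\<lambda>z. f z * g z) (\<lambda>z. f' z * g z + f z * g' z) S"
proof -
  from assms(1) obtain D where D: "\<And>z. z \<in> S \<Longrightarrow> (f has_derivative D z) (at z)"
    "\<And>z c v. z \<in> S \<Longrightarrow> D z (smul c v) = csm c * D z v" "\<And>z. z \<in> S \<Longrightarrow> D z (1, cvec \<mu>) = f' z"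
    by (rule fholE) blast
  from assms(2) obtain E where E: "\<And>z. z \<in> S \<Longrightarrow> (g has_derivative E z) (at z)"
    "\<And>z c v. z \<in> S \<Longrightarrow> E z (smul c v) = csm c * E z v" "\<And>z. z \<in> S \<Longrightarrow> E z (1, cvec \<mu>) = g' z"
    by (rule fholE) blast
  show ?thesis
  proof (rule fholI[where D="\<lambda>z v. f z * E z v + D z v * g z"])
    fix z c v assume z: "z \<in> S"
    have "f z * (csm c * E z v) = csm c * (f z * E z v)"
      by (metis csm_commute mult.assoc)
    then show "f z * E z (smul c v) + D z (smul c v) * g z = csm c * (f z * E z v + D z v * g z)"
      using z by (simp add: D(2) E(2) algebra_simps)
  qed (auto intro!: has_derivative_mult D E simp: D(3) E(3) algebra_simps)
qed

lemma fhol_linear: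
  assumes "fhol \<mu> f f' S" "bounded_linear L" "\<And>c x. L (csm c * x) = csm c * L x"
  shows "fhol \<mu> (\<lambda>z. L (f z)) (\<lambda>z. L (f' z)) S"
proof -
  from assms(1) obtain D where D: "\<And>z. z \<in> S \<Longrightarrow> (f has_derivative D z) (at z)"
    "\<And>z c v. z \<in> S \<Longrightarrow> D z (smul c v) = csm c * D z v" "\<And>z. z \<in> S \<Longrightarrow> D z (1, cvec \<mu>) = f' z"
    by (rule fholE) blast
  show ?thesis
    by (rule fholI[where D="\<lambda>z v. L (D z v)"])
      (auto intro!: bounded_linear.has_derivative[OF assms(2)] D simp: D(2,3) assms(3))
qed

section \<open>Cauchy estimates and termwise differentiation of series\<close>

lemma norm_cscaleV: "norm (cscaleV c v) = cmod c * norm v"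
  by (simp add: cscaleV_def norm_vec_def norm_mult L2_set_right_distrib)

lemma norm_smul: "norm (smul c v) = cmod c * norm v"
proof -
  have "norm (smul c v) = sqrt ((cmod c)\<^sup>2 * ((norm (fst v))\<^sup>2 + (norm (snd v))\<^sup>2))"
    by (simp add: smul_def norm_Pair norm_mult norm_cscaleV power_mult_distrib algebra_simps)
  then show ?thesis
    by (simp add: real_sqrt_mult norm_prod_def)
qed

lemma has_derivative_smul: "((\<lambda>s. smul s v) has_derivative (\<lambda>s. smul s v)) (at x)"
proof -
  have "bounded_linear (\<lambda>s. smul s v)"
    by (rule bounded_linear_intro[where K="norm v"])
      (auto simp: smul_def cscaleV_def vec_eq_iff algebra_simps norm_smul[unfolded smul_def] simp flip: scaleR_conv_of_real,
       metis norm_smul order_refl smul_def cscaleV_def)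
  then show ?thesis by (rule bounded_linear_imp_has_derivative)
qed

text \<open>Cauchy's estimate along the complex line through \<open>z\<close> in direction \<open>v\<close>.\<close>

lemma fhol_derivative_bound:
  fixes f :: "complex \<times> (complex^'d) \<Rightarrow> 'n::finite opmat"
  assumes f: "fhol \<mu> f f' (ball z r)" and "r > 0" "\<And>w. w \<in> ball z r \<Longrightarrow> norm (f w) \<le> b"
    and D: "(f has_derivative D) (at z)"
  shows "norm (D v) \<le> real (CARD('n))^2 * b * (2 / r) * norm v"
proof (cases "v = 0")
  case True
  then show ?thesis using has_derivative_bounded_linear[OF D] by (simp add: linear_simps)
next
  case False
  obtain E where E: "\<And>z'. z' \<in> ball z r \<Longrightarrow> (f has_derivative E z') (at z')"
    "\<And>z' c v. z' \<in> ball z r \<Longrightarrow> E z' (smul c v) = csm c * E z' v"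
    using f by (rule fholE) blast
  have EzD: "E z = D"
    using E(1)[of z] D \<open>r > 0\<close> has_derivative_unique by (metis centre_in_ball)
  \<comment> \<open>Radius of the disc of parameters \<open>s\<close> for which
    \<open>z + s v\<close> stays in the ball. Cauchy's inequality is used on half of it, whose
    closure is still inside; hence the factor 2. Summing over the entries costs
    \<open>CARD('n)^2\<close>.\<close>
  define \<delta> where "\<delta> = r / norm v"
  have \<delta>: "\<delta> > 0" using False \<open>r > 0\<close> by (simp add: \<delta>_def)
  have in_ball: "z + smul s v \<in> ball z r" if "s \<in> ball 0 \<delta>" for s
    using that False by (simp add: \<delta>_def dist_norm norm_smul field_simps)
  have entry: "cmod (mat_of (D v) $ i $ j) \<le> b * (2 / \<delta>)" for i j
  proof -
    define u where "u s = mat_of (f (z + smul s v)) $ i $ j" for s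
    have bl: "bounded_linear (\<lambda>M::'n opmat. mat_of M $ i $ j)"
      by (intro bounded_linear_compose[OF bounded_linear_vec_nth] bounded_linear_mat_of)
    have du: "(u has_field_derivative mat_of (E (z + smul s v) v) $ i $ j) (at s)"
      if s: "s \<in> ball 0 \<delta>" for s
    proof -
      have "((\<lambda>s. z + smul s v) has_derivative (\<lambda>s. smul s v)) (at s)"
        using has_derivative_add[OF has_derivative_const has_derivative_smul] by simp
      from has_derivative_compose[OF this E(1)[OF in_ball[OF s]]]
      have "((\<lambda>s. f (z + smul s v)) has_derivative (\<lambda>t. E (z + smul s v) (smul t v))) (at s)" .
      from bounded_linear.has_derivative[OF bl this]
      have "(u has_derivative (\<lambda>t. t * (mat_of (E (z + smul s v) v) $ i $ j))) (at s)"
        unfolding u_def using E(2)[OF in_ball[OF s]] by (simp add: mat_of_csm_mult)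
      then show ?thesis
        by (rule has_derivative_imp_has_field_derivative[OF _ refl])
    qed
    have smaller: "cball (0::complex) (\<delta>/2) \<subseteq> ball 0 \<delta>" using \<delta> by auto
    have hol: "u holomorphic_on ball 0 \<delta>"
      using du unfolding holomorphic_on_open[OF open_ball] by blast
    have "cmod ((deriv ^^ 1) u 0) \<le> fact 1 * b / (\<delta>/2)^1"
    proof (rule Cauchy_inequality)
      show "u holomorphic_on ball 0 (\<delta>/2)" using hol smaller by (meson ball_subset_cball holomorphic_on_subset)
      show "continuous_on (cball 0 (\<delta>/2)) u"
        using hol smaller by (meson holomorphic_on_imp_continuous_on holomorphic_on_subset)
      show "cmod (u x) \<le> b" if "cmod (0 - x) = \<delta>/2" for x
      proof -
        have "x \<in> ball 0 \<delta>" using that \<delta> by simp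
        from assms(3)[OF in_ball[OF this]] show ?thesis
          unfolding u_def using norm_entry_le order_trans by blast
      qed
    qed (use \<delta> in auto)
    moreover have "deriv u 0 = mat_of (D v) $ i $ j"
      using DERIV_imp_deriv[OF du[of 0]] \<delta> EzD by (simp add: smul_def cscaleV_def zero_prod_def[symmetric] zero_vec_def[symmetric])
    ultimately show ?thesis by simp
  qed
  have "norm (D v) \<le> (\<Sum>i\<in>(UNIV::'n set). \<Sum>j\<in>(UNIV::'n set). b * (2 / \<delta>))"
    using norm_opmat_le_sum[of "D v"] sum_mono[OF sum_mono[OF entry]] by (rule order_trans)
  then show ?thesis using False by (simp add: \<delta>_def power2_eq_square field_simps)
qed

text \<open>A summable bound on the values suffices: Cauchy's estimate converts it into a summable
  bound on the derivatives, uniform near each point, and this justifies differentiating term by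
  term.\<close>

lemma fhol_suminf:
  fixes f :: "nat \<Rightarrow> complex \<times> (complex^'d) \<Rightarrow> 'n::finite opmat"
  assumes S: "open S" and f: "\<And>n. fhol \<mu> (f n) (f' n) S"
    and b: "\<And>n w. w \<in> S \<Longrightarrow> norm (f n w) \<le> b n" and sb: "summable b"
  shows "fhol \<mu> (\<lambda>w. \<Sum>n. f n w) (\<lambda>w. \<Sum>n. f' n w) S"
proof -
  have "\<exists>D. \<forall>z\<in>S. (f n has_derivative D z) (at z) \<and>
    (\<forall>c v. D z (smul c v) = csm c * D z v) \<and> D z (1, cvec \<mu>) = f' n z" for n
    using f[of n] unfolding fhol_def by (rule bchoice)
  then obtain D where D': "\<And>n. \<forall>z\<in>S. (f n has_derivative D n z) (at z) \<and>
    (\<forall>c v. D n z (smul c v) = csm c * D n z v) \<and> D n z (1, cvec \<mu>) = f' n z"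
    by metis
  have D: "\<And>n z. z \<in> S \<Longrightarrow> (f n has_derivative D n z) (at z)"
    "\<And>n z c v. z \<in> S \<Longrightarrow> D n z (smul c v) = csm c * D n z v"
    "\<And>n z. z \<in> S \<Longrightarrow> D n z (1, cvec \<mu>) = f' n z"
    using D' by blast+
  show ?thesis
    unfolding fhol_def
  proof
    fix z assume z: "z \<in> S"
    obtain r2 where r2: "r2 > 0" "ball z r2 \<subseteq> S"
      by (rule openE[OF S z])
    \<comment> \<open>Half the radius, so that a ball of the same radius \<open>r\<close> around any
      point of \<open>ball z r\<close> still lies in \<open>S\<close>.\<close>
    define r where "r = r2 / 2"
    have r: "r > 0" "ball z (2*r) \<subseteq> S" using r2 by (simp_all add: r_def)
    define K where "K = real (CARD('n))^2 * (2 / r)"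
    have Db: "norm (D n x v) \<le> K * b n * norm v" if x: "x \<in> ball z r" for n x v
    proof -
      have "ball x r \<subseteq> ball z (2*r)"
        using x r(1) by (simp add: ball_subset_ball_iff dist_commute)
      then have sub: "ball x r \<subseteq> S" using r(2) by (rule order_trans)
      have xS: "x \<in> S" using subsetD[OF sub, of x] r(1) by simp
      have "norm (D n x v) \<le> real (CARD('n))^2 * b n * (2 / r) * norm v"
      proof (rule fhol_derivative_bound)
        show "fhol \<mu> (f n) (f' n) (ball x r)" by (rule fhol_subset[OF f sub])
        show "(f n has_derivative D n x) (at x)" by (rule D(1)[OF xS])
        show "norm (f n w) \<le> b n" if "w \<in> ball x r" for w by (rule b[OF subsetD[OF sub that]])
      qed (rule r(1))
      also have "\<dots> = K * b n * norm v" by (simp only: K_def mult_ac)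
      finally show ?thesis .
    qed
    have ballS: "ball z r \<subseteq> S" by (rule order_trans[OF subset_ball r(2)]) (use r(1) in simp)
    have sD: "summable (\<lambda>n. D n x v)" if x: "x \<in> ball z r" for x v
      by (rule summable_comparison_test'[where g="\<lambda>n. K * b n * norm v"])
        (use Db[OF x] sb in \<open>auto intro!: summable_mult summable_mult2\<close>)
    have "\<exists>g. \<forall>x\<in>ball z r. (\<lambda>n. f n x) sums (g x) \<and>
       (g has_derivative (\<lambda>v. \<Sum>n. D n x v)) (at x within ball z r)"
    proof (rule has_derivative_series)
      show "(f n has_derivative D n x) (at x within ball z r)" if "x \<in> ball z r" for n x
        using D(1) that ballS has_derivative_at_withinI by blast
      show "(\<lambda>n. f n z) sums (\<Sum>n. f n z)"
        by (rule summable_sums[OF summable_comparison_test'[OF sb, of 0]]) (use b z in auto)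
      fix e :: real assume e: "e > 0"
      have "summable (\<lambda>n. K * b n)" using sb by (rule summable_mult)
      then have "(\<lambda>n. \<Sum>i. K * b (i + n)) \<longlonglongrightarrow> 0"
        by (rule suminf_exist_split2)
      then have "\<forall>\<^sub>F n in sequentially. (\<Sum>i. K * b (i + n)) < e"
        using e by (rule order_tendstoD)
      then show "\<forall>\<^sub>F n in sequentially. \<forall>x\<in>ball z r. \<forall>h.
          norm ((\<Sum>i<n. D i x h) - (\<Sum>n. D n x h)) \<le> e * norm h"
      proof (rule eventually_mono, intro ballI allI)
        fix n x v assume n: "(\<Sum>i. K * b (i + n)) < e" and x: "x \<in> ball z r"
        have "norm ((\<Sum>i<n. D i x v) - (\<Sum>n. D n x v)) = norm (\<Sum>i. D (i + n) x v)"
          by (subst suminf_split_initial_segment[OF sD[OF x], where k=n]) (simp add: norm_minus_commute)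
        also have "\<dots> \<le> (\<Sum>i. K * b (i + n) * norm v)"
          by (rule norm_suminf_le)
            (use Db[OF x] sb in \<open>auto intro!: summable_mult summable_mult2 summable_ignore_initial_segment\<close>)
        also have "\<dots> = (\<Sum>i. K * b (i + n)) * norm v"
          by (rule suminf_mult2[symmetric]) (use sb in \<open>auto intro!: summable_mult summable_ignore_initial_segment\<close>)
        also have "\<dots> \<le> e * norm v" using n by (simp add: mult_right_mono)
        finally show "norm ((\<Sum>i<n. D i x v) - (\<Sum>n. D n x v)) \<le> e * norm v" .
      qed
    qed (use r in auto)
    then obtain g where g: "\<And>x. x \<in> ball z r \<Longrightarrow> (\<lambda>n. f n x) sums (g x)"
      "(g has_derivative (\<lambda>v. \<Sum>n. D n z v)) (at z within ball z r)"
      using r by (meson centre_in_ball)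
    have zb: "z \<in> ball z r" using r by simp
    have "((\<lambda>w. \<Sum>n. f n w) has_derivative (\<lambda>v. \<Sum>n. D n z v)) (at z)"
    proof (rule has_derivative_transform_within_open[where f=g])
      show "(g has_derivative (\<lambda>v. \<Sum>n. D n z v)) (at z)"
        using g(2) zb by (simp add: at_within_open[OF zb])
      show "g x = (\<Sum>n. f n x)" if "x \<in> ball z r" for x using g(1)[OF that] by (rule sums_unique)
    qed (use r in auto)
    moreover have "(\<Sum>n. D n z (smul c v)) = csm c * (\<Sum>n. D n z v)" for c v
      using D(2)[OF z] suminf_mult[OF sD[OF zb]] by simp
    moreover have "(\<Sum>n. D n z (1, cvec \<mu>)) = (\<Sum>n. f' n z)"
      using D(3)[OF z] by simp
    ultimately show "\<exists>D. ((\<lambda>w. \<Sum>n. f n w) has_derivative D) (at z) \<and>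
        (\<forall>c v. D (smul c v) = csm c * D v) \<and> D (1, cvec \<mu>) = (\<Sum>n. f' n z)" by blast
  qed
qed

section \<open>Power series and sums over the integers\<close>

text \<open>The derivative of the \<open>k\<close>-th power at \<open>y\<close> in direction
  \<open>z\<close>, that is, the sum of all words in which one of the \<open>k\<close> factors
  \<open>y\<close> is replaced by \<open>z\<close>. Since \<open>y\<close> and \<open>z\<close> need
  not commute the words stay distinct.\<close>

fun dpow :: "nat \<Rightarrow> 'a \<Rightarrow> 'a \<Rightarrow> 'a::real_normed_algebra_1" where
  "dpow 0 y z = 0"
| "dpow (Suc k) y z = z * y ^ k + y * dpow k y z"

lemma dpow_0_right [simp]: "dpow k y 0 = 0"
  by (induction k) auto

lemma norm_dpow_le:
  assumes "norm y \<le> r"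
  shows "norm (dpow k y z) \<le> real k * r ^ (k - 1) * norm z"
proof (induction k)
  case (Suc k)
  have r: "r \<ge> 0" using assms norm_ge_zero order_trans by blast
  have "norm (dpow (Suc k) y z) \<le> norm z * norm y ^ k + norm y * norm (dpow k y z)"
    by (simp, intro norm_triangle_le add_mono order_trans[OF norm_mult_ineq] mult_left_mono norm_power_ineq) auto
  also have "\<dots> \<le> norm z * r ^ k + r * (real k * r ^ (k - 1) * norm z)"
    using assms Suc r by (intro add_mono mult_mono power_mono) auto
  also have "r * (real k * r ^ (k - 1) * norm z) = real k * r ^ k * norm z"
    by (cases k) auto
  finally show ?case by (simp add: algebra_simps)
qed simp

lemma fhol_power:
  assumes "fhol \<mu> f f' S"
  shows "fhol \<mu> (\<lambda>w. f w ^ k) (\<lambda>w. dpow k (f w) (f' w)) S"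
proof (induction k)
  case 0
  show ?case by (simp add: fhol_const)
next
  case (Suc k)
  show ?case using fhol_mult[OF assms Suc] by simp
qed

text \<open>The generator of the flow contains a derivative of the inverse square root and must be
  holomorphic itself, so derivatives of powers are differentiated once more; only existence matters
  at this order.\<close>

lemma fhol_dpow:
  assumes "fhol \<mu> f f' S" "fhol \<mu> g g' S"
  shows "\<exists>p. fhol \<mu> (\<lambda>w. dpow k (f w) (g w)) p S"
proof (induction k)
  case 0
  show ?case by (auto intro: fhol_const)
next
  case (Suc k)
  then obtain p where p: "fhol \<mu> (\<lambda>w. dpow k (f w) (g w)) p S" by blast
  show ?case
    using fhol_add[OF fhol_mult[OF assms(2) fhol_power[OF assms(1), of k]] fhol_mult[OF assms(1) p]]
    by auto
qed

lemma fhol_scaleR: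
  assumes "fhol \<mu> f f' S"
  shows "fhol \<mu> (\<lambda>w. r *\<^sub>R f w) (\<lambda>w. r *\<^sub>R f' w) S"
  by (rule fhol_linear[OF assms bounded_linear_scaleR_right]) simp

lemma fhol_powser:
  fixes f :: "complex \<times> (complex^'d) \<Rightarrow> 'n::finite opmat"
  assumes "open S" "fhol \<mu> f f' S" "\<And>w. w \<in> S \<Longrightarrow> norm (f w) \<le> r"
    and "summable (\<lambda>k. \<bar>c k\<bar> * r ^ k)"
  shows "fhol \<mu> (\<lambda>w. \<Sum>k. c k *\<^sub>R f w ^ k) (\<lambda>w. \<Sum>k. c k *\<^sub>R dpow k (f w) (f' w)) S"
proof (rule fhol_suminf[OF assms(1) fhol_scaleR[OF fhol_power[OF assms(2)]] _ assms(4)])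
  fix n w assume "w \<in> S"
  then have "norm (f w ^ n) \<le> r ^ n"
    by (meson assms(3) norm_ge_zero norm_power_ineq order_trans power_mono)
  then show "norm (c n *\<^sub>R f w ^ n) \<le> \<bar>c n\<bar> * r ^ n"
    by (simp add: mult_left_mono)
qed

text \<open>In the termwise derivative every \<open>dpow k (f w) 0\<close> vanishes, which avoids
  the noncommutative formula for the derivative of \<open>exp\<close>. The intended \<open>f\<close>
  are functions constant along the flow.\<close>

lemma fhol_exp_flow_invariant:
  fixes f :: "complex \<times> (complex^'d) \<Rightarrow> 'n::finite opmat"
  assumes "open S" "fhol \<mu> f (\<lambda>_. 0) S" "\<And>w. w \<in> S \<Longrightarrow> norm (f w) \<le> r"
  shows "fhol \<mu> (\<lambda>w. exp (f w)) (\<lambda>_. 0) S"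
proof -
  have "summable (\<lambda>k. \<bar>inverse (fact k)\<bar> * r ^ k)"
    using summable_exp[of r] by (simp add: divide_inverse mult.commute)
  from fhol_powser[OF assms this] show ?thesis
    by (simp add: exp_def)
qed

lemma csm_split: "csm c = Re c *\<^sub>R 1 + Im c *\<^sub>R (csm \<i> :: 'n::finite opmat)"
proof -
  have "Re c *\<^sub>R 1 + Im c *\<^sub>R \<i> = c" by (simp add: complex_eq_iff)
  then show ?thesis by (metis csm_add csm_scaleR csm_1)
qed

text \<open>The exponent is split into its real and imaginary parts \<open>Re c A\<close> and
  \<open>Im c (i A)\<close>, which commute; each factor is an exponential with a real parameter, and
  the product rule reassembles a complex linear derivative.\<close>

lemma has_derivative_exp_csm:
  "((\<lambda>c. exp (csm c * A)) has_derivative (\<lambda>v. csm v * (A * exp (csm c * A)))) (at c)"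
  for A :: "'n::finite opmat"
proof -
  have split: "exp (csm c * A) = exp (Re c *\<^sub>R A) * exp (Im c *\<^sub>R (csm \<i> * A))" for c
  proof -
    have "csm c * A = Re c *\<^sub>R A + Im c *\<^sub>R (csm \<i> * A)"
      by (subst csm_split) (simp add: distrib_right)
    moreover have "(Re c *\<^sub>R A) * (Im c *\<^sub>R (csm \<i> * A)) = (Im c *\<^sub>R (csm \<i> * A)) * (Re c *\<^sub>R A)"
      using csm_commute[of \<i> A] by (simp add: mult.assoc)
    ultimately show ?thesis by (simp add: exp_add_commuting)
  qed
  have part: "((\<lambda>c. exp (g c *\<^sub>R B)) has_derivative (\<lambda>v. g v *\<^sub>R (exp (g c *\<^sub>R B) * B))) (at c)"
    if "bounded_linear g" for g :: "complex \<Rightarrow> real" and B :: "'n opmat"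
    using has_derivative_compose[OF bounded_linear_imp_has_derivative[OF that]
        exp_scaleR_has_vector_derivative_right[of B "g c" UNIV, unfolded has_vector_derivative_def]]
    by simp
  have "((\<lambda>c. exp (Re c *\<^sub>R A) * exp (Im c *\<^sub>R (csm \<i> * A))) has_derivative
     (\<lambda>v. exp (Re c *\<^sub>R A) * (Im v *\<^sub>R (exp (Im c *\<^sub>R (csm \<i> * A)) * (csm \<i> * A))) +
          Re v *\<^sub>R (exp (Re c *\<^sub>R A) * A) * exp (Im c *\<^sub>R (csm \<i> * A)))) (at c)"
    by (rule has_derivative_mult part bounded_linear_Re bounded_linear_Im)+
  moreover have "exp (Re c *\<^sub>R A) * (Im v *\<^sub>R (exp (Im c *\<^sub>R (csm \<i> * A)) * (csm \<i> * A))) +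
          Re v *\<^sub>R (exp (Re c *\<^sub>R A) * A) * exp (Im c *\<^sub>R (csm \<i> * A)) = csm v * (A * exp (csm c * A))" for v
  proof -
    let ?E = "exp (Re c *\<^sub>R A)" and ?F = "exp (Im c *\<^sub>R (csm \<i> * A))"
    have FB: "?F * (csm \<i> * A) = (csm \<i> * A) * ?F" by (rule exp_times_scaleR_commute)
    have EA: "?E * A = A * ?E" by (rule exp_times_scaleR_commute)
    have "?E * (?F * (csm \<i> * A)) = (?E * csm \<i>) * A * ?F"
      unfolding FB by (simp only: mult.assoc)
    also have "\<dots> = csm \<i> * (?E * A) * ?F"
      by (simp only: csm_commute[symmetric] mult.assoc)
    finally have "?E * (?F * (csm \<i> * A)) = csm \<i> * (A * (?E * ?F))"
      by (simp only: EA mult.assoc)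
    moreover have "?E * A * ?F = A * (?E * ?F)" by (simp only: EA mult.assoc)
    ultimately show ?thesis
      unfolding split csm_split[of v] by (simp add: distrib_right)
  qed
  ultimately show ?thesis unfolding split by simp
qed

lemma fhol_exp_csm_fst:
  fixes A :: "'n::finite opmat"
  shows "fhol \<mu> (\<lambda>w. exp (csm (fst w - c) * A)) (\<lambda>w. A * exp (csm (fst w - c) * A)) S"
proof (rule fholI[where D="\<lambda>z v. csm (fst v) * (A * exp (csm (fst z - c) * A))"])
  fix z :: "complex \<times> (complex^'d)"
  have "((\<lambda>w. fst w - c) has_derivative fst) (at z)"
    by (auto intro!: derivative_eq_intros)
  from has_derivative_compose[OF this has_derivative_exp_csm]
  show "((\<lambda>w. exp (csm (fst w - c) * A)) has_derivative
        (\<lambda>v. csm (fst v) * (A * exp (csm (fst z - c) * A)))) (at z)" .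
qed (simp_all add: smul_def csm_mult mult.assoc)

lemma fhol_csm_fst:
  fixes S :: "(complex \<times> (complex^'d)) set"
  assumes "\<And>w. w \<in> S \<Longrightarrow> (\<rho> has_field_derivative \<rho>' (fst w - c)) (at (fst w - c))"
  shows "fhol \<mu> (\<lambda>w. csm (\<rho> (fst w - c)) :: 'n::finite opmat) (\<lambda>w. csm (\<rho>' (fst w - c))) S"
proof (rule fholI[where D="\<lambda>z v. csm (\<rho>' (fst z - c) * fst v)"])
  fix z :: "complex \<times> (complex^'d)" assume z: "z \<in> S"
  have "((\<lambda>w. fst w - c) has_derivative fst) (at z)"
    by (auto intro!: derivative_eq_intros)
  from has_derivative_compose[OF this assms[OF z, unfolded has_field_derivative_def]]
  have "((\<lambda>w. \<rho> (fst w - c)) has_derivative (\<lambda>v. \<rho>' (fst z - c) * fst v)) (at z)" .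
  from bounded_linear.has_derivative[OF bounded_linear_csm this]
  show "((\<lambda>w. csm (\<rho> (fst w - c)) :: 'n opmat) has_derivative (\<lambda>v. csm (\<rho>' (fst z - c) * fst v))) (at z)" .
qed (simp_all add: smul_def mult.left_commute flip: csm_mult)


section \<open>Absolutely convergent series over the integers\<close>

definition isum :: "(int \<Rightarrow> 'a::banach) \<Rightarrow> 'a" where
  "isum f = (\<Sum>n. f (int_decode n))"

text \<open>Series along \<open>int_decode\<close> keep \<open>fhol_suminf\<close> applicable;
  absolute convergence makes the value independent of the enumeration, which is what permits shifts
  of the index.\<close>

definition zsummable :: "(int \<Rightarrow> 'a::banach) \<Rightarrow> bool" where
  "zsummable f \<longleftrightarrow> summable (\<lambda>n. norm (f (int_decode n)))"

lemma zsummable_D: "zsummable f \<Longrightarrow> summable (\<lambda>n. f (int_decode n))"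
  unfolding zsummable_def by (rule summable_norm_cancel)

lemma zsummable_iff: "zsummable f \<longleftrightarrow> (\<lambda>l. norm (f l)) summable_on UNIV"
proof -
  have "(\<lambda>l. norm (f l)) summable_on UNIV \<longleftrightarrow> (\<lambda>n. norm (f (int_decode n))) summable_on UNIV"
    using summable_on_reindex_bij_betw[OF bij_int_decode, of "\<lambda>l. norm (f l)"] by simp
  then show ?thesis
    unfolding zsummable_def by (simp add: summable_on_UNIV_nonneg_real_iff)
qed

lemma isum_eq_infsum: "zsummable f \<Longrightarrow> isum f = infsum f UNIV"
proof -
  assume "zsummable f"
  then have *: "summable (\<lambda>n. norm (f (int_decode n)))" by (simp add: zsummable_def)
  have "((\<lambda>n. f (int_decode n)) has_sum isum f) UNIV"
    unfolding isum_def
    by (rule norm_summable_imp_has_sum[OF * summable_sums[OF summable_norm_cancel[OF *]]])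
  then show ?thesis
    using has_sum_reindex_bij_betw[OF bij_int_decode, of f] by (metis infsumI)
qed

lemma zsummable_shift: "zsummable f \<Longrightarrow> zsummable (\<lambda>l. f (l + m))"
  using summable_on_reindex_bij_betw[of "\<lambda>l. l + m" UNIV UNIV "\<lambda>l. norm (f l)"]
  by (simp add: zsummable_iff bij_plus_right)

lemma isum_shift: "zsummable f \<Longrightarrow> isum (\<lambda>l. f (l + m)) = isum f"
  using infsum_reindex_bij_betw[of "\<lambda>l. l + m" UNIV UNIV f]
  by (simp add: isum_eq_infsum zsummable_shift bij_plus_right)

lemma isum_delta: "isum (\<lambda>l. if l = m then f l else 0) = f m"
proof -
  have "(\<lambda>n. if int_decode n = m then f (int_decode n) else 0) = (\<lambda>n. if n = int_encode m then f m else 0)"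
    by (auto simp: fun_eq_iff)
  then show ?thesis
    unfolding isum_def using sums_single[of "int_encode m" "\<lambda>_. f m"] sums_unique by metis
qed

text \<open>The comparison series of all estimates below: a bound \<open>c * wt l\<close> with
  \<open>c\<close> independent of \<open>l\<close> yields convergence and the bound
  \<open>c * isum wt\<close> at once.\<close>

definition wt :: "int \<Rightarrow> real" where "wt l = exp (- \<bar>real_of_int l\<bar>)"

lemma zsummable_wt: "zsummable wt"
proof -
  have s: "(\<lambda>n. exp (- real n)) summable_on UNIV"
  proof -
    have "summable (\<lambda>n. exp (-1::real) ^ n)" by (rule summable_geometric) simp
    then show ?thesis
      by (simp add: summable_on_UNIV_nonneg_real_iff exp_of_nat_mult[symmetric])
  qed
  have "(\<lambda>l. norm (wt l)) summable_on (int ` UNIV)"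
    by (subst summable_on_reindex) (use s in \<open>auto simp: inj_on_def wt_def o_def\<close>)
  moreover have "(\<lambda>l. norm (wt l)) summable_on ((\<lambda>n. - int n) ` UNIV)"
    by (subst summable_on_reindex) (use s in \<open>auto simp: inj_on_def wt_def o_def\<close>)
  ultimately have "(\<lambda>l. norm (wt l)) summable_on (int ` UNIV \<union> (\<lambda>n. - int n) ` UNIV)"
    by (rule summable_on_union)
  moreover have "int ` UNIV \<union> (\<lambda>n. - int n) ` UNIV = UNIV"
  proof -
    have "l \<in> int ` UNIV \<union> (\<lambda>n. - int n) ` UNIV" for l
      by (cases l rule: int_cases2) auto
    then show ?thesis by blast
  qed
  ultimately show ?thesis by (simp add: zsummable_iff)
qed

lemma zsummable_comparison:
  assumes "zsummable g" "\<And>l. norm (f l) \<le> c * norm (g l)"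
  shows "zsummable f"
  unfolding zsummable_def
  by (rule summable_comparison_test'[where g="\<lambda>n. c * norm (g (int_decode n))"])
    (use assms in \<open>auto simp: zsummable_def intro: summable_mult\<close>)

lemma norm_isum_le:
  assumes "\<And>l. norm (f l) \<le> c * wt l"
  shows "zsummable f" "norm (isum f) \<le> c * isum wt"
proof -
  have w: "norm (wt l) = wt l" for l by (simp add: wt_def)
  show z: "zsummable f"
    by (rule zsummable_comparison[OF zsummable_wt]) (use assms w in auto)
  have sw: "summable (\<lambda>n. wt (int_decode n))" by (rule zsummable_D[OF zsummable_wt])
  have "norm (isum f) \<le> (\<Sum>n. c * wt (int_decode n))"
    unfolding isum_def by (rule norm_suminf_le) (use assms sw in \<open>auto intro: summable_mult\<close>)
  also have "\<dots> = c * isum wt"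
    unfolding isum_def by (rule suminf_mult[OF sw])
  finally show "norm (isum f) \<le> c * isum wt" .
qed

lemma isum_add: "zsummable f \<Longrightarrow> zsummable g \<Longrightarrow> isum (\<lambda>l. f l + g l) = isum f + isum g"
  unfolding isum_def by (simp add: suminf_add zsummable_D)

lemma isum_diff: "zsummable f \<Longrightarrow> zsummable g \<Longrightarrow> isum (\<lambda>l. f l - g l) = isum f - isum g"
  unfolding isum_def by (simp add: suminf_diff zsummable_D)

lemma isum_linear: "bounded_linear L \<Longrightarrow> zsummable f \<Longrightarrow> isum (\<lambda>l. L (f l)) = L (isum f)"
  unfolding isum_def by (simp add: bounded_linear.suminf zsummable_D)

lemma fhol_isum:
  fixes f :: "int \<Rightarrow> complex \<times> (complex^'d) \<Rightarrow> 'n::finite opmat"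
  assumes "open S" "\<And>l. fhol \<mu> (f l) (f' l) S" "\<And>l w. w \<in> S \<Longrightarrow> norm (f l w) \<le> c * wt l"
  shows "fhol \<mu> (\<lambda>w. isum (\<lambda>l. f l w)) (\<lambda>w. isum (\<lambda>l. f' l w)) S"
  unfolding isum_def
  by (rule fhol_suminf[OF assms(1), where b="\<lambda>n. c * wt (int_decode n)"])
    (use assms zsummable_D[OF zsummable_wt] in \<open>auto intro: summable_mult\<close>)

section \<open>The inverse square root\<close>

abbreviation rsqrt_coeff :: "nat \<Rightarrow> real" where "rsqrt_coeff k \<equiv> (- 1 / 2) gchoose k"

text \<open>The binomial series of \<open>1 + y\<close> to the power \<open>- 1 / 2\<close>: the
  argument is the deviation from the identity.\<close>

definition rsqrt :: "'a::{real_normed_algebra_1,banach} \<Rightarrow> 'a" where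
  "rsqrt y = (\<Sum>k. rsqrt_coeff k *\<^sub>R y ^ k)"

definition drsqrt :: "'a::{real_normed_algebra_1,banach} \<Rightarrow> 'a \<Rightarrow> 'a" where
  "drsqrt y z = (\<Sum>k. rsqrt_coeff k *\<^sub>R dpow k y z)"

text \<open>Consecutive coefficients have the ratio \<open>(- 1 / 2 - k) / (k + 1)\<close>, of
  modulus at most 1.\<close>

lemma abs_rsqrt_coeff_le: "\<bar>rsqrt_coeff k\<bar> \<le> 1"
proof (induction k)
  case (Suc k)
  have "rsqrt_coeff (Suc k) = rsqrt_coeff k * ((- 1 / 2 - real k) / real (Suc k))"
    by (simp add: gbinomial_prod_rev field_simps prod.atLeast0_lessThan_Suc)
  moreover have "\<bar>(- 1 / 2 - real k) / real (Suc k)\<bar> \<le> 1" by (simp add: field_simps)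
  ultimately show ?case using Suc mult_mono[of "\<bar>rsqrt_coeff k\<bar>" 1 "\<bar>(- 1 / 2 - real k) / real (Suc k)\<bar>" 1]
    by (simp add: abs_mult)
qed simp

lemma norm_rsqrt_term_le:
  fixes y :: "'a::{real_normed_algebra_1,banach}"
  shows "norm (rsqrt_coeff k *\<^sub>R y ^ k) \<le> norm y ^ k"
  using mult_mono[OF abs_rsqrt_coeff_le[of k] norm_power_ineq[of y k]] by simp

text \<open>The derivative of the geometric series at \<open>1 / 2\<close> is
  \<open>1 / (1 - 1 / 2)^2 = 4\<close>.\<close>

lemma sums_drsqrt_bound: "(\<lambda>k. real k * (1/2) ^ (k - 1) * b) sums (4 * b)"
proof -
  have "(\<lambda>k. real (Suc k) * (1/2) ^ k) sums 4"
    using geometric_deriv_sums[of "1/2 :: real"] by (simp add: power2_eq_square)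
  then have "(\<lambda>k. real (Suc k) * (1/2) ^ (Suc k - 1)) sums 4" by simp
  then have "(\<lambda>k. real k * (1/2) ^ (k - 1)) sums 4"
    by (subst (asm) sums_Suc_iff) simp
  then show ?thesis by (rule sums_mult2)
qed

context
  fixes y :: "'a::{real_normed_algebra_1,banach}"
  assumes y: "norm y \<le> 1 / 2"
begin

lemma summable_norm_power: "summable (\<lambda>k. norm y ^ k)"
  using y by (intro summable_geometric) auto

lemma summable_rsqrt_norm: "summable (\<lambda>k. norm (rsqrt_coeff k *\<^sub>R y ^ k))"
  by (rule summable_comparison_test'[OF summable_norm_power, of 0])
    (use norm_rsqrt_term_le[of _ y] in simp)

lemmas summable_rsqrt = summable_norm_cancel[OF summable_rsqrt_norm]

lemma rsqrt_commute: "rsqrt y * y = y * rsqrt y"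
proof -
  have "rsqrt y * y = (\<Sum>k. (rsqrt_coeff k *\<^sub>R y ^ k) * y)"
    unfolding rsqrt_def by (rule suminf_mult2[OF summable_rsqrt])
  also have "\<dots> = (\<Sum>k. y * (rsqrt_coeff k *\<^sub>R y ^ k))"
    by (simp add: power_commutes)
  also have "\<dots> = y * rsqrt y"
    unfolding rsqrt_def by (rule suminf_mult[OF summable_rsqrt])
  finally show ?thesis .
qed

text \<open>In the Cauchy product Vandermonde's identity turns the convolved coefficients into
  \<open>- 1 gchoose k = (- 1) ^ k\<close>, so the square is the geometric series for the inverse of
  \<open>1 + y\<close>. Only powers of one element occur, so noncommutativity does no harm.\<close>

lemma rsqrt_square_mult: "rsqrt y * rsqrt y * (1 + y) = 1"
proof -
  have "rsqrt y * rsqrt y = (\<Sum>k. \<Sum>i\<le>k. (rsqrt_coeff i *\<^sub>R y ^ i) * (rsqrt_coeff (k - i) *\<^sub>R y ^ (k - i)))"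
    unfolding rsqrt_def by (rule Cauchy_product[OF summable_rsqrt_norm summable_rsqrt_norm])
  also have "\<dots> = (\<Sum>k. (- y) ^ k)"
  proof (rule suminf_cong)
    fix k
    have "(\<Sum>i\<le>k. (rsqrt_coeff i *\<^sub>R y ^ i) * (rsqrt_coeff (k - i) *\<^sub>R y ^ (k - i)))
      = (\<Sum>i\<le>k. (rsqrt_coeff i * rsqrt_coeff (k - i)) *\<^sub>R y ^ k)"
      by (intro sum.cong) (auto simp flip: power_add)
    also have "\<dots> = (\<Sum>i\<le>k. rsqrt_coeff i * rsqrt_coeff (k - i)) *\<^sub>R y ^ k"
      by (simp add: scaleR_sum_left)
    also have "(\<Sum>i\<le>k. rsqrt_coeff i * rsqrt_coeff (k - i)) = (- 1 gchoose k)"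
      using gbinomial_Vandermonde[of "-1/2 :: real" "-1/2" k] by (simp add: atLeast0AtMost)
    also have "(- 1 gchoose k :: real) = (- 1) ^ k"
      using gbinomial_minus[of "1::real" k] by (simp flip: binomial_gbinomial)
    also have "((- 1) ^ k) *\<^sub>R y ^ k = (- y) ^ k"
      using scaleR_power[of "-1" y k] by simp
    finally show "(\<Sum>i\<le>k. (rsqrt_coeff i *\<^sub>R y ^ i) * (rsqrt_coeff (k - i) *\<^sub>R y ^ (k - i))) = (- y) ^ k" .
  qed
  finally have R2: "rsqrt y * rsqrt y = (\<Sum>k. (- y) ^ k)" .
  have np: "norm ((- y) ^ k) \<le> norm y ^ k" for k
    using norm_power_ineq[of "- y" k] by simp
  have s: "summable (\<lambda>k. (- y) ^ k)"
    by (rule summable_norm_cancel, rule summable_comparison_test'[OF summable_norm_power, of 0]) (use np in simp)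
  have "(\<lambda>k. (- y) ^ k) \<longlonglongrightarrow> 0" by (rule summable_LIMSEQ_zero[OF s])
  from telescope_sums'[OF this]
  have "(\<lambda>k. (- y) ^ k * (1 + y)) sums 1"
    using power_commutes[of "- y"] by (simp add: algebra_simps)
  moreover have "(\<lambda>k. (- y) ^ k * (1 + y)) sums ((\<Sum>k. (- y) ^ k) * (1 + y))"
    by (intro sums_mult2 summable_sums s)
  ultimately show ?thesis unfolding R2 by (rule sums_unique2[symmetric])
qed

lemma rsqrt_conj: "rsqrt y * (1 + y) * rsqrt y = 1"
proof -
  have "(1 + y) * rsqrt y = rsqrt y * (1 + y)"
    using rsqrt_commute by (simp add: algebra_simps)
  then show ?thesis using rsqrt_square_mult by (simp add: mult.assoc)
qed

lemma norm_rsqrt_minus_1: "norm (rsqrt y - 1) \<le> 2 * norm y"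
proof -
  have "rsqrt y - 1 = (\<Sum>k. rsqrt_coeff (k + 1) *\<^sub>R y ^ (k + 1))"
    unfolding rsqrt_def using suminf_minus_initial_segment[OF summable_rsqrt, of 1] by simp
  also have "norm \<dots> \<le> (\<Sum>k. norm y * (1/2) ^ k)"
  proof (rule norm_suminf_le)
    fix k
    have "norm (rsqrt_coeff (k + 1) *\<^sub>R y ^ (k + 1)) \<le> norm y * norm y ^ k"
      using norm_rsqrt_term_le[of "k+1" y] by simp
    also have "\<dots> \<le> norm y * (1/2) ^ k" using y by (intro mult_left_mono power_mono) auto
    finally show "norm (rsqrt_coeff (k + 1) *\<^sub>R y ^ (k + 1)) \<le> norm y * (1/2) ^ k" .
  qed (intro summable_mult summable_geometric, simp)
  also have "\<dots> = norm y * 2"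
    by (subst suminf_mult) (auto intro!: summable_geometric simp: suminf_geometric)
  finally show ?thesis by simp
qed

lemma norm_drsqrt_term_le: "norm (rsqrt_coeff k *\<^sub>R dpow k y z) \<le> real k * (1/2) ^ (k - 1) * norm z"
  using mult_mono[OF abs_rsqrt_coeff_le[of k] norm_dpow_le[OF y, of k z]] by simp

lemma norm_drsqrt_le: "norm (drsqrt y z) \<le> 4 * norm z"
  unfolding drsqrt_def sums_unique[OF sums_drsqrt_bound[of "norm z"]]
  by (rule norm_suminf_le[OF norm_drsqrt_term_le sums_summable[OF sums_drsqrt_bound]])

end

lemma rsqrt_0 [simp]: "rsqrt 0 = (1 :: 'a::{real_normed_algebra_1,banach})"
proof -
  have "(\<lambda>k. rsqrt_coeff k *\<^sub>R (0::'a) ^ k) = (\<lambda>k. if k = 0 then 1 else 0)"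
    by (auto simp: fun_eq_iff power_0_left)
  then show ?thesis unfolding rsqrt_def using sums_single[of 0 "\<lambda>_. 1::'a"] sums_unique
    by (metis (mono_tags, lifting))
qed

lemma fhol_rsqrt:
  fixes f :: "complex \<times> (complex^'d) \<Rightarrow> 'n::finite opmat"
  assumes "open S" "fhol \<mu> f f' S" "\<And>w. w \<in> S \<Longrightarrow> norm (f w) \<le> 1/2"
  shows "fhol \<mu> (\<lambda>w. rsqrt (f w)) (\<lambda>w. drsqrt (f w) (f' w)) S"
  unfolding rsqrt_def drsqrt_def
proof (rule fhol_powser[OF assms])
  show "summable (\<lambda>k. \<bar>rsqrt_coeff k\<bar> * (1 / 2) ^ k)"
  proof (rule summable_comparison_test'[of "\<lambda>k. (1/2) ^ k" 0])
    show "norm (\<bar>rsqrt_coeff k\<bar> * (1 / 2) ^ k) \<le> (1 / 2) ^ k" for k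
      using mult_right_mono[OF abs_rsqrt_coeff_le[of k], of "(1 / 2) ^ k"] by (simp add: abs_mult)
  qed (auto intro: summable_geometric)
qed

lemma fhol_drsqrt:
  fixes f :: "complex \<times> (complex^'d) \<Rightarrow> 'n::finite opmat"
  assumes "open S" "fhol \<mu> f f' S" "\<And>w. w \<in> S \<Longrightarrow> norm (f w) \<le> 1/2"
    and g: "fhol \<mu> g g' S" "\<And>w. w \<in> S \<Longrightarrow> norm (g w) \<le> b"
  shows "\<exists>p. fhol \<mu> (\<lambda>w. drsqrt (f w) (g w)) p S"
proof -
  obtain p where p: "\<And>k. fhol \<mu> (\<lambda>w. dpow k (f w) (g w)) (p k) S"
    using fhol_dpow[OF assms(2) g(1)] by metis
  have "fhol \<mu> (\<lambda>w. drsqrt (f w) (g w)) (\<lambda>w. \<Sum>k. rsqrt_coeff k *\<^sub>R p k w) S"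
    unfolding drsqrt_def
  proof (rule fhol_suminf[OF assms(1) fhol_scaleR[OF p], where b="\<lambda>k. real k * (1/2) ^ (k - 1) * norm b"])
    fix k w assume w: "w \<in> S"
    have "norm (rsqrt_coeff k *\<^sub>R dpow k (f w) (g w)) \<le> real k * (1/2) ^ (k - 1) * norm (g w)"
      by (rule norm_drsqrt_term_le[OF assms(3)[OF w]])
    also have "\<dots> \<le> real k * (1/2) ^ (k - 1) * norm b"
      using g(2)[OF w] by (intro mult_left_mono) auto
    finally show "norm (rsqrt_coeff k *\<^sub>R dpow k (f w) (g w)) \<le> real k * (1/2) ^ (k - 1) * norm b" .
  qed (rule sums_summable[OF sums_drsqrt_bound])
  then show ?thesis by blast
qed

section \<open>A rapidly decaying cardinal partition of unity\<close>

text \<open>Faster than every exponential on every horizontal strip: the width and the rate can be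
  fixed later, when \<open>h\<close> and the size of \<open>A\<close> are known.\<close>

definition strip_decay :: "(complex \<Rightarrow> complex) \<Rightarrow> bool" where
  "strip_decay f \<longleftrightarrow> (\<forall>H k. \<exists>C\<ge>0. \<forall>t. \<bar>Im t\<bar> \<le> H \<longrightarrow> cmod (f t) \<le> C * exp (- k * cmod t))"

lemma strip_decayE:
  assumes "strip_decay f"
  obtains C where "C \<ge> 0" "\<And>t. \<bar>Im t\<bar> \<le> H \<Longrightarrow> cmod (f t) \<le> C * exp (- k * cmod t)"
  using assms unfolding strip_decay_def by blast

text \<open>Moving by at most \<open>r\<close> changes an exponential weight only by a constant
  factor. The hypothesis on \<open>g\<close> covers derivatives (Cauchy's inequality), increments of
  a primitive (mean value bound) and constant multiples (\<open>r = 0\<close>).\<close>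

lemma strip_decay_near:
  assumes f: "strip_decay f" and r: "r \<ge> 0"
    and g: "\<And>t B. (\<And>z. z \<in> cball t r \<Longrightarrow> cmod (f z) \<le> B) \<Longrightarrow> cmod (g t) \<le> c * B" and c: "c \<ge> 0"
  shows "strip_decay g"
  unfolding strip_decay_def
proof (intro allI)
  fix H k :: real
  \<comment> \<open>The triangle inequality is multiplied by the rate, which must therefore be
    nonnegative; decay at rate \<open>m\<close> implies decay at rate \<open>k\<close>.\<close>
  define m where "m = max k 0"
  obtain C where C: "C \<ge> 0" "\<And>t. \<bar>Im t\<bar> \<le> H + r \<Longrightarrow> cmod (f t) \<le> C * exp (- m * cmod t)"
    by (rule strip_decayE[OF f]) blast
  show "\<exists>C\<ge>0. \<forall>t. \<bar>Im t\<bar> \<le> H \<longrightarrow> cmod (g t) \<le> C * exp (- k * cmod t)"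
  proof (intro exI[of _ "c * (C * exp (m * r))"] conjI allI impI)
    fix t assume t: "\<bar>Im t\<bar> \<le> H"
    have "cmod (g t) \<le> c * (C * exp (m * r) * exp (- m * cmod t))"
    proof (rule g)
      fix z assume z: "z \<in> cball t r"
      then have d: "cmod (t - z) \<le> r" by (simp add: dist_norm)
      have "\<bar>Im z\<bar> \<le> H + r" using t d abs_Im_le_cmod[of "t - z"] by simp
      then have "cmod (f z) \<le> C * exp (- m * cmod z)" by (rule C(2))
      also have "cmod t \<le> cmod z + r" using d norm_triangle_sub[of t z] by linarith
      then have "m * cmod t \<le> m * (cmod z + r)" by (rule mult_left_mono) (simp add: m_def)
      then have "C * exp (- m * cmod z) \<le> C * exp (m * r + - m * cmod t)"
        using C(1) by (intro mult_left_mono) (auto simp: algebra_simps)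
      finally show "cmod (f z) \<le> C * exp (m * r) * exp (- m * cmod t)"
        unfolding exp_add by (simp only: mult.assoc)
    qed
    also have "exp (- m * cmod t) \<le> exp (- k * cmod t)" by (simp add: m_def mult_right_mono)
    finally show "cmod (g t) \<le> c * (C * exp (m * r)) * exp (- k * cmod t)"
      using C(1) c by (simp add: mult.assoc mult_left_mono)
  qed (use C c in auto)
qed

lemma strip_decay_deriv:
  assumes "strip_decay f" "f holomorphic_on UNIV"
  shows "strip_decay (deriv f)"
proof (rule strip_decay_near[OF assms(1), of 1 _ 1])
  fix t B assume B: "\<And>z. z \<in> cball t 1 \<Longrightarrow> cmod (f z) \<le> B"
  have "cmod ((deriv ^^ 1) f t) \<le> fact 1 * B / 1 ^ 1"
  proof (rule Cauchy_inequality)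
    show "f holomorphic_on ball t 1" "continuous_on (cball t 1) f"
      using assms(2) by (auto intro: holomorphic_on_subset holomorphic_on_imp_continuous_on)
  qed (use B in \<open>auto simp: dist_norm\<close>)
  then show "cmod (deriv f t) \<le> 1 * B" by simp
qed auto

text \<open>The modulus is \<open>exp ((Im t)^2 - (Re t)^2)\<close>, and completing the square
  absorbs any linear term \<open>m |Re t|\<close> at the cost of \<open>m^2 / 4\<close>.\<close>

lemma strip_decay_gauss: "strip_decay (\<lambda>t. exp (- t\<^sup>2))"
  unfolding strip_decay_def
proof (intro allI)
  fix H k :: real
  define m where "m = max k 0"
  have m: "m \<ge> 0" "k \<le> m" by (auto simp: m_def)
  show "\<exists>C\<ge>0. \<forall>t. \<bar>Im t\<bar> \<le> H \<longrightarrow> cmod (exp (- t\<^sup>2)) \<le> C * exp (- k * cmod t)"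
  proof (intro exI[of _ "exp (H\<^sup>2 + m * H + m\<^sup>2 / 4)"] conjI allI impI)
    fix t :: complex assume t: "\<bar>Im t\<bar> \<le> H"
    have "(Im t)\<^sup>2 \<le> H\<^sup>2" using t by (metis abs_ge_zero power2_abs power_mono)
    moreover have "k * cmod t \<le> m * (\<bar>Re t\<bar> + H)"
      using m t cmod_le[of t] by (intro mult_mono) auto
    moreover have "m * \<bar>Re t\<bar> \<le> (Re t)\<^sup>2 + m\<^sup>2 / 4"
      using zero_le_power2[of "\<bar>Re t\<bar> - m / 2"] by (simp add: power2_diff algebra_simps power2_eq_square)
    ultimately have "(Im t)\<^sup>2 - (Re t)\<^sup>2 \<le> H\<^sup>2 + m * H + m\<^sup>2 / 4 + - k * cmod t"
      by (simp add: algebra_simps)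
    then show "cmod (exp (- t\<^sup>2)) \<le> exp (H\<^sup>2 + m * H + m\<^sup>2 / 4) * exp (- k * cmod t)"
      by (simp add: Re_power2 flip: exp_add)
  qed auto
qed

lemma strip_decay_diff:
  assumes f: "strip_decay f" and g: "strip_decay g"
  shows "strip_decay (\<lambda>t. f t - g t)"
  unfolding strip_decay_def
proof (intro allI)
  fix H k :: real
  obtain A where A: "A \<ge> 0" "\<And>t. \<bar>Im t\<bar> \<le> H \<Longrightarrow> cmod (f t) \<le> A * exp (- k * cmod t)"
    by (rule strip_decayE[OF f]) blast
  obtain B where B: "B \<ge> 0" "\<And>t. \<bar>Im t\<bar> \<le> H \<Longrightarrow> cmod (g t) \<le> B * exp (- k * cmod t)"
    by (rule strip_decayE[OF g]) blast
  show "\<exists>C\<ge>0. \<forall>t. \<bar>Im t\<bar> \<le> H \<longrightarrow> cmod (f t - g t) \<le> C * exp (- k * cmod t)"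
  proof (intro exI[of _ "A + B"] conjI allI impI)
    fix t assume t: "\<bar>Im t\<bar> \<le> H"
    show "cmod (f t - g t) \<le> (A + B) * exp (- k * cmod t)"
      using norm_triangle_ineq4[of "f t" "g t"] A(2)[OF t] B(2)[OF t] by (simp add: distrib_right)
  qed (use A B in auto)
qed

lemma strip_decay_translate:
  assumes "strip_decay f"
  shows "\<exists>c\<ge>0. \<forall>t l. cmod t \<le> N \<longrightarrow> cmod (f (t - of_int l)) \<le> c * wt l"
proof -
  obtain C where C: "C \<ge> 0" "\<And>s. \<bar>Im s\<bar> \<le> N \<Longrightarrow> cmod (f s) \<le> C * exp (- 1 * cmod s)"
    by (rule strip_decayE[OF assms]) blast
  show ?thesis
  proof (intro exI[of _ "C * exp N"] conjI allI impI)
    fix t :: complex and l assume t: "cmod t \<le> N"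
    have "cmod (f (t - of_int l)) \<le> C * exp (- 1 * cmod (t - of_int l))"
      using abs_Im_le_cmod[of t] t by (intro C(2)) simp
    also have "\<dots> \<le> C * exp (N + - \<bar>real_of_int l\<bar>)"
      using norm_triangle_ineq2[of "of_int l" t] C(1) t
      by (intro mult_left_mono) (auto simp: norm_minus_commute)
    finally show "cmod (f (t - of_int l)) \<le> C * exp N * wt l"
      unfolding wt_def exp_add by (simp only: mult.assoc)
  qed (use C in auto)
qed

lemma zsummable_strip_decay:
  assumes "strip_decay f"
  shows "zsummable (\<lambda>l. f (t - of_int l))"
proof -
  obtain c where "\<And>l. cmod (f (t - of_int l)) \<le> c * wt l"
    using strip_decay_translate[OF assms, of "cmod t"] by blast
  then show ?thesis by (rule norm_isum_le(1))
qed

lemma strip_decay_isum: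
  assumes d: "strip_decay (\<lambda>t. D t)" and K: "strip_decay K"
  shows "strip_decay (\<lambda>t. isum (\<lambda>n. D (of_int n) * K (t - of_int n)))"
  unfolding strip_decay_def
proof (intro allI)
  fix H k :: real
  define m where "m = max k 0"
  have m: "m \<ge> 0" "k \<le> m" by (auto simp: m_def)
  \<comment> \<open>The rate \<open>m\<close> pays for
    \<open>cmod t \<le> |n| + cmod (t - n)\<close>; the additional unit is left over as
    \<open>wt n\<close> and makes the sum over \<open>n\<close> converge.\<close>
  obtain A where A: "A \<ge> 0" "\<And>t. \<bar>Im t\<bar> \<le> 0 \<Longrightarrow> cmod (D t) \<le> A * exp (- (m + 1) * cmod t)"
    by (rule strip_decayE[OF d]) blast
  obtain C where C: "C \<ge> 0" "\<And>t. \<bar>Im t\<bar> \<le> H \<Longrightarrow> cmod (K t) \<le> C * exp (- m * cmod t)"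
    by (rule strip_decayE[OF K]) blast
  show "\<exists>C\<ge>0. \<forall>t. \<bar>Im t\<bar> \<le> H \<longrightarrow> cmod (isum (\<lambda>n. D (of_int n) * K (t - of_int n))) \<le> C * exp (- k * cmod t)"
  proof (intro exI[of _ "A * C * \<bar>isum wt\<bar>"] conjI allI impI)
    fix t assume t: "\<bar>Im t\<bar> \<le> H"
    have "cmod (D (of_int n) * K (t - of_int n)) \<le> (A * C * exp (- m * cmod t)) * wt n" for n
    proof -
      have "cmod (D (of_int n)) * cmod (K (t - of_int n)) \<le>
         (A * exp (- (m + 1) * \<bar>real_of_int n\<bar>)) * (C * exp (- m * cmod (t - of_int n)))"
        using A(2)[of "of_int n"] C(2)[of "t - of_int n"] t A(1) C(1) by (intro mult_mono) auto
      also have "\<dots> = A * C * exp (- \<bar>real_of_int n\<bar> - m * (\<bar>real_of_int n\<bar> + cmod (t - of_int n)))"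
        by (simp add: algebra_simps flip: exp_add)
      also have "\<dots> \<le> A * C * exp (- \<bar>real_of_int n\<bar> - m * cmod t)"
      proof -
        have "cmod t \<le> \<bar>real_of_int n\<bar> + cmod (t - of_int n)"
          using norm_triangle_sub[of t "of_int n"] by simp
        then have "m * cmod t \<le> m * (\<bar>real_of_int n\<bar> + cmod (t - of_int n))"
          using m by (intro mult_left_mono) auto
        then show ?thesis using A(1) C(1) by (intro mult_left_mono) auto
      qed
      also have "\<dots> = (A * C * exp (- m * cmod t)) * wt n"
        by (simp add: wt_def mult.assoc flip: exp_add)
      finally show ?thesis by (simp add: norm_mult)
    qed
    then have "cmod (isum (\<lambda>n. D (of_int n) * K (t - of_int n))) \<le> (A * C * exp (- m * cmod t)) * isum wt"
      by (rule norm_isum_le(2))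
    also have "\<dots> \<le> (A * C * \<bar>isum wt\<bar>) * exp (- m * cmod t)"
      using mult_left_mono[OF abs_ge_self[of "isum wt"], of "A * C * exp (- m * cmod t)"] A(1) C(1)
      by (simp add: mult_ac)
    also have "\<dots> \<le> (A * C * \<bar>isum wt\<bar>) * exp (- k * cmod t)"
      using m A(1) C(1) by (intro mult_left_mono) (auto simp: mult_right_mono)
    finally show "cmod (isum (\<lambda>n. D (of_int n) * K (t - of_int n))) \<le> A * C * \<bar>isum wt\<bar> * exp (- k * cmod t)" .
  qed (use A C in auto)
qed

text \<open>The majorant may depend on the disc: for translates of a decaying function its constant
  grows with the distance of \<open>t\<close> from the origin.\<close>

lemma has_field_derivative_isum:
  assumes f: "\<And>n. f n holomorphic_on UNIV"
    and b: "\<And>N. \<exists>c\<ge>0. \<forall>t n. cmod t < N \<longrightarrow> cmod (f n t) \<le> c * wt n"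
  shows "((\<lambda>t. isum (\<lambda>n. f n t)) has_field_derivative isum (\<lambda>n. deriv (f n) x)) (at x)"
proof -
  have "\<exists>g g'. \<forall>x\<in>UNIV. ((\<lambda>n. f (int_decode n) x) sums g x) \<and>
       ((\<lambda>n. deriv (f (int_decode n)) x) sums g' x) \<and> (g has_field_derivative g' x) (at x)"
    proof (rule series_and_derivative_comparison_complex)
      show "(f (int_decode n) has_field_derivative deriv (f (int_decode n)) x) (at x)" for n x
        using f holomorphic_derivI open_UNIV UNIV_I by blast
      fix x :: complex
      obtain c where c: "c \<ge> 0" "\<And>t n. cmod t < cmod x + 1 \<Longrightarrow> cmod (f n t) \<le> c * wt n"
        using b by blast
      show "\<exists>d h. 0 < d \<and> summable h \<and> range h \<subseteq> \<real>\<^sub>\<ge>\<^sub>0 \<and>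
         (\<forall>\<^sub>F n in sequentially. \<forall>y\<in>ball x d \<inter> UNIV. cmod (f (int_decode n) y) \<le> cmod (h n))"
      proof (intro exI[of _ "1::real"] exI[of _ "\<lambda>n. of_real (c * wt (int_decode n)) :: complex"] conjI)
        show "summable (\<lambda>n. of_real (c * wt (int_decode n)) :: complex)"
          by (intro summable_of_real summable_mult zsummable_D[OF zsummable_wt])
        show "range (\<lambda>n. of_real (c * wt (int_decode n)) :: complex) \<subseteq> \<real>\<^sub>\<ge>\<^sub>0"
          using c(1) by (auto simp: wt_def)
        have "cmod y < cmod x + 1" if "y \<in> ball x 1" for y
          using that norm_triangle_sub[of y x] by (simp add: dist_norm norm_minus_commute)
        then show "\<forall>\<^sub>F n in sequentially. \<forall>y\<in>ball x 1 \<inter> UNIV. cmod (f (int_decode n) y) \<le>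
            cmod (of_real (c * wt (int_decode n)) :: complex)"
          using c by (intro always_eventually) (auto simp: wt_def norm_mult)
      qed auto
    qed simp
  then obtain g g' where g: "\<And>x. (\<lambda>n. f (int_decode n) x) sums g x"
    "\<And>x. (\<lambda>n. deriv (f (int_decode n)) x) sums g' x" "\<And>x. (g has_field_derivative g' x) (at x)"
    by blast
  have "isum (\<lambda>n. f n t) = g t" "isum (\<lambda>n. deriv (f n) t) = g' t" for t
    unfolding isum_def using g(1,2)[of t] by (auto simp: sums_iff)
  then show ?thesis using g(3) by simp
qed

lemma holomorphic_isum:
  assumes "\<And>n. f n holomorphic_on UNIV"
    and "\<And>N. \<exists>c\<ge>0. \<forall>t n. cmod t < N \<longrightarrow> cmod (f n t) \<le> c * wt n"
  shows "(\<lambda>t. isum (\<lambda>n. f n t)) holomorphic_on UNIV"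
  using has_field_derivative_isum[OF assms] by (auto simp: holomorphic_on_open)

text \<open>Termwise differentiation of a constant. Because of this cancellation the blend weighted
  by the derivative of \<rho> has no term of order zero and is itself of the size of
  \<open>G\<close>.\<close>

lemma isum_deriv_translates_eq_0:
  assumes \<rho>: "\<rho> holomorphic_on UNIV" "strip_decay \<rho>" and c: "\<And>t. isum (\<lambda>l. \<rho> (t - of_int l)) = c"
  shows "isum (\<lambda>l. deriv \<rho> (t - of_int l)) = 0"
proof -
  have d: "((\<lambda>t. \<rho> (t - of_int l)) has_field_derivative deriv \<rho> (t - of_int l)) (at t)" for l t
  proof -
    have "((\<lambda>t. t - of_int l) has_field_derivative 1) (at t)"
      by (auto intro!: derivative_eq_intros)
    from DERIV_chain2[OF holomorphic_derivI[OF \<rho>(1) open_UNIV UNIV_I] this] show ?thesis by simp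
  qed
  have "((\<lambda>t. isum (\<lambda>l. \<rho> (t - of_int l))) has_field_derivative
      isum (\<lambda>l. deriv (\<lambda>t. \<rho> (t - of_int l)) t)) (at t)"
  proof (rule has_field_derivative_isum)
    show "(\<lambda>t. \<rho> (t - of_int l)) holomorphic_on UNIV" for l
      using d by (auto simp: holomorphic_on_open)
    show "\<exists>c\<ge>0. \<forall>t l. cmod t < N \<longrightarrow> cmod (\<rho> (t - of_int l)) \<le> c * wt l" for N
      using strip_decay_translate[OF \<rho>(2), of N] less_imp_le by blast
  qed
  then have "((\<lambda>t. c) has_field_derivative isum (\<lambda>l. deriv \<rho> (t - of_int l))) (at t)"
    by (simp add: c DERIV_imp_deriv[OF d])
  then show ?thesis using DERIV_const DERIV_unique by blast
qed

lemma isum_swap: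
  fixes f :: "int \<Rightarrow> int \<Rightarrow> 'a::banach"
  assumes "\<And>l n. norm (f l n) \<le> c * wt l * wt n"
  shows "isum (\<lambda>l. isum (\<lambda>n. f l n)) = isum (\<lambda>n. isum (\<lambda>l. f l n))"
proof -
  have w0: "wt l \<ge> 0" "wt l \<le> 1" for l by (auto simp: wt_def)
  have "0 \<le> c * wt 0 * wt 0" using assms norm_ge_zero order_trans by blast
  then have c: "c \<ge> 0" by (simp add: wt_def)
  have ws: "wt summable_on UNIV" using zsummable_wt w0(1) by (simp add: zsummable_iff)
  have "(\<lambda>(x, y). c * wt x * wt y) summable_on UNIV \<times> UNIV"
  proof (rule summable_on_SigmaI)
    show "((\<lambda>y. case (x, y) of (x, y) \<Rightarrow> c * wt x * wt y) has_sum c * wt x * infsum wt UNIV) UNIV" for x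
      using has_sum_cmult_right[OF has_sum_infsum[OF ws], of "c * wt x"] by simp
    show "(\<lambda>x. c * wt x * infsum wt UNIV) summable_on UNIV"
      by (intro summable_on_cmult_left summable_on_cmult_right ws)
  qed (use c w0 in auto)
  then have "(\<lambda>p. norm (case p of (x, y) \<Rightarrow> f x y)) summable_on UNIV \<times> UNIV"
    by (rule summable_on_comparison_test) (use assms in auto)
  then have "(\<lambda>(x, y). f x y) summable_on UNIV \<times> UNIV"
    by (rule abs_summable_summable)
  from infsum_swap_banach[OF this]
  have sw: "infsum (\<lambda>x. infsum (\<lambda>y. f x y) UNIV) UNIV = infsum (\<lambda>y. infsum (\<lambda>x. f x y) UNIV) UNIV" .
  have 1: "norm (f l n) \<le> (c * wt l) * wt n" "norm (f l n) \<le> (c * wt n) * wt l" for l n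
    using assms by (auto simp: mult_ac)
  have row: "isum (f l) = infsum (f l) UNIV" for l
    by (rule isum_eq_infsum, rule norm_isum_le(1), rule 1(1))
  have col: "isum (\<lambda>l. f l n) = infsum (\<lambda>l. f l n) UNIV" for n
    by (rule isum_eq_infsum, rule norm_isum_le(1), rule 1(2))
  have "norm (isum (f l)) \<le> (c * isum wt) * wt l" for l
    using norm_isum_le(2)[of "f l", OF 1(1)] by (simp add: mult_ac)
  then have r2: "isum (\<lambda>l. isum (f l)) = infsum (\<lambda>l. isum (f l)) UNIV"
    by (intro isum_eq_infsum norm_isum_le(1))
  have "norm (isum (\<lambda>l. f l n)) \<le> (c * isum wt) * wt n" for n
    using norm_isum_le(2)[of "\<lambda>l. f l n", OF 1(2)] by (simp add: mult_ac)
  then have c2: "isum (\<lambda>n. isum (\<lambda>l. f l n)) = infsum (\<lambda>n. isum (\<lambda>l. f l n)) UNIV"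
    by (intro isum_eq_infsum norm_isum_le(1))
  show ?thesis using r2 c2 sw by (simp add: row col)
qed


lemma isum_eq_cmult: "zsummable f \<Longrightarrow> isum (\<lambda>l. c * f l) = c * isum f" for c :: complex
  by (rule isum_linear[OF bounded_linear_mult_right])

lemma gauss_primitive:
  obtains F :: "complex \<Rightarrow> complex" where "\<And>t. (F has_field_derivative exp (- t\<^sup>2)) (at t)"
proof -
  have "(\<lambda>t::complex. exp (- t\<^sup>2)) holomorphic_on UNIV" by (intro holomorphic_intros)
  then show thesis
  proof (rule holomorphic_convex_primitive'[OF convex_UNIV open_UNIV])
    fix g :: "complex \<Rightarrow> complex"
    assume "\<And>x. x \<in> UNIV \<Longrightarrow> (g has_field_derivative exp (- x\<^sup>2)) (at x within UNIV)"
    then show thesis using that[of g] by simp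
  qed
qed

lemma holomorphic_comp_diff:
  "f holomorphic_on UNIV \<Longrightarrow> (\<lambda>t. f (t - c)) holomorphic_on UNIV" for f :: "complex \<Rightarrow> complex"
proof -
  assume f: "f holomorphic_on UNIV"
  have "(\<lambda>t. t - c) holomorphic_on UNIV" by (intro holomorphic_intros)
  from holomorphic_on_compose_gen[OF this f] show ?thesis by (simp add: o_def)
qed

text \<open>The error function provides an entire, rapidly decaying partition of unity \<open>R\<close> under
  integer translation; it need not interpolate the Kronecker delta at the integers.\<close>

lemma erf_partition:
  obtains R :: "complex \<Rightarrow> complex" where "R holomorphic_on UNIV" "strip_decay R"
    "\<And>t. isum (\<lambda>l. R (t - of_int l)) = 1" "\<And>x::real. R (of_real x) \<in> \<real>"
proof -
  obtain F :: "complex \<Rightarrow> complex" where F: "\<And>t. (F has_field_derivative exp (- t\<^sup>2)) (at t)"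
    by (rule gauss_primitive) blast
  have lip: "cmod (F a - F b) \<le> B * cmod (a - b)"
    if "convex S" "\<And>z. z \<in> S \<Longrightarrow> cmod (exp (- z\<^sup>2)) \<le> B" "a \<in> S" "b \<in> S" for a b S B
    by (rule field_differentiable_bound[OF that(1) has_field_derivative_at_within[OF F] that(2-4)])
  \<comment> \<open>An increment of the primitive over a unit interval: formally the translates
    telescope to the total increment, whatever \<open>t\<close> is.\<close>
  define R0 where "R0 t = F (t + 1/2) - F (t - 1/2)" for t
  have hF: "F holomorphic_on UNIV" using F by (auto simp: holomorphic_on_open)
  have hR0: "R0 holomorphic_on UNIV"
    unfolding R0_def using holomorphic_comp_diff[OF hF, of "-1/2"] holomorphic_comp_diff[OF hF, of "1/2"]
    by (auto intro!: holomorphic_intros)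
  have dR0: "strip_decay R0"
  proof (rule strip_decay_near[OF strip_decay_gauss, of "1/2" _ 1])
    fix t B assume B: "\<And>z. z \<in> cball t (1/2) \<Longrightarrow> cmod (exp (- z\<^sup>2)) \<le> B"
    show "cmod (R0 t) \<le> 1 * B"
      using lip[where S="cball t (1/2)" and a="t + 1/2" and b="t - 1/2", OF convex_cball B] by (simp add: R0_def dist_norm)
  qed auto
  have sR0: "zsummable (\<lambda>l. R0 (t - of_int l))" for t by (rule zsummable_strip_decay[OF dR0])
  define \<sigma> where "\<sigma> = isum (\<lambda>l. R0 (0 - of_int l))"
  have const: "isum (\<lambda>l. R0 (t - of_int l)) = \<sigma>" for t
  proof -
    \<comment> \<open>\<open>F\<close> does not decay, so the telescoping cannot be carried out with
      \<open>F\<close> directly. Its increments by the fixed amount \<open>t\<close> do decay, and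
      the difference of the sums at \<open>t\<close> and at 0 telescopes in terms of them.\<close>
    define u where "u s = F (s + t) - F s" for s
    have du: "strip_decay u"
    proof (rule strip_decay_near[OF strip_decay_gauss, of "cmod t" _ "cmod t"])
      fix s B assume B: "\<And>z. z \<in> cball s (cmod t) \<Longrightarrow> cmod (exp (- z\<^sup>2)) \<le> B"
      show "cmod (u s) \<le> cmod t * B"
        using lip[where S="cball s (cmod t)" and a="s + t" and b=s, OF convex_cball B] by (simp add: u_def dist_norm mult.commute)
    qed auto
    have "isum (\<lambda>l. R0 (t - of_int l)) - \<sigma> = isum (\<lambda>l. R0 (t - of_int l) - R0 (0 - of_int l))"
      unfolding \<sigma>_def by (rule isum_diff[symmetric, OF sR0 sR0])
    also have "\<dots> = isum (\<lambda>l. u (1/2 - of_int l) - u (1/2 - of_int (l + 1)))"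
      by (rule arg_cong[of _ _ isum]) (simp add: fun_eq_iff R0_def u_def algebra_simps minus_diff_commute)
    also have "\<dots> = isum (\<lambda>l. u (1/2 - of_int l)) - isum (\<lambda>l. u (1/2 - of_int (l + 1)))"
      by (rule isum_diff[OF zsummable_strip_decay[OF du] zsummable_shift[OF zsummable_strip_decay[OF du]]])
    also have "\<dots> = 0"
      using isum_shift[OF zsummable_strip_decay[OF du], of "1/2" 1] by simp
    finally show ?thesis by simp
  qed
  have vd: "((\<lambda>x. F (of_real x)) has_vector_derivative of_real (exp (- x\<^sup>2))) (at x)" for x
    using has_vector_derivative_real_field[OF F[of "of_real x"]] by (simp flip: exp_of_real)
  have dRe: "((\<lambda>x. Re (F (of_real x))) has_field_derivative exp (- x\<^sup>2)) (at x)" for x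
    using bounded_linear.has_vector_derivative[OF bounded_linear_Re vd[of x]]
    by (simp add: has_real_derivative_iff_has_vector_derivative)
  \<comment> \<open>The primitive is determined up to a complex constant only. Its imaginary part is
    constant on the real axis, so increments between real points are real.\<close>
  have dIm: "((\<lambda>x. Im (F (of_real x))) has_field_derivative 0) (at x)" for x
    using bounded_linear.has_vector_derivative[OF bounded_linear_Im vd[of x]]
    by (simp add: has_real_derivative_iff_has_vector_derivative)
  have R0_eq: "R0 (of_real x) = F (of_real (x + 1/2)) - F (of_real (x - 1/2))" for x
    by (simp add: R0_def)
  have R0_real: "Im (R0 (of_real x)) = 0" for x
    using DERIV_isconst_all[of "\<lambda>x. Im (F (of_real x))" "x + 1/2" "x - 1/2"] dIm unfolding R0_eq by simp
  have R0_pos: "Re (R0 (of_real x)) > 0" for x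
    unfolding R0_eq using DERIV_pos_imp_increasing[of "x - 1/2" "x + 1/2" "\<lambda>x. Re (F (of_real x))"] dRe
    by force
  \<comment> \<open>At real points \<open>R0\<close> is an increment of a strictly increasing
    function. All terms of the sum are positive, so \<sigma> is nonzero and one may divide by
    it.\<close>
  have "Re \<sigma> = isum (\<lambda>l. Re (R0 (0 - of_int l)))"
    unfolding \<sigma>_def by (rule isum_linear[OF bounded_linear_Re sR0, symmetric])
  also have "\<dots> > 0"
    unfolding isum_def
  proof (rule suminf_pos)
    show "summable (\<lambda>n. Re (R0 (0 - of_int (int_decode n))))"
      by (rule bounded_linear.summable[OF bounded_linear_Re zsummable_D[OF sR0]])
    show "0 < Re (R0 (0 - of_int (int_decode n)))" for n
      using R0_pos[of "- of_int (int_decode n)"] by simp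
  qed
  finally have \<sigma>_pos: "Re \<sigma> > 0" .
  have "Im \<sigma> = isum (\<lambda>l. Im (R0 (0 - of_int l)))"
    unfolding \<sigma>_def by (rule isum_linear[OF bounded_linear_Im sR0, symmetric])
  also have "\<dots> = 0"
    unfolding isum_def using R0_real[of "- of_int _"] by simp
  finally have \<sigma>_real: "Im \<sigma> = 0" .
  have \<sigma>0: "\<sigma> \<noteq> 0" using \<sigma>_pos by auto
  define R where "R t = inverse \<sigma> * R0 t" for t
  show thesis
  proof (rule that[of R])
    show "R holomorphic_on UNIV" unfolding R_def using hR0 by (intro holomorphic_intros)
    show "strip_decay R"
      by (rule strip_decay_near[OF dR0, of 0 _ "cmod (inverse \<sigma>)"])
        (auto simp: R_def norm_mult intro!: mult_left_mono)
    show "isum (\<lambda>l. R (t - of_int l)) = 1" for t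
      unfolding R_def by (subst isum_eq_cmult[OF sR0]) (simp add: const \<sigma>0)
    show "R (of_real x) \<in> \<real>" for x
      unfolding R_def using R0_real \<sigma>_real by (intro Reals_mult) (auto simp: complex_is_Real_iff)
  qed
qed

text \<open>An entire function with rapid decay equal to the Kronecker delta at the integers: a Gaussian
  times the cardinal sine.\<close>

lemma cardinal_gauss:
  obtains K :: "complex \<Rightarrow> complex" where "K holomorphic_on UNIV" "strip_decay K"
    "\<And>n::int. K (of_int n) = (if n = 0 then 1 else 0)" "\<And>x::real. K (of_real x) \<in> \<real>"
proof -
  define s where "s t = sin (of_real pi * t) / of_real pi" for t :: complex
  define q where "q t = (if t = 0 then 1 else s t / t)" for t
  have hs: "s holomorphic_on UNIV" unfolding s_def by (intro holomorphic_intros) auto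
  have "(s has_field_derivative 1) (at 0)"
    unfolding s_def by (auto intro!: derivative_eq_intros)
  then have "deriv s 0 = 1" by (rule DERIV_imp_deriv)
  then have hq: "q holomorphic_on UNIV"
  proof -
    assume "deriv s 0 = 1"
    then have "q = (\<lambda>z. if z = 0 then deriv s 0 else (s z - s 0) / (z - 0))"
      by (auto simp: q_def s_def fun_eq_iff)
    then show ?thesis using pole_lemma_open[OF hs open_UNIV, of 0] by simp
  qed
  \<comment> \<open>Near 0 the quotient is bounded by compactness. Farther out its denominator has
    modulus at least 1 and the sine grows at most like \<open>exp (pi |t|)\<close>.\<close>
  obtain b where b: "\<And>t. t \<in> cball 0 1 \<Longrightarrow> cmod (q t) \<le> b"
  proof -
    have "compact (q ` cball 0 1)"
      by (intro compact_continuous_image holomorphic_on_imp_continuous_on holomorphic_on_subset[OF hq]) auto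
    then show thesis using that compact_imp_bounded[THEN bounded_pos[THEN iffD1]] by (metis image_eqI)
  qed
  have qb: "cmod (q t) \<le> max b 1 * exp (pi * cmod t)" for t
  proof (cases "cmod t \<le> 1")
    case True
    then have "cmod (q t) \<le> max b 1" using b[of t] by simp
    also have "\<dots> \<le> max b 1 * exp (pi * cmod t)" by (simp add: mult_le_cancel_left1)
    finally show ?thesis .
  next
    case False
    have "cmod (q t) = cmod (sin (of_real pi * t)) / (pi * cmod t)"
      using False by (auto simp: q_def s_def norm_divide norm_mult)
    also have "\<dots> \<le> cmod (sin (of_real pi * t)) / 1"
    proof (rule divide_left_mono)
      show "1 \<le> pi * cmod t" using False pi_gt3 mult_mono[of 1 pi 1 "cmod t"] by simp
      have "t \<noteq> 0" using False by auto
      then show "0 < pi * cmod t * 1" by simp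
    qed auto
    also have "\<dots> \<le> exp (pi * cmod t)"
    proof -
      define z where "z = of_real pi * t"
      have "cmod (sin z) \<le> (cmod (exp (\<i> * z)) + cmod (exp (- (\<i> * z)))) / 2"
        unfolding sin_exp_eq using norm_triangle_ineq4[of "exp (\<i> * z)" "exp (- (\<i> * z))"]
        by (simp add: norm_divide norm_mult)
      also have "\<dots> \<le> (exp (cmod z) + exp (cmod z)) / 2"
        using abs_Im_le_cmod[of z] by (intro divide_right_mono add_mono) auto
      also have "\<dots> = exp (pi * cmod t)" by (simp add: z_def norm_mult)
      finally show ?thesis by (simp add: z_def)
    qed
    also have "\<dots> \<le> max b 1 * exp (pi * cmod t)" by simp
    finally show ?thesis .
  qed
  define K where "K t = q t * exp (- t\<^sup>2)" for t
  show thesis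
  proof (rule that[of K])
    show "K holomorphic_on UNIV" unfolding K_def using hq by (intro holomorphic_intros)
    show "strip_decay K"
      unfolding strip_decay_def
    proof (intro allI)
      fix H k :: real
      \<comment> \<open>The rate is raised by \<open>pi\<close> to pay for the growth of
        \<open>q\<close>.\<close>
      obtain C where C: "C \<ge> 0" "\<And>t. \<bar>Im t\<bar> \<le> H \<Longrightarrow> cmod (exp (- t\<^sup>2)) \<le> C * exp (- (k + pi) * cmod t)"
        by (rule strip_decayE[OF strip_decay_gauss]) blast
      show "\<exists>C\<ge>0. \<forall>t. \<bar>Im t\<bar> \<le> H \<longrightarrow> cmod (K t) \<le> C * exp (- k * cmod t)"
      proof (intro exI[of _ "max b 1 * C"] conjI allI impI)
        fix t assume t: "\<bar>Im t\<bar> \<le> H"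
        have "cmod (K t) \<le> (max b 1 * exp (pi * cmod t)) * (C * exp (- (k + pi) * cmod t))"
          unfolding K_def norm_mult using qb C t by (intro mult_mono) auto
        also have "\<dots> = max b 1 * C * exp (- k * cmod t)"
          by (simp add: algebra_simps flip: exp_add)
        finally show "cmod (K t) \<le> max b 1 * C * exp (- k * cmod t)" .
      qed (use C in auto)
    qed
    show "K (of_int n) = (if n = 0 then 1 else 0)" for n
    proof -
      have "sin (of_real pi * of_int n :: complex) = of_real (sin (pi * of_int n))"
        by (simp flip: sin_of_real del: sin_npi_int)
      also have "\<dots> = 0" by (simp only: sin_npi_int of_real_0)
      finally show ?thesis by (simp add: K_def q_def s_def)
    qed
    show "K (of_real x) \<in> \<real>" for x
    proof -
      have "K (of_real x) = of_real ((if x = 0 then 1 else sin (pi * x) / pi / x) * exp (- x\<^sup>2))"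
        by (simp add: K_def q_def s_def flip: sin_of_real exp_of_real)
      then show ?thesis by (metis Reals_of_real)
    qed
  qed
qed

text \<open>\<open>R\<close> has the right sum of translates, \<open>K\<close> the right values at
  the integers. Subtracting from \<open>R\<close> the cardinal interpolation \<open>v\<close> of the
  defects \<open>D n = R n - K n\<close> repairs the values. It leaves the sum alone: the translates
  of \<open>v\<close> add up to the sum of the \<open>D n\<close> times the sum of the translates of
  \<open>K\<close>, and the \<open>D n\<close> add up to \<open>1 - 1 = 0\<close>.\<close>

lemma cardinal_partition_of_unity:
  obtains \<rho> :: "complex \<Rightarrow> complex" where "\<rho> holomorphic_on UNIV" "strip_decay \<rho>"
    "\<And>t. isum (\<lambda>l. \<rho> (t - of_int l)) = 1"
    "\<And>n::int. \<rho> (of_int n) = (if n = 0 then 1 else 0)" "\<And>x::real. \<rho> (of_real x) \<in> \<real>"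
proof -
  obtain R where R: "R holomorphic_on UNIV" "strip_decay R"
    "\<And>t. isum (\<lambda>l. R (t - of_int l)) = 1" "\<And>x::real. R (of_real x) \<in> \<real>"
    by (rule erf_partition) blast
  obtain K where K: "K holomorphic_on UNIV" "strip_decay K"
    "\<And>n::int. K (of_int n) = (if n = 0 then 1 else 0)" "\<And>x::real. K (of_real x) \<in> \<real>"
    by (rule cardinal_gauss) blast
  define D where "D t = R t - K t" for t
  have dD: "strip_decay D" unfolding D_def by (rule strip_decay_diff[OF R(2) K(2)])
  define v where "v t = isum (\<lambda>n. D (of_int n) * K (t - of_int n))" for t
  have dv: "strip_decay v" unfolding v_def by (rule strip_decay_isum[OF dD K(2)])
  have Dint: "D (of_int n) = R (of_int n) - (if n = 0 then 1 else 0)" for n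
    by (simp add: D_def K(3))
  obtain A where A: "A \<ge> 0" "\<And>n. cmod (D (of_int n)) \<le> A * wt n"
  proof -
    obtain A where "A \<ge> 0" "\<And>t. \<bar>Im t\<bar> \<le> 0 \<Longrightarrow> cmod (D t) \<le> A * exp (- 1 * cmod t)"
      by (rule strip_decayE[OF dD]) blast
    from that[OF this(1)] this(2)[of "of_int _"] show thesis by (simp add: wt_def)
  qed
  have term_bound: "\<exists>c\<ge>0. \<forall>t n. cmod t < N \<longrightarrow> cmod (D (of_int n) * K (t - of_int n)) \<le> c * wt n" for N
  proof -
    obtain c where c: "c \<ge> 0" "\<And>t l. cmod t \<le> N \<Longrightarrow> cmod (K (t - of_int l)) \<le> c * wt l"
      using strip_decay_translate[OF K(2)] by blast
    show ?thesis
    proof (intro exI[of _ "A * c"] conjI allI impI)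
      fix t :: complex and n assume "cmod t < N"
      then have "cmod (K (t - of_int n)) \<le> c * wt n" by (intro c(2)) simp
      also have "\<dots> \<le> c" using c(1) by (simp add: wt_def mult_left_le)
      finally have "cmod (D (of_int n)) * cmod (K (t - of_int n)) \<le> (A * wt n) * c"
        using A by (intro mult_mono) (auto simp: wt_def)
      then show "cmod (D (of_int n) * K (t - of_int n)) \<le> A * c * wt n"
        by (simp add: norm_mult mult_ac)
    qed (use A c in auto)
  qed
  have hv: "v holomorphic_on UNIV"
    unfolding v_def
  proof (rule holomorphic_isum)
    show "(\<lambda>t. D (of_int n) * K (t - of_int n)) holomorphic_on UNIV" for n
      using holomorphic_comp_diff[OF K(1)] by (intro holomorphic_intros)
  qed (rule term_bound)
  have sR: "zsummable (\<lambda>l. R (t - of_int l))" and sv: "zsummable (\<lambda>l. v (t - of_int l))"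
    and sK: "zsummable (\<lambda>l. K (t - of_int l))" for t
    using R(2) dv K(2) by (auto intro: zsummable_strip_decay)
  have sD: "zsummable (\<lambda>n. D (of_int n))" and sumD: "isum (\<lambda>n. D (of_int n)) = 0"
  proof -
    have refl: "zsummable (\<lambda>n. f (- n))" "isum (\<lambda>n. f (- n)) = isum f" if "zsummable f" for f :: "int \<Rightarrow> complex"
    proof -
      show *: "zsummable (\<lambda>n. f (- n))"
        using that summable_on_reindex_bij_betw[OF bij_uminus, of "\<lambda>l. norm (f l)"] by (simp add: zsummable_iff)
      show "isum (\<lambda>n. f (- n)) = isum f"
        using that * infsum_reindex_bij_betw[OF bij_uminus, of f] by (simp add: isum_eq_infsum)
    qed
    have zR: "zsummable (\<lambda>n. R (of_int n))" and iR: "isum (\<lambda>n. R (of_int n)) = 1"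
      using refl[OF sR[of 0]] R(3)[of 0] by auto
    have zd: "zsummable (\<lambda>n. if n = 0 then 1 else 0 :: complex)"
      by (rule zsummable_comparison[OF zsummable_wt, of _ 1]) (simp add: wt_def)
    show "zsummable (\<lambda>n. D (of_int n))"
      using refl(1)[OF zsummable_strip_decay[OF dD, of 0]] by simp
    have "isum (\<lambda>n. D (of_int n)) = isum (\<lambda>n. R (of_int n)) - isum (\<lambda>n. if n = 0 then 1 else 0)"
      unfolding Dint by (rule isum_diff[OF zR zd])
    also have "isum (\<lambda>n::int. if n = 0 then 1 else 0 :: complex) = 1"
      using isum_delta[of 0 "\<lambda>_. 1::complex"] by simp
    finally show "isum (\<lambda>n. D (of_int n)) = 0" using iR by simp
  qed
  have sumv: "isum (\<lambda>l. v (t - of_int l)) = 0" for t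
  proof -
    have "isum (\<lambda>l. v (t - of_int l)) = isum (\<lambda>l. isum (\<lambda>n. D (of_int n) * K (t - of_int l - of_int n)))"
      by (simp add: v_def)
    have inner: "isum (\<lambda>l. D (of_int n) * K (t - of_int l - of_int n)) = D (of_int n) * isum (\<lambda>l. K (t - of_int l))" for n
      using isum_eq_cmult[OF zsummable_shift[OF sK], of "D (of_int n)" t n] isum_shift[OF sK, of t n]
      by (simp add: algebra_simps)
    obtain C where C: "C \<ge> 0" "\<And>s. \<bar>Im s\<bar> \<le> \<bar>Im t\<bar> \<Longrightarrow> cmod (K s) \<le> C * exp (- 1 * cmod s)"
      by (rule strip_decayE[OF K(2)]) blast
    \<comment> \<open>Of the rate 2, one unit survives as \<open>wt n\<close>; the other converts
      decay of \<open>K\<close> in \<open>l + n\<close> into decay in \<open>l\<close>.\<close>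
    obtain A where A: "A \<ge> 0" "\<And>t. \<bar>Im t\<bar> \<le> 0 \<Longrightarrow> cmod (D t) \<le> A * exp (- 2 * cmod t)"
      by (rule strip_decayE[OF dD]) blast
    have "isum (\<lambda>l. isum (\<lambda>n. D (of_int n) * K (t - of_int l - of_int n)))
        = isum (\<lambda>n. isum (\<lambda>l. D (of_int n) * K (t - of_int l - of_int n)))"
    proof (rule isum_swap)
      fix l n :: int
      have "cmod (D (of_int n)) * cmod (K (t - of_int l - of_int n)) \<le>
          (A * exp (- 2 * \<bar>real_of_int n\<bar>)) * (C * exp (- 1 * cmod (t - of_int l - of_int n)))"
        using A(2)[of "of_int n"] C(2)[of "t - of_int l - of_int n"] A(1) by (intro mult_mono) auto
      also have "\<dots> = A * C * exp (- 2 * \<bar>real_of_int n\<bar> - cmod (t - of_int l - of_int n))"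
        by (simp add: algebra_simps flip: exp_add)
      also have "\<dots> \<le> A * C * exp (cmod t + - \<bar>real_of_int l\<bar> + - \<bar>real_of_int n\<bar>)"
      proof -
        have "\<bar>real_of_int l\<bar> \<le> cmod t + \<bar>real_of_int n\<bar> + cmod (t - of_int l - of_int n)"
          using norm_triangle_ineq4[of "t - of_int n" "t - of_int l - of_int n"] norm_triangle_ineq4[of t "of_int n"]
          by simp
        then show ?thesis using A(1) C(1) by (intro mult_left_mono) auto
      qed
      finally show "cmod (D (of_int n) * K (t - of_int l - of_int n)) \<le> (A * C * exp (cmod t)) * wt l * wt n"
        unfolding norm_mult wt_def exp_add by (simp only: mult.assoc)
    qed
    also have "\<dots> = isum (\<lambda>n. isum (\<lambda>l. K (t - of_int l)) * D (of_int n))"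
      by (simp add: inner mult.commute)
    also have "\<dots> = 0" by (simp add: isum_eq_cmult[OF sD] sumD)
    finally show ?thesis by (simp add: v_def)
  qed
  define \<rho> where "\<rho> t = R t - v t" for t
  show thesis
  proof (rule that[of \<rho>])
    show "\<rho> holomorphic_on UNIV" unfolding \<rho>_def using R(1) hv by (intro holomorphic_intros)
    show "strip_decay \<rho>" unfolding \<rho>_def by (rule strip_decay_diff[OF R(2) dv])
    show "isum (\<lambda>l. \<rho> (t - of_int l)) = 1" for t
      unfolding \<rho>_def by (subst isum_diff[OF sR sv]) (simp add: R(3) sumv)
    show "\<rho> (of_int m) = (if m = 0 then 1 else 0)" for m
    proof -
      have "v (of_int m) = isum (\<lambda>n. if n = m then D (of_int n) else 0)"
        unfolding v_def
      proof (rule arg_cong[of _ _ isum], rule ext)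
        fix n
        show "D (of_int n) * K (of_int m - of_int n) = (if n = m then D (of_int n) else 0)"
          using K(3)[of "m - n"] by auto
      qed
      also have "\<dots> = D (of_int m)" by (rule isum_delta)
      finally show ?thesis by (simp add: \<rho>_def Dint)
    qed
    show "\<rho> (of_real x) \<in> \<real>" for x
    proof -
      have "Im (v (of_real x)) = isum (\<lambda>n. Im (D (of_int n) * K (of_real x - of_int n)))"
      proof -
        have "zsummable (\<lambda>n. D (of_int n) * K (of_real x - of_int n))"
        proof -
          obtain c where "\<And>n. cmod (D (of_int n) * K (of_real x - of_int n)) \<le> c * wt n"
            using term_bound[of "cmod (of_real x) + 1"] by force
          then show ?thesis by (rule norm_isum_le(1))
        qed
        from isum_linear[OF bounded_linear_Im this] show ?thesis by (simp add: v_def)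
      qed
      also have "\<dots> = 0"
      proof -
        have "D (of_int n) * K (of_real x - of_int n) \<in> \<real>" for n
          unfolding D_def using R(4)[of "of_int n"] K(4)[of "of_int n"] K(4)[of "x - of_int n"]
          by (intro Reals_mult Reals_diff) auto
        then have "Im (D (of_int n) * K (of_real x - of_int n)) = 0" for n
          by (simp add: complex_is_Real_iff)
        then show ?thesis by (simp add: isum_def)
      qed
      finally have "v (of_real x) \<in> \<real>" by (simp add: complex_is_Real_iff)
      then show ?thesis unfolding \<rho>_def using R(4) by (intro Reals_diff)
    qed
  qed
qed

section \<open>Blending the iterates of a cocycle\<close>

lemma norm_exp_minus_one_le:
  fixes x :: "'a::{real_normed_algebra_1,banach}"
  assumes "norm x \<le> \<epsilon>" "\<epsilon> \<le> 1"
  shows "norm (exp x - 1) \<le> 2 * \<epsilon>"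
proof -
  have e0: "\<epsilon> \<ge> 0" using assms(1) norm_ge_zero order_trans by blast
  have s: "summable (\<lambda>n. \<epsilon> ^ (n + 1) /\<^sub>R fact (n + 1))"
    using summable_ignore_initial_segment[OF summable_exp_generic[of \<epsilon>], of 1] by simp
  have "norm (exp x - 1) = norm (\<Sum>n. x ^ (n + 1) /\<^sub>R fact (n + 1))"
    by (subst exp_first_term) simp
  also have "\<dots> \<le> (\<Sum>n. \<epsilon> ^ (n + 1) /\<^sub>R fact (n + 1))"
  proof (rule norm_suminf_le[OF _ s])
    fix n
    have "norm (x ^ (n + 1)) \<le> \<epsilon> ^ (n + 1)"
      using assms(1) norm_power_ineq[of x "n + 1"] power_mono[of "norm x" \<epsilon> "n + 1"] by simp
    then show "norm (x ^ (n + 1) /\<^sub>R fact (n + 1)) \<le> \<epsilon> ^ (n + 1) /\<^sub>R fact (n + 1)"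
      by (simp add: mult_left_mono)
  qed
  also have "\<dots> = exp \<epsilon> - 1" by (subst exp_first_term[of \<epsilon>]) simp
  also have "\<dots> \<le> \<epsilon> + \<epsilon>\<^sup>2" using exp_bound[OF e0 assms(2)] by simp
  also have "\<dots> \<le> 2 * \<epsilon>" using mult_right_mono[OF assms(2) e0] by (simp add: power2_eq_square)
  finally show ?thesis .
qed

lemma exp_of_nat_times:
  fixes x :: "'a::{real_normed_algebra_1,banach}"
  shows "exp (of_nat n * x) = exp x ^ n"
proof (induction n)
  case (Suc n)
  have "x * (of_nat n * x) = (of_nat n * x) * x"
    by (simp add: mult.assoc mult_of_nat_commute)
  then show ?case using Suc by (simp add: distrib_right exp_add_commuting)
qed simp

text \<open>\<open>X (n + 1) - Q^(n + 1) = (P n - Q) X n + Q (X n - Q^n)\<close>. The contributions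
  \<open>2 \<epsilon> q\<close> and \<open>\<epsilon> q\<close> add up to \<open>3 q\<close> times
  \<epsilon>, so the base \<open>3 q\<close> that bounds each factor also closes the induction for
  the difference.\<close>

lemma norm_iterate_le:
  fixes X P :: "nat \<Rightarrow> 'a::real_normed_algebra_1"
  assumes X: "X 0 = 1" "\<And>n. X (Suc n) = P n * X n"
    and P: "\<And>n. norm (P n - Q) \<le> 2 * \<epsilon> * q" "norm Q \<le> q" and \<epsilon>: "0 \<le> \<epsilon>" "\<epsilon> \<le> 1" and q: "q \<ge> 1"
  shows "norm (X n) \<le> (3 * q) ^ n" "norm (X n - Q ^ n) \<le> \<epsilon> * (3 * q) ^ n"
proof -
  have "norm (P n) \<le> 3 * q" for n
  proof -
    have "norm (P n) \<le> norm (P n - Q) + norm Q" by (metis norm_triangle_sub add.commute)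
    also have "\<dots> \<le> 2 * \<epsilon> * q + q" using P(1)[of n] P(2) by (rule add_mono)
    also have "\<dots> \<le> 2 * q + q" using \<epsilon>(2) q by simp
    finally show ?thesis by simp
  qed
  note Pn = this
  show 1: "norm (X n) \<le> (3 * q) ^ n" for n
  proof (induction n)
    case (Suc n)
    have "norm (X (Suc n)) \<le> norm (P n) * norm (X n)" using norm_mult_ineq by (simp add: X(2))
    also have "\<dots> \<le> (3 * q) * (3 * q) ^ n" using Pn Suc q by (intro mult_mono) auto
    finally show ?case by simp
  qed (simp add: X)
  show "norm (X n - Q ^ n) \<le> \<epsilon> * (3 * q) ^ n"
  proof (induction n)
    case (Suc n)
    have "X (Suc n) - Q ^ Suc n = (P n - Q) * X n + Q * (X n - Q ^ n)"
      by (simp add: X(2) algebra_simps)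
    then have "norm (X (Suc n) - Q ^ Suc n) \<le> norm (P n - Q) * norm (X n) + norm Q * norm (X n - Q ^ n)"
      using norm_triangle_mono[OF norm_mult_ineq norm_mult_ineq] by metis
    also have "\<dots> \<le> (2 * \<epsilon> * q) * (3 * q) ^ n + q * (\<epsilon> * (3 * q) ^ n)"
      using P 1 Suc q \<epsilon> by (intro add_mono mult_mono) auto
    also have "\<dots> = \<epsilon> * (3 * q) ^ Suc n" by (simp add: algebra_simps)
    finally show ?case .
  qed (simp add: X \<epsilon>)
qed

section \<open>Strips and the coordinate transverse to the flow\<close>

lemma cvec_simps:
  "cvec 0 = 0" "cvec (x + y) = cvec x + cvec y" "cvec (x - y) = cvec x - cvec y" "cvec (r *\<^sub>R x) = r *\<^sub>R cvec x"
  by (simp_all add: cvec_def vec_eq_iff) (simp add: scaleR_conv_of_real)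

lemma strip1_add_cvec [simp]: "z + cvec x \<in> strip1 h \<longleftrightarrow> z \<in> strip1 h"
  by (simp add: strip1_def cvec_def)

lemma open_strip1: "open (strip1 h :: (complex^'d) set)"
proof -
  have "strip1 h = (\<Inter>j. {z :: complex^'d. \<bar>Im (z $ j)\<bar> < h})" by (auto simp: strip1_def)
  moreover have "open {z :: complex^'d. \<bar>Im (z $ j)\<bar> < h}" for j
    by (intro open_Collect_less continuous_intros)
  ultimately show ?thesis by (simp add: open_INT)
qed

lemma open_strip2: "open (strip2 h :: (complex \<times> (complex^'d)) set)"
proof -
  have "strip2 h = {w. \<bar>Im (fst w)\<bar> < h} \<inter> snd -` (strip1 h :: (complex^'d) set)"
    by (auto simp: strip2_def strip1_def)
  moreover have "open {w :: complex \<times> (complex^'d). \<bar>Im (fst w)\<bar> < h}"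
    by (intro open_Collect_less continuous_intros)
  moreover have "open (snd -` (strip1 h :: (complex^'d) set) :: (complex \<times> _) set)"
    by (intro open_vimage_snd open_strip1)
  ultimately show ?thesis by auto
qed

lemma l1norm_nonneg: "l1norm \<mu> \<ge> 0"
  by (auto simp: l1norm_def intro: sum_nonneg)

text \<open>The point at time 0 of the complexified flow line through \<open>w\<close>. It is
  annihilated by the direction \<open>(1, \<mu>)\<close>, so functions of it are constant along the
  flow.\<close>

definition untwist :: "real^'d \<Rightarrow> complex \<times> (complex^'d) \<Rightarrow> complex^'d" where
  "untwist \<mu> w = snd w - cscaleV (fst w) (cvec \<mu>)"

lemma untwist_strip1:
  assumes "w \<in> strip2 (h / (1 + l1norm \<mu>))"
  shows "untwist \<mu> w \<in> strip1 h"
proof -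
  obtain a z where w: "w = (a, z)" by (cases w)
  define h' where "h' = h / (1 + l1norm \<mu>)"
  have a: "\<bar>Im a\<bar> < h'" "\<And>j. \<bar>Im (z $ j)\<bar> < h'" using assms by (auto simp: strip2_def w h'_def)
  have l: "l1norm \<mu> \<ge> 0" by (rule l1norm_nonneg)
  have "h' * (1 + l1norm \<mu>) = h" using l by (simp add: h'_def)
  then have h: "h = h' + h' * l1norm \<mu>" by (simp add: distrib_left)
  have "\<bar>Im (untwist \<mu> w $ j)\<bar> < h" for j
  proof -
    have "\<bar>\<mu> $ j\<bar> \<le> l1norm \<mu>" unfolding l1norm_def by (rule member_le_sum) auto
    then have "\<bar>Im a\<bar> * \<bar>\<mu> $ j\<bar> \<le> h' * l1norm \<mu>" using a by (intro mult_mono) auto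
    moreover have "\<bar>Im (untwist \<mu> w $ j)\<bar> \<le> \<bar>Im (z $ j)\<bar> + \<bar>Im a\<bar> * \<bar>\<mu> $ j\<bar>"
      by (simp add: untwist_def w cscaleV_def cvec_def abs_mult[symmetric])
    ultimately show ?thesis using a(2)[of j] h by linarith
  qed
  then show ?thesis by (simp add: strip1_def)
qed

lemma strip2_fst:
  assumes "(a, z) \<in> strip2 (h / (1 + l1norm \<mu>))" "h > 0"
  shows "\<bar>Im a\<bar> < h"
proof -
  have l: "l1norm \<mu> \<ge> 0" by (rule l1norm_nonneg)
  then have "h / (1 + l1norm \<mu>) \<le> h / 1" using assms(2) by (intro divide_left_mono) auto
  then show ?thesis using assms by (simp add: strip2_def)
qed

lemma has_derivative_untwist: "(untwist \<mu> has_derivative untwist \<mu>) (at w)"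
proof -
  have "bounded_linear (\<lambda>a. cscaleV a (cvec \<mu>))"
    by (rule bounded_linear_intro[where K="norm (cvec \<mu>)"])
      (simp_all add: norm_cscaleV, simp_all add: cscaleV_def vec_eq_iff algebra_simps)
  from bounded_linear_sub[OF bounded_linear_snd bounded_linear_compose[OF this bounded_linear_fst]]
  have "bounded_linear (untwist \<mu>)" by (simp add: untwist_def[abs_def])
  then show ?thesis by (rule bounded_linear_imp_has_derivative)
qed

definition holo1 :: "(complex^'d \<Rightarrow> 'n::finite opmat) \<Rightarrow> (complex^'d) set \<Rightarrow> bool" where
  "holo1 G S \<longleftrightarrow> (\<forall>z\<in>S. \<exists>D. (G has_derivative D) (at z) \<and> (\<forall>c v. D (cscaleV c v) = csm c * D v))"

lemma fhol_untwist:
  assumes "holo1 G (strip1 h)" "S \<subseteq> strip2 (h / (1 + l1norm \<mu>))"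
  shows "fhol \<mu> (\<lambda>w. G (untwist \<mu> w + cvec x)) (\<lambda>_. 0) S"
  unfolding fhol_def
proof
  fix w assume w: "w \<in> S"
  then have "untwist \<mu> w + cvec x \<in> strip1 h"
    using untwist_strip1[OF subsetD[OF assms(2)]] by simp
  then obtain D where D: "(G has_derivative D) (at (untwist \<mu> w + cvec x))" "\<And>c v. D (cscaleV c v) = csm c * D v"
    using assms(1) unfolding holo1_def by blast
  have "((\<lambda>w. untwist \<mu> w + cvec x) has_derivative untwist \<mu>) (at w)"
    using has_derivative_add[OF has_derivative_untwist has_derivative_const] by simp
  from has_derivative_compose[OF this D(1)]
  have "((\<lambda>w. G (untwist \<mu> w + cvec x)) has_derivative (\<lambda>v. D (untwist \<mu> v))) (at w)" .
  moreover have "untwist \<mu> (smul c v) = cscaleV c (untwist \<mu> v)" for c v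
    by (simp add: untwist_def smul_def cscaleV_def vec_eq_iff algebra_simps)
  moreover have "untwist \<mu> (1, cvec \<mu>) = 0" by (simp add: untwist_def cscaleV_def vec_eq_iff)
  moreover have "D 0 = 0" using has_derivative_bounded_linear[OF D(1)] by (simp add: linear_simps)
  ultimately show "\<exists>D. ((\<lambda>w. G (untwist \<mu> w + cvec x)) has_derivative D) (at w) \<and>
      (\<forall>c v. D (smul c v) = csm c * D v) \<and> D (1, cvec \<mu>) = 0"
    using D(2) by (intro exI[of _ "\<lambda>v. D (untwist \<mu> v)"]) auto
qed

section \<open>Iterates of a cocycle and their blend\<close>

locale cocycle =
  fixes A :: "'n::finite opmat" and G :: "complex^'d \<Rightarrow> 'n opmat" and \<mu> :: "real^'d"
begin

definition M :: "complex^'d \<Rightarrow> 'n opmat" where "M z = exp A * exp (G z)"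
definition Minv :: "complex^'d \<Rightarrow> 'n opmat" where "Minv z = exp (- G z) * exp (- A)"

fun Mp :: "nat \<Rightarrow> complex^'d \<Rightarrow> 'n opmat" where
  "Mp 0 z = 1"
| "Mp (Suc n) z = M (z + cvec (real n *\<^sub>R \<mu>)) * Mp n z"

text \<open>The iterate of index \<open>- n\<close>: the inverse matrices at
  \<open>z - \<mu>\<close>, ..., \<open>z - n \<mu>\<close>. The inverse of a step is evaluated at
  the point from which the step starts, hence the \<open>Suc n\<close> in the translation.\<close>

fun Mn :: "nat \<Rightarrow> complex^'d \<Rightarrow> 'n opmat" where
  "Mn 0 z = 1"
| "Mn (Suc n) z = Minv (z + cvec (- real (Suc n) *\<^sub>R \<mu>)) * Mn n z"

definition Mc :: "int \<Rightarrow> complex^'d \<Rightarrow> 'n opmat" where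
  "Mc l z = (if l \<ge> 0 then Mp (nat l) z else Mn (nat (- l)) z)"

text \<open>For \<open>G = 0\<close> the matrix factor is \<open>exp (a A)\<close> for every
  \<open>l\<close>; this is why the iterate is followed by the flow of \<open>A\<close> for the
  remaining time \<open>a - l\<close>.\<close>

definition T :: "(complex \<Rightarrow> complex) \<Rightarrow> int \<Rightarrow> complex \<times> (complex^'d) \<Rightarrow> 'n opmat" where
  "T \<eta> l w = csm (\<eta> (fst w - of_int l)) * (exp (csm (fst w - of_int l) * A) * Mc l (untwist \<mu> w))"

definition blend :: "(complex \<Rightarrow> complex) \<Rightarrow> complex \<times> (complex^'d) \<Rightarrow> 'n opmat" where
  "blend \<eta> w = isum (\<lambda>l. T \<eta> l w)"

lemma M_Minv: "M z * Minv z = 1" "Minv z * M z = 1"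
proof -
  show "M z * Minv z = 1"
    unfolding M_def Minv_def by (simp add: mult.assoc exp_minus_inverse flip: mult.assoc[of "exp (G z)"])
  then show "Minv z * M z = 1" by (rule opmat_inverse_commute)
qed

lemma Mc_0 [simp]: "Mc 0 z = 1" by (simp add: Mc_def)

lemma Mc_step: "Mc (l + 1) z = M (z + cvec (of_int l *\<^sub>R \<mu>)) * Mc l z"
proof (cases "l \<ge> 0")
  case True
  then have "nat (l + 1) = Suc (nat l)" by simp
  then show ?thesis using True by (simp add: Mc_def)
next
  case False
  \<comment> \<open>Going from \<open>l\<close> to \<open>l + 1\<close> lowers the index of
    \<open>Mn\<close> from \<open>n + 1\<close> to \<open>n\<close>: the new factor \<open>M\<close>
    meets the \<open>Minv\<close> that was added last.\<close>
  define n where "n = nat (- l) - 1"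
  have l: "nat (- l) = Suc n" "of_int l = - real (Suc n)" using False by (auto simp: n_def)
  have "Mc l z = Minv (z + cvec (of_int l *\<^sub>R \<mu>)) * Mn n z"
    using False by (simp add: Mc_def l)
  moreover have "Mc (l + 1) z = Mn n z"
    using False by (cases n) (auto simp: Mc_def n_def nat_diff_distrib' intro: arg_cong2[of _ _ _ _ Mn])
  ultimately show ?thesis by (simp add: M_Minv flip: mult.assoc)
qed

text \<open>The factor is split off at the starting point instead of at the end, as required when
  \<open>a\<close> increases by 1 with \<open>z\<close> fixed and the base point moves back by
  \<mu>. Downward induction cancels a common \<open>M\<close> by its inverse.\<close>

lemma Mc_shift: "Mc (l + 1) z = Mc l (z + cvec \<mu>) * M z"
proof (induction l rule: int_induct[of _ 0])
  case base
  show ?case using Mc_step[of 0 z] by (simp add: cvec_simps)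
next
  case (step1 l)
  have "Mc (l + 1 + 1) z = M (z + cvec (of_int (l + 1) *\<^sub>R \<mu>)) * (Mc l (z + cvec \<mu>) * M z)"
    using Mc_step[of "l + 1" z] step1 by simp
  also have "z + cvec (of_int (l + 1) *\<^sub>R \<mu>) = z + cvec \<mu> + cvec (of_int l *\<^sub>R \<mu>)"
    by (simp add: cvec_simps algebra_simps)
  finally show ?case using Mc_step[of l "z + cvec \<mu>"] by (simp add: mult.assoc)
next
  case (step2 l)
  have e: "z + cvec (of_int l *\<^sub>R \<mu>) = z + cvec \<mu> + cvec (of_int (l - 1) *\<^sub>R \<mu>)" (is "?x = ?y")
    by (simp add: cvec_simps algebra_simps)
  have "M ?x * Mc l z = Mc l (z + cvec \<mu>) * M z"
    using step2(2) Mc_step[of l z] by (simp only:)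
  also have "Mc l (z + cvec \<mu>) = M ?x * Mc (l - 1) (z + cvec \<mu>)"
    using Mc_step[of "l - 1" "z + cvec \<mu>"] unfolding e by simp
  finally have "M ?x * Mc l z = M ?x * (Mc (l - 1) (z + cvec \<mu>) * M z)" by (simp only: mult.assoc)
  then have "Minv ?x * (M ?x * Mc l z) = Minv ?x * (M ?x * (Mc (l - 1) (z + cvec \<mu>) * M z))" by simp
  then show ?case by (simp add: M_Minv flip: mult.assoc)
qed

lemma Mc_1: "Mc 1 z = M z" using Mc_shift[of 0 z] by simp

lemma Mc_periodic:
  assumes "\<And>z. G (z + u) = G z"
  shows "Mc l (z + u) = Mc l z"
proof -
  have M: "M (z + u) = M z" and Mi: "Minv (z + u) = Minv z" for z
    by (simp_all add: M_def Minv_def assms)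
  have "Mp n (z + u) = Mp n z" for n
    by (induction n) (use M[of "z + cvec _"] in \<open>simp_all add: add_ac\<close>)
  moreover have "Mn n (z + u) = Mn n z" for n
    by (induction n) (use Mi[of "z + cvec _"] in \<open>simp_all add: add_ac\<close>)
  ultimately show ?thesis by (simp add: Mc_def)
qed

end

section \<open>Growth, holomorphy and size of the blend\<close>

locale small_cocycle = cocycle A G \<mu>
  for A :: "'n::finite opmat" and G :: "complex^'d \<Rightarrow> 'n opmat" and \<mu> :: "real^'d" +
  fixes h \<alpha> \<epsilon> :: real
  assumes h: "h > 0" and \<alpha>: "norm A \<le> \<alpha>" and \<epsilon>: "0 \<le> \<epsilon>" "\<epsilon> \<le> 1"
    and G_holo: "holo1 G (strip1 h)" and G_le: "\<And>z. z \<in> strip1 h \<Longrightarrow> norm (G z) \<le> \<epsilon>"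
begin

abbreviation S :: "(complex \<times> (complex^'d)) set" where "S \<equiv> strip2 (h / (1 + l1norm \<mu>))"

text \<open>The rate is the sum of \<alpha> for \<open>exp ((a - l) A)\<close>,
  \<open>\<alpha> + 2\<close> for the growth of the iterates and 1 for the summable weight
  \<open>wt\<close>.\<close>

definition rapid :: "real \<Rightarrow> (complex \<Rightarrow> complex) \<Rightarrow> bool" where
  "rapid C \<eta> \<longleftrightarrow> C \<ge> 0 \<and> (\<forall>t. \<bar>Im t\<bar> < h \<longrightarrow> cmod (\<eta> t) \<le> C * exp (- (2 * \<alpha> + 3) * cmod t))"

lemma \<alpha>0: "\<alpha> \<ge> 0" using \<alpha> norm_ge_zero order_trans by blast

lemma norm_exp_A: "norm (exp (r *\<^sub>R A)) \<le> exp (\<bar>r\<bar> * \<alpha>)"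
proof -
  have "norm (exp (r *\<^sub>R A)) \<le> exp (norm (r *\<^sub>R A))" by (rule norm_exp)
  also have "\<dots> \<le> exp (\<bar>r\<bar> * \<alpha>)" using \<alpha> by (simp add: mult_left_mono)
  finally show ?thesis .
qed

lemma norm_exp_csm_A: "norm (exp (csm c * A)) \<le> exp (\<alpha> * cmod c)"
proof -
  have "norm (exp (csm c * A)) \<le> exp (norm (csm c * A))" by (rule norm_exp)
  also have "norm (csm c * A) \<le> \<alpha> * cmod c"
    using norm_csm_mult_le[of c A] mult_right_mono[OF \<alpha>, of "cmod c"] by (simp add: mult.commute)
  finally show ?thesis by simp
qed

lemma norm_M_minus: "z \<in> strip1 h \<Longrightarrow> norm (M z - exp A) \<le> 2 * \<epsilon> * exp \<alpha>"
proof -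
  assume z: "z \<in> strip1 h"
  have "M z - exp A = exp A * (exp (G z) - 1)" by (simp add: M_def algebra_simps)
  then have "norm (M z - exp A) \<le> norm (exp A) * norm (exp (G z) - 1)" using norm_mult_ineq by metis
  also have "\<dots> \<le> exp \<alpha> * (2 * \<epsilon>)"
    using norm_exp_A[of 1] norm_exp_minus_one_le[OF G_le[OF z] \<epsilon>(2)] by (intro mult_mono) auto
  finally show ?thesis by (simp add: mult_ac)
qed

lemma norm_Minv_minus: "z \<in> strip1 h \<Longrightarrow> norm (Minv z - exp (- A)) \<le> 2 * \<epsilon> * exp \<alpha>"
proof -
  assume z: "z \<in> strip1 h"
  have "norm (- G z) \<le> \<epsilon>" using G_le[OF z] by simp
  note * = norm_exp_minus_one_le[OF this \<epsilon>(2)]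
  have "Minv z - exp (- A) = (exp (- G z) - 1) * exp (- A)" by (simp add: Minv_def algebra_simps)
  then have "norm (Minv z - exp (- A)) \<le> norm (exp (- G z) - 1) * norm (exp (- A))" using norm_mult_ineq by metis
  also have "\<dots> \<le> (2 * \<epsilon>) * exp \<alpha>"
    using norm_exp_A[of "-1"] * \<epsilon> by (intro mult_mono) auto
  finally show ?thesis by (simp add: mult_ac)
qed

lemma norm_Mc_le:
  assumes z: "z \<in> strip1 h"
  shows "norm (Mc l z) \<le> exp ((\<alpha> + 2) * \<bar>real_of_int l\<bar>)"
    and "norm (Mc l z - exp (csm (of_int l) * A)) \<le> \<epsilon> * exp ((\<alpha> + 2) * \<bar>real_of_int l\<bar>)"
proof -
  \<comment> \<open>Absorbs the 3 of \<open>norm_iterate_le\<close> into the exponent, which is the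
    origin of the 2 in \<open>\<alpha> + 2\<close>.\<close>
  have "(3::real) \<le> exp 2" using exp_ge_add_one_self[of "2::real"] by simp
  then have "3 * exp \<alpha> \<le> exp 2 * exp \<alpha>" by simp
  then have q: "3 * exp \<alpha> \<le> exp (\<alpha> + 2)" by (simp add: exp_add mult.commute)
  have qn: "(3 * exp \<alpha>) ^ n \<le> exp ((\<alpha> + 2) * real n)" for n
    using power_mono[OF q, of n] by (simp add: exp_of_nat2_mult)
  have p: "norm (Mp n z) \<le> (3 * exp \<alpha>) ^ n" "norm (Mp n z - exp A ^ n) \<le> \<epsilon> * (3 * exp \<alpha>) ^ n" for n
    using norm_iterate_le[of "\<lambda>n. Mp n z" "\<lambda>n. M (z + cvec (real n *\<^sub>R \<mu>))" "exp A" \<epsilon> "exp \<alpha>" n]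
      norm_M_minus z norm_exp_A[of 1] \<epsilon> \<alpha>0 by auto
  have m: "norm (Mn n z) \<le> (3 * exp \<alpha>) ^ n" "norm (Mn n z - exp (- A) ^ n) \<le> \<epsilon> * (3 * exp \<alpha>) ^ n" for n
    using norm_iterate_le[of "\<lambda>n. Mn n z" "\<lambda>n. Minv (z + cvec (- real (Suc n) *\<^sub>R \<mu>))" "exp (- A)" \<epsilon> "exp \<alpha>" n]
      norm_Minv_minus z norm_exp_A[of "-1"] \<epsilon> \<alpha>0 by auto
  have ce: "exp (csm (of_int l) * A) = (if l \<ge> 0 then exp A ^ nat l else exp (- A) ^ nat (- l))"
  proof (cases "l \<ge> 0")
    case True
    then have "csm (of_int l) * A = of_nat (nat l) * A"
      using csm_of_real[of "of_int l", where 'n='n] by simp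
    then show ?thesis using True exp_of_nat_times[of "nat l" A] by simp
  next
    case False
    then have "csm (of_int l) * A = of_nat (nat (- l)) * (- A)"
      using csm_of_real[of "of_int l", where 'n='n] by simp
    then show ?thesis using False exp_of_nat_times[of "nat (- l)" "- A"] by simp
  qed
  show "norm (Mc l z) \<le> exp ((\<alpha> + 2) * \<bar>real_of_int l\<bar>)"
  proof (cases "l \<ge> 0")
    case True
    then show ?thesis using order_trans[OF p(1) qn, of "nat l"] by (simp add: Mc_def)
  next
    case False
    then show ?thesis using order_trans[OF m(1) qn, of "nat (- l)"] by (simp add: Mc_def)
  qed
  show "norm (Mc l z - exp (csm (of_int l) * A)) \<le> \<epsilon> * exp ((\<alpha> + 2) * \<bar>real_of_int l\<bar>)"
  proof (cases "l \<ge> 0")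
    case True
    then show ?thesis using order_trans[OF p(2) mult_left_mono[OF qn \<epsilon>(1)], of "nat l"] by (simp add: Mc_def ce)
  next
    case False
    then show ?thesis using order_trans[OF m(2) mult_left_mono[OF qn \<epsilon>(1)], of "nat (- l)"] by (simp add: Mc_def ce)
  qed
qed

lemma norm_weighted_term_le:
  assumes \<eta>: "rapid C \<eta>" and a: "\<bar>Im a\<bar> < h" "cmod a \<le> N" and Z: "norm Z \<le> c * exp ((\<alpha> + 2) * \<bar>real_of_int l\<bar>)" and c: "c \<ge> 0"
  shows "norm (csm (\<eta> (a - of_int l)) * (exp (csm (a - of_int l) * A) * Z)) \<le> (C * c * exp ((2 * \<alpha> + 3) * N)) * wt l"
proof -
  let ?d = "cmod (a - of_int l)" and ?l = "\<bar>real_of_int l\<bar>"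
  have C: "C \<ge> 0" using \<eta> by (simp add: rapid_def)
  have e: "cmod (\<eta> (a - of_int l)) \<le> C * exp (- (2 * \<alpha> + 3) * ?d)"
    using \<eta> a unfolding rapid_def by simp
  have "norm (csm (\<eta> (a - of_int l)) * (exp (csm (a - of_int l) * A) * Z))
      \<le> cmod (\<eta> (a - of_int l)) * (norm (exp (csm (a - of_int l) * A)) * norm Z)"
    by (rule order_trans[OF norm_csm_mult_le]) (intro mult_left_mono norm_mult_ineq, simp)
  also have "\<dots> \<le> (C * exp (- (2 * \<alpha> + 3) * ?d)) * (exp (\<alpha> * ?d) * (c * exp ((\<alpha> + 2) * ?l)))"
    using e norm_exp_csm_A Z c C by (intro mult_mono) auto
  also have "\<dots> = C * c * exp (- (2 * \<alpha> + 3) * ?d + \<alpha> * ?d + (\<alpha> + 2) * ?l)"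
    by (simp add: exp_add)
  also have "\<dots> \<le> C * c * exp ((2 * \<alpha> + 3) * N + - ?l)"
  proof -
    \<comment> \<open>The weight decays in the distance of \<open>a\<close> from \<open>l\<close>,
      the iterate grows in \<open>|l|\<close>; a bound \<open>N\<close> on \<open>cmod a\<close>
      makes the two comparable.\<close>
    have "?l - N \<le> ?d" using norm_triangle_ineq2[of "of_int l" a] a(2) by (simp add: norm_minus_commute)
    then have "(\<alpha> + 3) * (?l - N) \<le> (\<alpha> + 3) * ?d" using \<alpha>0 by (intro mult_left_mono) auto
    moreover have "0 \<le> \<alpha> * N" using \<alpha>0 a(2) norm_ge_zero[of a] by (intro mult_nonneg_nonneg) linarith+
    ultimately have "- (2 * \<alpha> + 3) * ?d + \<alpha> * ?d + (\<alpha> + 2) * ?l \<le> (2 * \<alpha> + 3) * N + - ?l"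
      by (simp add: algebra_simps)
    then show ?thesis using C c by (intro mult_left_mono) auto
  qed
  finally show ?thesis unfolding exp_add wt_def by (simp only: mult.assoc)
qed

lemma norm_T_le:
  assumes "rapid C \<eta>" "w \<in> S" "cmod (fst w) \<le> N"
  shows "norm (T \<eta> l w) \<le> (C * 1 * exp ((2 * \<alpha> + 3) * N)) * wt l"
  unfolding T_def
  by (rule norm_weighted_term_le[OF assms(1) _ assms(3)])
    (use assms strip2_fst[of "fst w" "snd w" h \<mu>] h norm_Mc_le(1)[OF untwist_strip1] in auto)

lemma zsummable_T: "rapid C \<eta> \<Longrightarrow> w \<in> S \<Longrightarrow> zsummable (\<lambda>l. T \<eta> l w)"
  by (rule norm_isum_le(1)[OF norm_T_le[OF _ _ order_refl]])

lemma fhol_Mc: "fhol \<mu> (\<lambda>w. Mc l (untwist \<mu> w)) (\<lambda>_. 0) S"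
proof -
  have eG: "fhol \<mu> (\<lambda>w. exp (G (untwist \<mu> w + cvec x))) (\<lambda>_. 0) S" for x
    by (rule fhol_exp_flow_invariant[OF open_strip2 fhol_untwist[OF G_holo order_refl], where r=\<epsilon>])
      (simp add: G_le untwist_strip1)
  have "holo1 (\<lambda>z. - G z) (strip1 h)"
    using G_holo unfolding holo1_def by (metis has_derivative_minus mult_minus_right)
  then have eG': "fhol \<mu> (\<lambda>w. exp (- G (untwist \<mu> w + cvec x))) (\<lambda>_. 0) S" for x
    using fhol_exp_flow_invariant[OF open_strip2 fhol_untwist[OF _ order_refl, where G="\<lambda>z. - G z" and h=h], where r=\<epsilon> and \<mu>=\<mu>]
    by (simp add: G_le untwist_strip1)
  have M: "fhol \<mu> (\<lambda>w. M (untwist \<mu> w + cvec x)) (\<lambda>_. 0) S" for x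
    using fhol_mult[OF fhol_const[of \<mu> "exp A"] eG[of x]] by (simp add: M_def)
  have Mi: "fhol \<mu> (\<lambda>w. Minv (untwist \<mu> w + cvec x)) (\<lambda>_. 0) S" for x
    using fhol_mult[OF eG'[of x] fhol_const[of \<mu> "exp (- A)"]] by (simp add: Minv_def)
  have "fhol \<mu> (\<lambda>w. Mp n (untwist \<mu> w)) (\<lambda>_. 0) S" for n
  proof (induction n)
    case (Suc n)
    show ?case using fhol_mult[OF M Suc, of "real n *\<^sub>R \<mu>"] by simp
  qed (simp add: fhol_const)
  moreover have "fhol \<mu> (\<lambda>w. Mn n (untwist \<mu> w)) (\<lambda>_. 0) S" for n
  proof (induction n)
    case (Suc n)
    show ?case using fhol_mult[OF Mi Suc, of "- real (Suc n) *\<^sub>R \<mu>"] by simp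
  qed (simp add: fhol_const)
  ultimately show ?thesis by (cases "l \<ge> 0") (simp_all add: Mc_def)
qed

text \<open>In each term the iterate is constant along the flow. The derivative of the weight gives
  the blend of \<open>\<eta>'\<close>, and that of the exponential a left factor \<open>A\<close>
  which does not depend on \<open>l\<close> and leaves the sum.\<close>

lemma fhol_blend:
  assumes \<eta>: "rapid C \<eta>" and \<eta>': "rapid C' \<eta>'" and d: "\<And>t. (\<eta> has_field_derivative \<eta>' t) (at t)"
  shows "fhol \<mu> (blend \<eta>) (\<lambda>w. blend \<eta>' w + A * blend \<eta> w) S"
proof -
  have fT: "fhol \<mu> (T \<eta> l) (\<lambda>w. T \<eta>' l w + A * T \<eta> l w) S" for l
  proof -
    have "fhol \<mu> (\<lambda>w. csm (\<eta> (fst w - of_int l)) * (exp (csm (fst w - of_int l) * A) * Mc l (untwist \<mu> w)))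
      (\<lambda>w. csm (\<eta>' (fst w - of_int l)) * (exp (csm (fst w - of_int l) * A) * Mc l (untwist \<mu> w)) +
        csm (\<eta> (fst w - of_int l)) * (A * exp (csm (fst w - of_int l) * A) * Mc l (untwist \<mu> w) +
           exp (csm (fst w - of_int l) * A) * 0)) S"
      by (intro fhol_mult fhol_csm_fst fhol_exp_csm_fst fhol_Mc d)
    moreover have "csm c * (A * x * y) = A * (csm c * (x * y))" for c x y
      by (metis csm_commute mult.assoc)
    ultimately show ?thesis by (simp add: T_def[abs_def] mult.assoc)
  qed
  \<comment> \<open>The termwise bounds grow with \<open>cmod a\<close>, which is unbounded on the
    strip. Differentiation is local, so it is done on an exhaustion by open pieces.\<close>
  define U where "U N = S \<inter> {w. cmod (fst w) < real N}" for N
  have U: "open (U N)" "U N \<subseteq> S" for N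
    unfolding U_def by (auto intro!: open_Int open_strip2 open_Collect_less continuous_intros)
  have "fhol \<mu> (\<lambda>w. isum (\<lambda>l. T \<eta> l w)) (\<lambda>w. isum (\<lambda>l. T \<eta>' l w + A * T \<eta> l w)) (U N)" for N
    by (rule fhol_isum[OF U(1) fhol_subset[OF fT U(2)], where c="C * 1 * exp ((2 * \<alpha> + 3) * real N)"])
      (use norm_T_le[OF \<eta>] in \<open>auto simp: U_def\<close>)
  then have "fhol \<mu> (\<lambda>w. isum (\<lambda>l. T \<eta> l w)) (\<lambda>w. isum (\<lambda>l. T \<eta>' l w + A * T \<eta> l w)) (\<Union>N. U N)"
    by (intro fhol_UN)
  moreover have "(\<Union>N. U N) = S"
    unfolding U_def using reals_Archimedean2 by auto
  ultimately have *: "fhol \<mu> (\<lambda>w. isum (\<lambda>l. T \<eta> l w)) (\<lambda>w. isum (\<lambda>l. T \<eta>' l w + A * T \<eta> l w)) S" by simp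
  show ?thesis
  proof (rule fhol_cong[OF * open_strip2])
    fix w assume w: "w \<in> S"
    have sA: "zsummable (\<lambda>l. A * T \<eta> l w)"
      by (rule zsummable_comparison[OF zsummable_T[OF \<eta> w], of _ "norm A"]) (rule norm_mult_ineq)
    show "isum (\<lambda>l. T \<eta>' l w + A * T \<eta> l w) = blend \<eta>' w + A * blend \<eta> w"
      using isum_add[OF zsummable_T[OF \<eta>' w] sA] isum_linear[OF bounded_linear_mult_right zsummable_T[OF \<eta> w], of A]
      by (simp add: blend_def)
  qed (simp add: blend_def)
qed

text \<open>A unit of time moves the weights and the base point together; after the index is shifted
  by one, the cocycle identity leaves the same right factor in every term.\<close>

lemma blend_step:
  assumes \<eta>: "rapid C \<eta>" and w: "(a, z) \<in> S"
  shows "blend \<eta> (a + 1, z) = blend \<eta> (a, z) * M (untwist \<mu> (a + 1, z))"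
proof -
  have u: "untwist \<mu> (a, z) = untwist \<mu> (a + 1, z) + cvec \<mu>"
    by (simp add: untwist_def cscaleV_def vec_eq_iff algebra_simps)
  have "T \<eta> (l + 1) (a + 1, z) = T \<eta> l (a, z) * M (untwist \<mu> (a + 1, z))" for l
    by (simp add: T_def u Mc_shift mult.assoc)
  then have e: "T \<eta> l (a + 1, z) = T \<eta> (l + (-1)) (a, z) * M (untwist \<mu> (a + 1, z))" for l
    by (metis add.commute add_minus_cancel)
  have "blend \<eta> (a + 1, z) = isum (\<lambda>l. T \<eta> (l + (-1)) (a, z) * M (untwist \<mu> (a + 1, z)))"
    unfolding blend_def e ..
  also have "\<dots> = isum (\<lambda>l. T \<eta> (l + (-1)) (a, z)) * M (untwist \<mu> (a + 1, z))"
    by (rule isum_linear[OF bounded_linear_mult_left zsummable_shift[OF zsummable_T[OF \<eta> w]]])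
  also have "isum (\<lambda>l. T \<eta> (l + (-1)) (a, z)) = blend \<eta> (a, z)"
    unfolding blend_def by (rule isum_shift[OF zsummable_T[OF \<eta> w]])
  finally show ?thesis .
qed

text \<open>The subtracted term is the blend for \<open>G = 0\<close>. Only the differences of
  \<open>M_l\<close> and \<open>exp (l A)\<close> remain, and these carry a factor \<epsilon>. The
  applications are \<open>s = 1\<close> for \<rho> and \<open>s = 0\<close> for its
  derivative.\<close>

lemma norm_blend_minus_le:
  assumes \<eta>: "rapid C \<eta>" and w: "(a, z) \<in> S" and a: "cmod a \<le> N"
    and s: "isum (\<lambda>l. \<eta> (a - of_int l)) = s" "zsummable (\<lambda>l. \<eta> (a - of_int l))"
  shows "norm (blend \<eta> (a, z) - csm s * exp (csm a * A)) \<le> C * exp ((2 * \<alpha> + 3) * N) * isum wt * \<epsilon>"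
proof -
  define Z where "Z l = Mc l (untwist \<mu> (a, z)) - exp (csm (of_int l) * A)" for l
  have e: "exp (csm (a - of_int l) * A) * exp (csm (of_int l) * A) = exp (csm a * A)" for l
  proof -
    have "(csm (a - of_int l) * A) * (csm (of_int l) * A) = (csm (of_int l) * A) * (csm (a - of_int l) * A)"
      by (metis csm_commute mult.assoc)
    from exp_add_commuting[OF this] show ?thesis
      by (simp add: distrib_right[symmetric] csm_add[symmetric])
  qed
  have "csm s * exp (csm a * A) = isum (\<lambda>l. csm (\<eta> (a - of_int l)) * exp (csm a * A))"
    using isum_linear[OF bounded_linear_compose[OF bounded_linear_mult_left[of "exp (csm a * A)"] bounded_linear_csm] s(2)] s(1)
    by simp
  moreover have "zsummable (\<lambda>l. csm (\<eta> (a - of_int l)) * exp (csm a * A))"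
    by (rule zsummable_comparison[OF s(2), of _ "norm (exp (csm a * A))"])
      (metis norm_csm_mult_le mult.commute)
  ultimately have "blend \<eta> (a, z) - csm s * exp (csm a * A) =
      isum (\<lambda>l. T \<eta> l (a, z) - csm (\<eta> (a - of_int l)) * exp (csm a * A))"
    unfolding blend_def by (simp add: isum_diff[OF zsummable_T[OF \<eta> w]])
  also have "\<dots> = isum (\<lambda>l. csm (\<eta> (a - of_int l)) * (exp (csm (a - of_int l) * A) * Z l))"
    by (rule arg_cong[of _ _ isum]) (simp add: T_def Z_def e right_diff_distrib fun_eq_iff)
  also have "norm \<dots> \<le> (C * \<epsilon> * exp ((2 * \<alpha> + 3) * N)) * isum wt"
    by (rule norm_isum_le(2), rule norm_weighted_term_le[OF \<eta> strip2_fst[OF w h] a _ \<epsilon>(1)])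
      (use norm_Mc_le(2)[OF untwist_strip1[OF w]] in \<open>simp add: Z_def\<close>)
  finally show ?thesis by (simp add: mult_ac)
qed

lemma blend_of_int:
  assumes "\<And>n::int. \<eta> (of_int n) = (if n = 0 then 1 else 0)"
  shows "blend \<eta> (of_int m, z) = Mc m (untwist \<mu> (of_int m, z))"
proof -
  have "T \<eta> l (of_int m, z) = (if l = m then Mc l (untwist \<mu> (of_int m, z)) else 0)" for l
    using assms[of "m - l"] by (simp add: T_def)
  then show ?thesis unfolding blend_def by (simp add: isum_delta)
qed

lemma blend_periodic:
  assumes "\<And>z. G (z + u) = G z"
  shows "blend \<eta> (a, z + u) = blend \<eta> (a, z)"
proof -
  have "untwist \<mu> (a, z + u) = untwist \<mu> (a, z) + u" by (simp add: untwist_def)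
  then show ?thesis by (simp add: blend_def T_def Mc_periodic[OF assms])
qed

end

section \<open>The embedding of a small cocycle\<close>

text \<open>Transposition without conjugation, because a complex linear operation preserves
  holomorphy.\<close>

lift_definition optr :: "'n::finite opmat \<Rightarrow> 'n opmat" is transpose .

lemma optr_optr [simp]: "optr (optr x) = x" by transfer simp

lemma optr_mult: "optr (x * y) = optr y * optr x"
  by transfer (simp add: matrix_transpose_mul)

lemma optr_1 [simp]: "optr 1 = 1" by transfer simp

lemma optr_csm_mult: "optr (csm c * x) = csm c * optr x"
proof -
  have "optr (csm c) = csm c" by transfer (auto simp: transpose_def mat_def vec_eq_iff)
  then show ?thesis by (metis csm_commute optr_mult)
qed

definition optr_bound :: "'n::finite itself \<Rightarrow> real" where
  "optr_bound _ = 1 + (real CARD('n))\<^sup>2"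

lemma norm_optr_le: "norm (optr x) \<le> optr_bound TYPE('n) * norm x" for x :: "'n::finite opmat"
proof -
  have "norm (optr x) \<le> (\<Sum>i\<in>(UNIV::'n set). \<Sum>j\<in>(UNIV::'n set). norm (mat_of (optr x) $ i $ j))"
    by (rule norm_opmat_le_sum)
  also have "\<dots> \<le> (\<Sum>i\<in>(UNIV::'n set). \<Sum>j\<in>(UNIV::'n set). norm x)"
    using norm_entry_le[of x] by (intro sum_mono) (simp add: optr.rep_eq transpose_def)
  also have "\<dots> \<le> optr_bound TYPE('n) * norm x"
    by (simp add: optr_bound_def power2_eq_square algebra_simps)
  finally show ?thesis .
qed

lemma bounded_linear_optr: "bounded_linear (optr :: 'n::finite opmat \<Rightarrow> _)"
proof (rule bounded_linear_intro)
  show "optr (x + y) = optr x + optr y" for x y :: "'n opmat"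
    by transfer (simp add: transpose_def vec_eq_iff)
  show "optr (r *\<^sub>R x) = r *\<^sub>R optr x" for r and x :: "'n opmat"
    by transfer (simp add: transpose_def vec_eq_iff)
  show "norm (optr x) \<le> norm x * optr_bound TYPE('n)" for x :: "'n opmat"
    using norm_optr_le[of x] by (simp add: mult.commute)
qed

lemma antihom_power:
  assumes "\<And>x y. L (x * y) = L y * L x" "L 1 = 1"
  shows "L (x ^ n) = (L x :: 'a::monoid_mult) ^ n"
  by (induction n) (simp_all add: assms power_commutes)

lemma hom_power:
  assumes "\<And>x y. L (x * y) = L x * L y" "L 1 = 1"
  shows "L (x ^ n) = (L x :: 'a::monoid_mult) ^ n"
  by (induction n) (simp_all add: assms)

text \<open>The hypothesis on powers holds for homomorphisms and antihomomorphisms alike. Real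
  linearity is enough since the coefficients are real, so complex conjugation is admissible.\<close>

lemma linear_exp:
  fixes L :: "'a::{real_normed_algebra_1,banach} \<Rightarrow> 'a"
  assumes "bounded_linear L" "\<And>n. L (x ^ n) = L x ^ n"
  shows "L (exp x) = exp (L x)"
  unfolding exp_def
  by (subst bounded_linear.suminf[OF assms(1) summable_exp_generic])
    (simp add: linear_cmul[OF bounded_linear.linear[OF assms(1)]] assms(2))

lemma linear_rsqrt:
  fixes L :: "'a::{real_normed_algebra_1,banach} \<Rightarrow> 'a"
  assumes "bounded_linear L" "\<And>n. L (y ^ n) = L y ^ n" "norm y \<le> 1 / 2"
  shows "L (rsqrt y) = rsqrt (L y)"
  unfolding rsqrt_def
  by (subst bounded_linear.suminf[OF assms(1) summable_rsqrt[OF assms(3)]])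
    (simp add: linear_cmul[OF bounded_linear.linear[OF assms(1)]] assms(2))

lemma optr_exp: "optr (exp x) = exp (optr x)"
  by (rule linear_exp[OF bounded_linear_optr antihom_power]) (simp_all add: optr_mult)

text \<open>The a priori bound \<open>D\<close> turns the quadratic error \<open>d^2\<close> into
  one linear in \<open>d\<close>.\<close>

lemma norm_mult_minus_le:
  fixes x :: "'a::real_normed_algebra"
  assumes "norm (x - x0) \<le> d" "norm (y - y0) \<le> d" "norm x0 \<le> m" "norm y0 \<le> m" "d \<le> D" "d \<ge> 0"
  shows "norm (x * y - x0 * y0) \<le> d * (2 * m + D)"
proof -
  have y: "norm y \<le> m + d" using norm_triangle_sub[of y y0] assms by linarith
  have m: "m \<ge> 0" using assms(3) norm_ge_zero order_trans by blast
  have "x * y - x0 * y0 = (x - x0) * y + x0 * (y - y0)" by (simp add: algebra_simps)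
  then have "norm (x * y - x0 * y0) \<le> norm (x - x0) * norm y + norm x0 * norm (y - y0)"
    using norm_triangle_mono[OF norm_mult_ineq norm_mult_ineq] by metis
  also have "\<dots> \<le> d * (m + d) + m * d" using assms y m by (intro add_mono mult_mono) auto
  also have "\<dots> \<le> d * (m + D) + m * d" using assms m by (intro add_mono mult_left_mono) auto
  finally show ?thesis by (simp add: algebra_simps)
qed

lemma strip2_shift [simp]: "(a + of_int n, z) \<in> strip2 h \<longleftrightarrow> (a, z) \<in> strip2 h" "(a + 1, z) \<in> strip2 h \<longleftrightarrow> (a, z) \<in> strip2 h"
  by (simp_all add: strip2_def)

lemma strip2_axis [simp]: "(a, z + axis j 1) \<in> strip2 h \<longleftrightarrow> (a, z) \<in> strip2 h"
proof -
  have "Im (axis j (1::complex) $ i) = 0" for i by (simp add: axis_def)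
  then show ?thesis by (simp add: strip2_def)
qed

lemma periodic_of_int:
  assumes "\<And>a. (a, z) \<in> strip2 h \<Longrightarrow> f (a + 1, z) = f (a, z)" "(a, z) \<in> strip2 h"
  shows "f (a + of_int n, z) = f (a, z)"
proof (induction n rule: int_induct[of _ 0])
  case (step1 i)
  show ?case using assms(1)[of "a + of_int i"] assms(2) step1 by (simp add: add.assoc)
next
  case (step2 i)
  have "f (a + of_int (i - 1) + 1, z) = f (a + of_int (i - 1), z)"
    by (rule assms(1)) (use assms(2) in \<open>simp del: of_int_diff\<close>)
  then show ?case using step2 by simp
qed simp

lemma fhol_unique:
  assumes "fhol \<mu> f f' S" "fhol \<mu> f f'' S" "z \<in> S"
  shows "f' z = f'' z"
  using assms unfolding fhol_def by (metis has_derivative_unique)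

lemma fhol_has_vector_derivative:
  fixes x :: "real^'d"
  assumes "fhol \<mu> f f' (strip2 k)" "k > 0"
  shows "((\<lambda>t. f (of_real t, cvec (x + t *\<^sub>R \<mu>))) has_vector_derivative f' (of_real t, cvec (x + t *\<^sub>R \<mu>))) (at t)"
proof -
  let ?p = "\<lambda>t. (of_real t, cvec (x + t *\<^sub>R \<mu>)) :: complex \<times> (complex^'d)"
  have "?p t \<in> strip2 k" using assms(2) by (simp add: strip2_def cvec_def)
  then obtain D where D: "(f has_derivative D) (at (?p t))" "D (1, cvec \<mu>) = f' (?p t)"
    using assms(1) unfolding fhol_def by blast
  have "?p = (\<lambda>t. (0, cvec x) + t *\<^sub>R (1, cvec \<mu>))"
    by (simp add: fun_eq_iff cvec_simps of_real_def)
  moreover have "((\<lambda>t. (0, cvec x) + t *\<^sub>R (1, cvec \<mu>)) has_vector_derivative (1, cvec \<mu>)) (at t)"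
    by (auto intro!: derivative_eq_intros)
  ultimately have "(?p has_derivative (\<lambda>s. s *\<^sub>R (1, cvec \<mu>))) (at t)"
    by (simp add: has_vector_derivative_def)
  from has_derivative_compose[OF this D(1)]
  have "((\<lambda>t. f (?p t)) has_derivative (\<lambda>s. D (s *\<^sub>R (1, cvec \<mu>)))) (at t)" .
  moreover have "D (s *\<^sub>R (1, cvec \<mu>)) = s *\<^sub>R f' (?p t)" for s
    using linear_cmul[OF has_derivative_linear[OF D(1)]] D(2) by metis
  ultimately show ?thesis by (simp add: has_vector_derivative_def)
qed

text \<open>The matrices of the second cocycle are the inverse transposes of those of the first. Its
  blend, transposed, is the blend of the inverse iterates, so one set of estimates serves both
  blends.\<close>

locale embedding =
  P: small_cocycle A G \<mu> h \<alpha> \<epsilon> + Q: small_cocycle "- optr A" "\<lambda>z. - optr (G z)" \<mu> h \<alpha> \<epsilon>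
  for A :: "'n::finite opmat" and G :: "complex^'d \<Rightarrow> 'n opmat" and \<mu> :: "real^'d" and h \<alpha> \<epsilon> :: real +
  fixes \<rho> :: "complex \<Rightarrow> complex" and C :: real
  assumes \<rho>_holo: "\<rho> holomorphic_on UNIV" and \<rho>_decay: "strip_decay \<rho>"
    and \<rho>_sum: "\<And>t. isum (\<lambda>l. \<rho> (t - of_int l)) = 1"
    and \<rho>_int: "\<And>n::int. \<rho> (of_int n) = (if n = 0 then 1 else 0)"
    and \<rho>_real: "\<And>x::real. \<rho> (of_real x) \<in> \<real>"
    and C: "P.rapid C \<rho>" "P.rapid C (deriv \<rho>)"
    and G_periodic: "\<And>z j. G (z + axis j 1) = G z"
begin

abbreviation S where "S \<equiv> P.S"

definition B where "B = P.blend \<rho>"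
definition Bd where "Bd w = P.blend (deriv \<rho>) w + A * B w"
definition Bs where "Bs w = optr (Q.blend \<rho> w)"
definition Bsd where "Bsd w = optr (Q.blend (deriv \<rho>) w) + Bs w * (- A)"
definition Y where "Y w = B w * Bs w + (- 1)"
definition Yd where "Yd w = Bd w * Bs w + B w * Bsd w"
definition Z where "Z w = Bd w * Bs w"
definition R where "R w = rsqrt (Y w)"
definition Rd where "Rd w = drsqrt (Y w) (Yd w)"
definition \<Phi> where "\<Phi> w = R w * B w"
definition \<Phi>d where "\<Phi>d w = Rd w * B w + R w * Bd w"
definition \<Psi> where "\<Psi> w = Bs w * R w"
text \<open>\<open>\<Phi>d \<Psi> - A\<close> expanded so that \<open>B\<close>, \<open>Bs\<close>
  and their derivatives occur only inside the products \<open>Y\<close>, \<open>Yd\<close> and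
  \<open>Z\<close>; these are periodic in time, their factors are not.\<close>

definition F where "F w = Rd w * ((1 + Y w) * R w) + R w * (Z w * R w) + (- A)"

lemma deriv_\<rho>: "(\<rho> has_field_derivative deriv \<rho> t) (at t)"
  and deriv2_\<rho>: "(deriv \<rho> has_field_derivative deriv (deriv \<rho>) t) (at t)"
  using \<rho>_holo holomorphic_derivI holomorphic_deriv open_UNIV UNIV_I by blast+

lemma strip_decay_rapid: "strip_decay \<eta> \<Longrightarrow> \<exists>C. P.rapid C \<eta> \<and> Q.rapid C \<eta>"
  unfolding P.rapid_def Q.rapid_def strip_decay_def by (meson less_imp_le)

lemma CQ: "Q.rapid C \<rho>" "Q.rapid C (deriv \<rho>)"
  using C unfolding P.rapid_def Q.rapid_def by auto

lemma fhol_B: "fhol \<mu> B Bd S"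
  using P.fhol_blend[OF C deriv_\<rho>] by (simp add: B_def Bd_def[abs_def])

lemma fhol_Bs: "fhol \<mu> Bs Bsd S"
proof -
  have "fhol \<mu> (\<lambda>w. optr (Q.blend \<rho> w)) (\<lambda>w. optr (Q.blend (deriv \<rho>) w + - optr A * Q.blend \<rho> w)) S"
    by (rule fhol_linear[OF Q.fhol_blend[OF CQ deriv_\<rho>] bounded_linear_optr optr_csm_mult])
  moreover have "optr (x + - optr A * y) = optr x + optr y * (- A)" for x y
    using linear_add[OF bounded_linear.linear[OF bounded_linear_optr]]
      linear_neg[OF bounded_linear.linear[OF bounded_linear_optr]] by (simp add: optr_mult linear_diff[OF bounded_linear.linear[OF bounded_linear_optr]])
  ultimately show ?thesis by (simp add: Bs_def[abs_def] Bsd_def[abs_def])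
qed

text \<open>\<open>F\<close> contains the flow derivative of the blend, so its holomorphy brings in
  the second derivative of \<rho>.\<close>

lemma fhol_Bd: "\<exists>p. fhol \<mu> Bd p S"
proof -
  obtain C' where "P.rapid C' (deriv (deriv \<rho>))"
    using strip_decay_rapid[OF strip_decay_deriv[OF strip_decay_deriv[OF \<rho>_decay \<rho>_holo]]]
      holomorphic_deriv[OF \<rho>_holo open_UNIV] by blast
  from P.fhol_blend[OF C(2) this deriv2_\<rho>]
  have "fhol \<mu> (P.blend (deriv \<rho>)) (\<lambda>w. P.blend (deriv (deriv \<rho>)) w + A * P.blend (deriv \<rho>) w) S" .
  from fhol_add[OF this fhol_mult[OF fhol_const[of \<mu> A] fhol_B]] show ?thesis
    by (auto simp: Bd_def[abs_def])
qed

lemma fhol_Bsd: "\<exists>p. fhol \<mu> Bsd p S"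
proof -
  obtain C' where "Q.rapid C' (deriv (deriv \<rho>))"
    using strip_decay_rapid[OF strip_decay_deriv[OF strip_decay_deriv[OF \<rho>_decay \<rho>_holo]]]
      holomorphic_deriv[OF \<rho>_holo open_UNIV] by blast
  from fhol_linear[OF Q.fhol_blend[OF CQ(2) this deriv2_\<rho>] bounded_linear_optr optr_csm_mult]
  have "fhol \<mu> (\<lambda>w. optr (Q.blend (deriv \<rho>) w)) (\<lambda>w. optr (Q.blend (deriv (deriv \<rho>)) w + - optr A * Q.blend (deriv \<rho>) w)) S" .
  from fhol_add[OF this fhol_mult[OF fhol_Bs fhol_const[of \<mu> "- A"]]] show ?thesis
    by (auto simp: Bsd_def[abs_def])
qed

lemma fhol_Y: "fhol \<mu> Y Yd S"
  using fhol_add[OF fhol_mult[OF fhol_B fhol_Bs] fhol_const[of \<mu> "- 1"]]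
  by (simp add: Y_def[abs_def] Yd_def[abs_def])

lemma fhol_Yd: "\<exists>p. fhol \<mu> Yd p S"
proof -
  obtain p q where p: "fhol \<mu> Bd p S" and q: "fhol \<mu> Bsd q S" using fhol_Bd fhol_Bsd by blast
  from fhol_add[OF fhol_mult[OF p fhol_Bs] fhol_mult[OF fhol_B q]] show ?thesis
    by (auto simp: Yd_def[abs_def])
qed

lemma fhol_Z: "\<exists>p. fhol \<mu> Z p S"
proof -
  obtain p where p: "fhol \<mu> Bd p S" using fhol_Bd by blast
  from fhol_mult[OF p fhol_Bs] show ?thesis by (auto simp: Z_def[abs_def])
qed

lemma optr_QM: "optr (Q.M z) = P.Minv z"
  by (simp add: Q.M_def P.Minv_def optr_mult optr_exp linear_neg[OF bounded_linear.linear[OF bounded_linear_optr]])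

text \<open>One period multiplies \<open>B\<close> and \<open>Bd\<close> by \<open>M\<close> on the
  right, \<open>Bs\<close> and \<open>Bsd\<close> by its inverse on the left, and the two meet in
  the middle of each product. In the opposite order the products would be conjugated by
  \<open>M\<close> instead of preserved.\<close>

lemma blends_periodic:
  assumes w: "(a, z) \<in> S"
  shows "Y (a + 1, z) = Y (a, z)" "Yd (a + 1, z) = Yd (a, z)" "Z (a + 1, z) = Z (a, z)"
proof -
  let ?m = "P.M (untwist \<mu> (a + 1, z))" and ?mi = "P.Minv (untwist \<mu> (a + 1, z))"
  have B: "B (a + 1, z) = B (a, z) * ?m" unfolding B_def by (rule P.blend_step[OF C(1) w])
  have Bd: "Bd (a + 1, z) = Bd (a, z) * ?m"
    unfolding Bd_def B by (simp add: P.blend_step[OF C(2) w] distrib_right mult.assoc)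
  have Bs: "Bs (a + 1, z) = ?mi * Bs (a, z)"
    unfolding Bs_def by (simp add: Q.blend_step[OF CQ(1) w] optr_mult optr_QM)
  have Bsd: "Bsd (a + 1, z) = ?mi * Bsd (a, z)"
    unfolding Bsd_def Bs by (simp add: Q.blend_step[OF CQ(2) w] optr_mult optr_QM right_diff_distrib mult.assoc)
  have c: "x * ?m * (?mi * y) = x * y" for x y
    by (simp add: mult.assoc P.M_Minv(1) flip: mult.assoc[of ?m])
  show "Y (a + 1, z) = Y (a, z)" "Yd (a + 1, z) = Yd (a, z)" "Z (a + 1, z) = Z (a, z)"
    unfolding Y_def Yd_def Z_def B Bd Bs Bsd c by simp_all
qed

lemma F_step: "(a, z) \<in> S \<Longrightarrow> F (a + 1, z) = F (a, z)"
  by (simp add: F_def R_def Rd_def blends_periodic)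

lemma F_axis: "F (a, z + axis j 1) = F (a, z)"
proof -
  have "P.blend \<eta> (a, z + axis j 1) = P.blend \<eta> (a, z)" "Q.blend \<eta> (a, z + axis j 1) = Q.blend \<eta> (a, z)" for \<eta>
    by (rule P.blend_periodic Q.blend_periodic; simp add: G_periodic)+
  then show ?thesis
    by (simp add: F_def R_def Rd_def Y_def Yd_def Z_def B_def Bd_def Bs_def Bsd_def)
qed

text \<open>\<open>m\<close> bounds the unperturbed factors \<open>exp (a A)\<close>,
  \<open>exp (- a A)\<close> and their products with \<open>A\<close> over one period.
  \<open>D\<close> is a Lipschitz constant in \<epsilon> for the four blends:
  \<open>1 + \<alpha>\<close> comes from the term with \<open>A\<close> in the derivatives,
  \<open>optr_bound\<close> from transposing. \<open>D2\<close> is the resulting constant for the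
  products.\<close>

definition m where "m = (1 + \<alpha>) * exp (\<alpha> * (1 + h))"
definition D where "D = optr_bound TYPE('n) * ((1 + \<alpha>) * (2 * (C * exp ((2 * \<alpha> + 3) * (1 + h)) * isum wt)))"
definition D2 where "D2 = D * (2 * m + D)"

lemma isum_wt_nonneg: "isum wt \<ge> 0"
  unfolding isum_def by (rule suminf_nonneg[OF zsummable_D[OF zsummable_wt]]) (simp add: wt_def)

lemma C_nonneg: "C \<ge> 0" using C(1) by (simp add: P.rapid_def)

lemma blends_near:
  assumes w: "(a, z) \<in> S" and a: "cmod a \<le> 1 + h"
  shows "norm (B (a, z) - exp (csm a * A)) \<le> D * \<epsilon>"
    and "norm (Bd (a, z) - A * exp (csm a * A)) \<le> D * \<epsilon>"
    and "norm (Bs (a, z) - exp (- (csm a * A))) \<le> D * \<epsilon>"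
    and "norm (Bsd (a, z) - exp (- (csm a * A)) * (- A)) \<le> D * \<epsilon>"
proof -
  define c where "c = C * exp ((2 * \<alpha> + 3) * (1 + h)) * isum wt"
  define \<tau> where "\<tau> = optr_bound TYPE('n)"
  have c: "c \<ge> 0" using C_nonneg isum_wt_nonneg by (simp add: c_def)
  have \<tau>1: "\<tau> \<ge> 1" by (simp add: \<tau>_def optr_bound_def)
  have \<alpha>0: "\<alpha> \<ge> 0" by (rule P.\<alpha>0)
  have D: "D = \<tau> * ((1 + \<alpha>) * (2 * c))" by (simp add: D_def c_def \<tau>_def)
  have ce: "c * \<epsilon> \<ge> 0" using c P.\<epsilon> by simp
  have De: "\<tau> * (c * \<epsilon>) \<le> D * \<epsilon>" "\<tau> * (c * \<epsilon> + \<alpha> * (c * \<epsilon>)) \<le> D * \<epsilon>" "\<tau> * (c * \<epsilon>) + \<tau> * (c * \<epsilon>) * \<alpha> \<le> D * \<epsilon>"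
    using c P.\<epsilon>(1) \<tau>1 \<alpha>0
    by (auto simp: D algebra_simps intro!: add_nonneg_nonneg mult_nonneg_nonneg)
  have De': "x \<le> \<tau> * x" if "x \<ge> 0" for x using \<tau>1 that by (simp add: mult_le_cancel_right1)
  have zs: "zsummable (\<lambda>l. \<rho> (a - of_int l))" "zsummable (\<lambda>l. deriv \<rho> (a - of_int l))"
    using zsummable_strip_decay \<rho>_decay strip_decay_deriv[OF \<rho>_decay \<rho>_holo] by blast+
  have s0: "isum (\<lambda>l. deriv \<rho> (a - of_int l)) = 0"
    by (rule isum_deriv_translates_eq_0[OF \<rho>_holo \<rho>_decay \<rho>_sum])
  have b: "norm (P.blend \<rho> (a, z) - exp (csm a * A)) \<le> c * \<epsilon>"
    using P.norm_blend_minus_le[OF C(1) w a \<rho>_sum zs(1)] by (simp add: c_def)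
  have bd: "norm (P.blend (deriv \<rho>) (a, z)) \<le> c * \<epsilon>"
    using P.norm_blend_minus_le[OF C(2) w a s0 zs(2)] by (simp add: c_def)
  have q: "norm (Q.blend \<rho> (a, z) - exp (csm a * (- optr A))) \<le> c * \<epsilon>"
    using Q.norm_blend_minus_le[OF CQ(1) w a \<rho>_sum zs(1)] by (simp add: c_def)
  have qd: "norm (Q.blend (deriv \<rho>) (a, z)) \<le> c * \<epsilon>"
    using Q.norm_blend_minus_le[OF CQ(2) w a s0 zs(2)] by (simp add: c_def)
  have ol: "norm (optr x) \<le> \<tau> * (c * \<epsilon>)" if "norm x \<le> c * \<epsilon>" for x :: "'n opmat"
    using norm_optr_le[of x] mult_left_mono[OF that, of \<tau>] \<tau>1 unfolding \<tau>_def by linarith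
  show "norm (B (a, z) - exp (csm a * A)) \<le> D * \<epsilon>"
    using b De(1) De'[OF ce] unfolding B_def by linarith
  have Ab: "norm (A * (P.blend \<rho> (a, z) - exp (csm a * A))) \<le> \<alpha> * (c * \<epsilon>)"
    using norm_mult_ineq mult_mono[OF P.\<alpha> b \<alpha>0] order_trans by (metis norm_ge_zero)
  have "norm (Bd (a, z) - A * exp (csm a * A)) =
     norm (P.blend (deriv \<rho>) (a, z) + A * (P.blend \<rho> (a, z) - exp (csm a * A)))"
    by (simp add: Bd_def B_def algebra_simps)
  also have "\<dots> \<le> c * \<epsilon> + \<alpha> * (c * \<epsilon>)" using norm_triangle_mono[OF bd Ab] .
  finally show "norm (Bd (a, z) - A * exp (csm a * A)) \<le> D * \<epsilon>"
    using De(2) De'[of "c * \<epsilon> + \<alpha> * (c * \<epsilon>)"] ce \<alpha>0 by (simp add: mult_nonneg_nonneg)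
  have oe: "optr (exp (csm a * (- optr A))) = exp (- (csm a * A))"
    by (simp add: optr_exp optr_csm_mult linear_neg[OF bounded_linear.linear[OF bounded_linear_optr]])
  have bs: "norm (Bs (a, z) - exp (- (csm a * A))) \<le> \<tau> * (c * \<epsilon>)"
    using ol[OF q] unfolding Bs_def
    by (simp add: linear_diff[OF bounded_linear.linear[OF bounded_linear_optr]] oe[simplified])
  then show "norm (Bs (a, z) - exp (- (csm a * A))) \<le> D * \<epsilon>" using De(1) by linarith
  have bA: "norm ((Bs (a, z) - exp (- (csm a * A))) * (- A)) \<le> \<tau> * (c * \<epsilon>) * \<alpha>"
  proof -
    have "norm (- A) \<le> \<alpha>" using P.\<alpha> by simp
    from mult_mono[OF bs this] have "norm (Bs (a, z) - exp (- (csm a * A))) * norm (- A) \<le> \<tau> * (c * \<epsilon>) * \<alpha>"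
      using \<tau>1 ce by simp
    then show ?thesis by (rule order_trans[OF norm_mult_ineq])
  qed
  have "norm (Bsd (a, z) - exp (- (csm a * A)) * (- A)) =
     norm (optr (Q.blend (deriv \<rho>) (a, z)) + (Bs (a, z) - exp (- (csm a * A))) * (- A))"
    by (simp add: Bsd_def algebra_simps)
  also have "\<dots> \<le> \<tau> * (c * \<epsilon>) + \<tau> * (c * \<epsilon>) * \<alpha>" using norm_triangle_mono[OF ol[OF qd] bA] .
  finally show "norm (Bsd (a, z) - exp (- (csm a * A)) * (- A)) \<le> D * \<epsilon>" using De(3) by linarith
qed


lemma D_nonneg: "D \<ge> 0"
  using C_nonneg isum_wt_nonneg P.\<alpha>0 by (simp add: D_def optr_bound_def)

lemma m_nonneg: "m \<ge> 0" using P.\<alpha>0 by (simp add: m_def)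

lemma D2_nonneg: "D2 \<ge> 0" using D_nonneg m_nonneg by (simp add: D2_def)

text \<open>The unperturbed products are \<open>1\<close> for \<open>B Bs\<close>, \<open>A\<close>
  for \<open>Bd Bs\<close> and \<open>- A\<close> for \<open>B Bsd\<close>. The last two cancel in
  \<open>Yd\<close>, which is therefore small as well.\<close>

lemma near_products:
  assumes w: "(a, z) \<in> S" and a: "cmod a \<le> 1 + h"
  shows "norm (Y (a, z)) \<le> D2 * \<epsilon>" "norm (Z (a, z) - A) \<le> D2 * \<epsilon>" "norm (Yd (a, z)) \<le> 2 * D2 * \<epsilon>"
proof -
  let ?E = "exp (csm a * A)" and ?E' = "exp (- (csm a * A))"
  have d: "D * \<epsilon> \<le> D" "D * \<epsilon> \<ge> 0" using P.\<epsilon> D_nonneg by (auto simp: mult_left_le)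
  have D2: "D * \<epsilon> * (2 * m + D) = D2 * \<epsilon>" by (simp add: D2_def)
  have e: "exp (\<alpha> * cmod a) \<le> exp (\<alpha> * (1 + h))" using a P.\<alpha>0 by (simp add: mult_left_mono)
  have E: "norm ?E \<le> exp (\<alpha> * (1 + h))" using P.norm_exp_csm_A[of a] e by linarith
  have E': "norm ?E' \<le> exp (\<alpha> * (1 + h))" 
  proof -
    have "norm ?E' \<le> exp (\<alpha> * cmod a)" using P.norm_exp_csm_A[of "- a"] by (simp add: csm_minus)
    then show ?thesis using e by linarith
  qed
  have em: "exp (\<alpha> * (1 + h)) \<le> m" using P.\<alpha>0 by (simp add: m_def)
  have Am: "\<alpha> * exp (\<alpha> * (1 + h)) \<le> m" by (simp add: m_def)
  have AE: "norm (A * ?E) \<le> m"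
    using norm_mult_ineq[of A ?E] mult_mono[OF P.\<alpha> E P.\<alpha>0] Am by fastforce
  have AE': "norm (?E' * (- A)) \<le> m"
    using norm_mult_ineq[of ?E' "- A"] mult_mono[OF E', of "norm A" \<alpha>] P.\<alpha> Am by (simp add: mult.commute)
  have c: "?E * ?E' = 1" by (rule exp_minus_inverse)
  have Y: "norm (B (a, z) * Bs (a, z) - ?E * ?E') \<le> D * \<epsilon> * (2 * m + D)"
    by (rule norm_mult_minus_le[OF blends_near(1,3)[OF w a]]) (use E E' em d in auto)
  then show "norm (Y (a, z)) \<le> D2 * \<epsilon>" unfolding c D2 by (simp add: Y_def)
  have Z: "norm (Bd (a, z) * Bs (a, z) - A * ?E * ?E') \<le> D * \<epsilon> * (2 * m + D)"
    by (rule norm_mult_minus_le[OF blends_near(2,3)[OF w a]]) (use AE E' em d in auto)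
  moreover have "A * ?E * ?E' = A" by (simp only: mult.assoc c mult_1_right)
  ultimately show Z': "norm (Z (a, z) - A) \<le> D2 * \<epsilon>" by (simp only: Z_def D2)
  have "norm (B (a, z) * Bsd (a, z) - ?E * (?E' * (- A))) \<le> D * \<epsilon> * (2 * m + D)"
    by (rule norm_mult_minus_le[OF blends_near(1,4)[OF w a]]) (use AE' E em d in auto)
  then have "norm (B (a, z) * Bsd (a, z) - (- A)) \<le> D2 * \<epsilon>"
    unfolding D2 by (simp only: c mult.assoc[symmetric] mult_1_left)
  from norm_triangle_mono[OF Z' this] show "norm (Yd (a, z)) \<le> 2 * D2 * \<epsilon>"
    by (simp add: Yd_def Z_def mult.commute[of \<epsilon>])
qed

text \<open>The estimates hold for bounded \<open>a\<close> only. Removing the integer part of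
  \<open>Re a\<close> and using \<open>|Im a| < h\<close> gives the bound
  \<open>1 + h\<close>.\<close>

lemma reduce_to_period:
  assumes w: "w \<in> S"
  obtains a z where "(a, z) \<in> S" "cmod a \<le> 1 + h" "Y w = Y (a, z)" "Yd w = Yd (a, z)" "Z w = Z (a, z)"
proof -
  obtain b z where bz: "w = (b, z)" by (cases w)
  define n where "n = \<lfloor>Re b\<rfloor>"
  define a where "a = b - of_int n"
  have b: "b = a + of_int n" by (simp add: a_def)
  have a: "(a, z) \<in> S" using w unfolding bz b by simp
  have "\<bar>Re a\<bar> \<le> 1" unfolding a_def n_def by (simp add: floor_le_iff; linarith)
  moreover have "\<bar>Im a\<bar> < h" by (rule strip2_fst[OF a P.h])
  ultimately have "cmod a \<le> 1 + h" using cmod_le[of a] by linarith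
  moreover have "Y w = Y (a, z)" "Yd w = Yd (a, z)" "Z w = Z (a, z)"
    unfolding bz b by (rule periodic_of_int[OF _ a]; simp add: blends_periodic)+
  ultimately show thesis using that a by blast
qed

end

section \<open>The normalised solution and its generator\<close>

locale small_embedding = embedding +
  assumes small: "D2 * \<epsilon> \<le> 1 / 2"
begin

lemma norm_products_le:
  assumes "w \<in> S"
  shows "norm (Y w) \<le> D2 * \<epsilon>" "norm (Y w) \<le> 1 / 2" "norm (Z w - A) \<le> D2 * \<epsilon>" "norm (Yd w) \<le> 2 * D2 * \<epsilon>"
proof -
  obtain a z where a: "(a, z) \<in> S" "cmod a \<le> 1 + h" "Y w = Y (a, z)" "Yd w = Yd (a, z)" "Z w = Z (a, z)"
    by (rule reduce_to_period[OF assms])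
  show "norm (Y w) \<le> D2 * \<epsilon>" "norm (Z w - A) \<le> D2 * \<epsilon>" "norm (Yd w) \<le> 2 * D2 * \<epsilon>"
    using near_products[OF a(1,2)] by (simp_all add: a)
  then show "norm (Y w) \<le> 1 / 2" using small by linarith
qed

lemma fhol_R: "fhol \<mu> R Rd S"
  using fhol_rsqrt[OF open_strip2 fhol_Y norm_products_le(2)] by (simp add: R_def[abs_def] Rd_def[abs_def])

lemma fhol_Rd: "\<exists>p. fhol \<mu> Rd p S"
  using fhol_Yd fhol_drsqrt[OF open_strip2 fhol_Y norm_products_le(2) _ norm_products_le(4)] by (auto simp: Rd_def[abs_def])

lemma fhol_\<Phi>: "fhol \<mu> \<Phi> \<Phi>d S"
  using fhol_mult[OF fhol_R fhol_B] by (simp add: \<Phi>_def[abs_def] \<Phi>d_def[abs_def])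

lemma fhol_\<Psi>: "fhol \<mu> \<Psi> (\<lambda>w. Bsd w * R w + Bs w * Rd w) S"
  using fhol_mult[OF fhol_Bs fhol_R] by (simp add: \<Psi>_def[abs_def])

lemma fhol_F: "\<exists>p. fhol \<mu> F p S"
proof -
  obtain p q where p: "fhol \<mu> Rd p S" and q: "fhol \<mu> Z q S" using fhol_Rd fhol_Z by blast
  show ?thesis
    using fhol_add[OF fhol_add[OF fhol_mult[OF p fhol_mult[OF fhol_add[OF fhol_const[of \<mu> 1] fhol_Y] fhol_R]]
        fhol_mult[OF fhol_R fhol_mult[OF q fhol_R]]] fhol_const[of \<mu> "- A"]]
    by (auto simp: F_def[abs_def])
qed

text \<open>With \<open>d = D2 \<epsilon>\<close>, the derivative of \<open>R\<close> contributes
  \<open>24 d\<close>, replacing \<open>R Z R\<close> by \<open>Z\<close> costs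
  \<open>6 (\<alpha> + 1) d\<close>, and \<open>Z - A\<close> is at most \<open>d\<close>; this adds
  up to \<open>(31 + 6 \<alpha>) d\<close>.\<close>

lemma norm_F_le:
  assumes w: "w \<in> S"
  shows "norm (F w) \<le> D2 * (31 + 6 * \<alpha>) * \<epsilon>"
proof -
  define d where "d = D2 * \<epsilon>"
  have d0: "d \<ge> 0" using D2_nonneg P.\<epsilon> by (simp add: d_def)
  note p = norm_products_le[OF w, folded d_def]
  have d2: "d \<le> 1 / 2" using small by (simp add: d_def)
  have R1: "norm (R w - 1) \<le> 2 * d" using norm_rsqrt_minus_1[OF p(2)] p(1) by (simp add: R_def)
  have R2: "norm (R w) \<le> 2" using norm_triangle_sub[of "R w" 1] R1 d2 by simp
  have "norm (Rd w) \<le> 4 * norm (Yd w)" unfolding Rd_def by (rule norm_drsqrt_le[OF p(2)])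
  then have Rd: "norm (Rd w) \<le> 8 * d" using p(4) by (simp add: d_def)
  have Y1: "norm (1 + Y w) \<le> 3 / 2" using norm_triangle_ineq[of 1 "Y w"] p(2) by simp
  have Z: "norm (Z w) \<le> \<alpha> + 1" using norm_triangle_sub[of "Z w" A] p(3) P.\<alpha> d2 by linarith
  have t1: "norm (Rd w * ((1 + Y w) * R w)) \<le> 8 * d * (3 / 2 * 2)"
    by (rule order_trans[OF norm_mult_ineq], intro mult_mono Rd order_trans[OF norm_mult_ineq] Y1 R2)
      (use d0 in auto)
  have "R w * (Z w * R w) - Z w = (R w - 1) * (Z w * R w) + Z w * (R w - 1)"
    by (simp add: algebra_simps)
  also have "norm \<dots> \<le> 2 * d * ((\<alpha> + 1) * 2) + (\<alpha> + 1) * (2 * d)"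
    by (intro norm_triangle_mono order_trans[OF norm_mult_ineq] mult_mono R1 R2 Z)
      (use d0 P.\<alpha>0 in auto)
  finally have t2: "norm (R w * (Z w * R w) - Z w) \<le> 6 * (\<alpha> + 1) * d" by (simp add: algebra_simps)
  have "F w = Rd w * ((1 + Y w) * R w) + (R w * (Z w * R w) - Z w) + (Z w - A)"
    by (simp add: F_def)
  then have "norm (F w) \<le> 8 * d * (3 / 2 * 2) + 6 * (\<alpha> + 1) * d + d"
    using norm_triangle_mono[OF norm_triangle_mono[OF t1 t2] p(3)] by simp
  then show ?thesis by (simp add: d_def algebra_simps)
qed

lemma \<Phi>_\<Psi>: "w \<in> S \<Longrightarrow> \<Phi> w * \<Psi> w = 1"
  using rsqrt_conj[OF norm_products_le(2)] by (simp add: \<Phi>_def \<Psi>_def R_def Y_def mult.assoc)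

lemma \<Psi>_\<Phi>: "w \<in> S \<Longrightarrow> \<Psi> w * \<Phi> w = 1"
  by (rule opmat_inverse_commute[OF \<Phi>_\<Psi>])

lemma A_plus_F: "A + F w = \<Phi>d w * \<Psi> w"
  by (simp add: F_def \<Phi>d_def \<Psi>_def Y_def Z_def algebra_simps)

lemma flow_equation: "w \<in> S \<Longrightarrow> \<Phi>d w = (A + F w) * \<Phi> w"
  by (simp add: A_plus_F mult.assoc \<Psi>_\<Phi>)

text \<open>At time 0 both blends reduce to the identity, so \<open>Y\<close> vanishes there and, by
  periodicity, at all integer times. \<open>R\<close> is then 1, and the normalisation leaves the
  iterates untouched.\<close>

lemma \<Phi>_of_int:
  assumes "(of_int n, z) \<in> S"
  shows "\<Phi> (of_int n, z) = P.Mc n (untwist \<mu> (of_int n, z))"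
proof -
  have "Y (of_int n, z) = Y (0, z)"
    using periodic_of_int[of z "h / (1 + l1norm \<mu>)" Y 0 n] assms blends_periodic(1) strip2_shift(1)[of 0 n z] by simp
  also have "\<dots> = 0"
    using P.blend_of_int[OF \<rho>_int, of 0 z] Q.blend_of_int[OF \<rho>_int, of 0 z] by (simp add: Y_def B_def Bs_def)
  finally show ?thesis by (simp add: \<Phi>_def R_def B_def P.blend_of_int[OF \<rho>_int])
qed

lemma real_points: "(of_real t, cvec x) \<in> S"
proof -
  have "l1norm \<mu> \<ge> 0" by (rule l1norm_nonneg)
  then show ?thesis using P.h by (simp add: strip2_def cvec_def)
qed

section \<open>Symmetries of the generator at real points\<close>

definition Mi where "Mi l z = optr (Q.Mc l z)"

lemma Mi_0: "Mi 0 z = 1" by (simp add: Mi_def)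

lemma Mi_step: "Mi (l + 1) z = Mi l z * P.Minv (z + cvec (of_int l *\<^sub>R \<mu>))"
  by (simp add: Mi_def Q.Mc_step optr_mult optr_QM)

lemma Mc_step_back: "P.Mc l z = P.Minv (z + cvec (of_int l *\<^sub>R \<mu>)) * P.Mc (l + 1) z"
  by (simp add: P.Mc_step P.M_Minv flip: mult.assoc)

lemma Mi_step_back: "Mi l z = Mi (l + 1) z * P.M (z + cvec (of_int l *\<^sub>R \<mu>))"
  by (simp add: Mi_step P.M_Minv mult.assoc)

text \<open>At real times the weights are real, so a map that is merely real linear, such as
  conjugation, can be applied term by term.\<close>

lemma linear_T:
  assumes L: "bounded_linear L"
  shows "L (P.T \<rho> l (of_real t, cvec x)) = Re (\<rho> (of_real (t - of_int l))) *\<^sub>R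
      L (exp ((t - of_int l) *\<^sub>R A) * P.Mc l (untwist \<mu> (of_real t, cvec x)))"
    "L (optr (Q.T \<rho> l (of_real t, cvec x))) = Re (\<rho> (of_real (t - of_int l))) *\<^sub>R
      L (Mi l (untwist \<mu> (of_real t, cvec x)) * exp (- ((t - of_int l) *\<^sub>R A)))"
proof -
  have c: "csm (of_real r) * x = r *\<^sub>R x" for r and x :: "'a opmat"
    unfolding csm_of_real by (simp add: of_real_def)
  define r where "r = t - of_int l"
  have e: "complex_of_real t - of_int l = of_real r" by (simp add: r_def)
  obtain s where s: "\<rho> (of_real r) = of_real s" using \<rho>_real[of r] by (auto elim: Reals_cases)
  note lin = linear_cmul[OF bounded_linear.linear]
  show "L (P.T \<rho> l (of_real t, cvec x)) = Re (\<rho> (of_real (t - of_int l))) *\<^sub>R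
      L (exp ((t - of_int l) *\<^sub>R A) * P.Mc l (untwist \<mu> (of_real t, cvec x)))"
    unfolding P.T_def fst_conv e s r_def[symmetric] c by (simp add: lin[OF L])
  show "L (optr (Q.T \<rho> l (of_real t, cvec x))) = Re (\<rho> (of_real (t - of_int l))) *\<^sub>R
      L (Mi l (untwist \<mu> (of_real t, cvec x)) * exp (- ((t - of_int l) *\<^sub>R A)))"
    unfolding Q.T_def fst_conv e s r_def[symmetric] c lin[OF bounded_linear_optr] lin[OF L] Mi_def
    by (simp add: optr_mult optr_exp lin[OF bounded_linear_optr] linear_neg[OF bounded_linear.linear[OF bounded_linear_optr]])
qed

lemma untwist_real: "untwist \<mu> (of_real t, cvec x) = cvec (x - t *\<^sub>R \<mu>)"
  by (simp add: untwist_def cscaleV_def cvec_def vec_eq_iff)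

lemma linear_blend:
  assumes L: "bounded_linear L"
  shows "L (B (of_real t, cvec x)) = isum (\<lambda>l. L (P.T \<rho> l (of_real t, cvec x)))"
    "L (Bs (of_real t, cvec x)) = isum (\<lambda>l. L (optr (Q.T \<rho> l (of_real t, cvec x))))"
proof -
  show "L (B (of_real t, cvec x)) = isum (\<lambda>l. L (P.T \<rho> l (of_real t, cvec x)))"
    unfolding B_def P.blend_def by (rule isum_linear[OF L P.zsummable_T[OF C(1) real_points], symmetric])
  show "L (Bs (of_real t, cvec x)) = isum (\<lambda>l. L (optr (Q.T \<rho> l (of_real t, cvec x))))"
    unfolding Bs_def Q.blend_def
    by (rule isum_linear[OF bounded_linear_compose[OF L bounded_linear_optr] Q.zsummable_T[OF CQ(1) real_points], symmetric])
qed

lemma linear_B: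
  assumes L: "bounded_linear L"
  shows "L (B (of_real t, cvec x)) = isum (\<lambda>l. Re (\<rho> (of_real (t - of_int l))) *\<^sub>R
      L (exp ((t - of_int l) *\<^sub>R A) * P.Mc l (cvec (x - t *\<^sub>R \<mu>))))"
    "L (Bs (of_real t, cvec x)) = isum (\<lambda>l. Re (\<rho> (of_real (t - of_int l))) *\<^sub>R
      L (Mi l (cvec (x - t *\<^sub>R \<mu>)) * exp (- ((t - of_int l) *\<^sub>R A))))"
  unfolding linear_blend[OF L] linear_T[OF L] untwist_real by (rule refl)+

lemma vector_derivative_\<Phi>:
  "((\<lambda>t. \<Phi> (of_real t, cvec (x + t *\<^sub>R \<mu>))) has_vector_derivative \<Phi>d (of_real t, cvec (x + t *\<^sub>R \<mu>))) (at t)"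
proof (rule fhol_has_vector_derivative[OF fhol_\<Phi>])
  have "l1norm \<mu> \<ge> 0" by (rule l1norm_nonneg)
  then show "h / (1 + l1norm \<mu>) > 0" using P.h by simp
qed

lemma vector_derivative_\<Psi>:
  "((\<lambda>t. \<Psi> (of_real t, cvec (x + t *\<^sub>R \<mu>))) has_vector_derivative
    Bsd (of_real t, cvec (x + t *\<^sub>R \<mu>)) * R (of_real t, cvec (x + t *\<^sub>R \<mu>)) +
    Bs (of_real t, cvec (x + t *\<^sub>R \<mu>)) * Rd (of_real t, cvec (x + t *\<^sub>R \<mu>))) (at t)"
proof (rule fhol_has_vector_derivative[OF fhol_\<Psi>])
  have "l1norm \<mu> \<ge> 0" by (rule l1norm_nonneg)
  then show "h / (1 + l1norm \<mu>) > 0" using P.h by simp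
qed

lemma F_fixed_by_automorphism:
  assumes L: "bounded_linear L" "\<And>x y. L (x * y) = L x * L y" "L 1 = 1"
    and LA: "L A = A" and LG: "\<And>x. L (G (cvec x)) = G (cvec x)"
  shows "L (F (of_real t, cvec x)) = F (of_real t, cvec x)"
    and "L (\<Phi> (of_real t, cvec x)) = \<Phi> (of_real t, cvec x)"
proof -
  note lin = linear_cmul[OF bounded_linear.linear[OF L(1)]] linear_neg[OF bounded_linear.linear[OF L(1)]]
    linear_add[OF bounded_linear.linear[OF L(1)]]
  have Le: "L (exp y) = exp (L y)" for y by (rule linear_exp[OF L(1) hom_power[OF L(2,3)]])
  have LM: "L (P.M (cvec u)) = P.M (cvec u)" "L (P.Minv (cvec u)) = P.Minv (cvec u)" for u
    by (simp_all add: P.M_def P.Minv_def L(2) Le lin LA LG)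
  have shift: "cvec u + cvec v = cvec (u + v)" for u v :: "real^'b" by (simp add: cvec_simps)
  have LMc: "L (P.Mc l (cvec u)) = P.Mc l (cvec u)" for l u
  proof (induction l rule: int_induct[of _ 0])
    case (step1 i)
    then show ?case by (simp add: P.Mc_step shift L(2) LM)
  next
    case (step2 i)
    then show ?case using Mc_step_back[of "i - 1" "cvec u"] by (simp add: shift L(2) LM)
  qed (simp add: L(3))
  have LMi: "L (Mi l (cvec u)) = Mi l (cvec u)" for l u
  proof (induction l rule: int_induct[of _ 0])
    case (step1 i)
    then show ?case by (simp add: Mi_step shift L(2) LM)
  next
    case (step2 i)
    then show ?case using Mi_step_back[of "i - 1" "cvec u"] by (simp add: shift L(2) LM)
  qed (simp add: L(3) Mi_0)
  note id = bounded_linear_ident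
  have LB: "L (B (of_real t, cvec x)) = B (of_real t, cvec x)" for t x
    using linear_B(1)[OF L(1), of t x] linear_B(1)[OF id, of t x]
    by (simp add: L(2) Le lin LA LMc)
  have LBs: "L (Bs (of_real t, cvec x)) = Bs (of_real t, cvec x)" for t x
    using linear_B(2)[OF L(1), of t x] linear_B(2)[OF id, of t x]
    by (simp add: L(2) Le lin LA LMi)
  have LY: "L (Y (of_real t, cvec x)) = Y (of_real t, cvec x)" for t x
    unfolding Y_def by (simp add: L lin LB LBs linear_diff[OF bounded_linear.linear[OF L(1)]])
  have LR: "L (R (of_real t, cvec x)) = R (of_real t, cvec x)" for t x
    unfolding R_def by (simp add: linear_rsqrt[OF L(1) hom_power[OF L(2,3)] norm_products_le(2)[OF real_points]] LY)
  show L\<Phi>: "L (\<Phi> (of_real t, cvec x)) = \<Phi> (of_real t, cvec x)" for t x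
    by (simp add: \<Phi>_def L(2) LR LB)
  have L\<Psi>: "L (\<Psi> (of_real t, cvec x)) = \<Psi> (of_real t, cvec x)" for t x
    by (simp add: \<Psi>_def L(2) LR LBs)
  \<comment> \<open>The real flow line that passes through \<open>x\<close> at time \<open>t\<close>
    starts at \<open>x - t \<mu>\<close>.\<close>
  have L\<Phi>d: "L (\<Phi>d (of_real t, cvec x)) = \<Phi>d (of_real t, cvec x)"
    using bounded_linear.has_vector_derivative[OF L(1) vector_derivative_\<Phi>[of "x - t *\<^sub>R \<mu>" t]]
      vector_derivative_\<Phi>[of "x - t *\<^sub>R \<mu>" t] vector_derivative_unique_at by (fastforce simp: L\<Phi>)
  have "L (A + F (of_real t, cvec x)) = A + F (of_real t, cvec x)"
    by (simp add: A_plus_F L(2) L\<Phi>d L\<Psi>)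
  then show "L (F (of_real t, cvec x)) = F (of_real t, cvec x)" by (simp add: lin LA)
qed

text \<open>\<open>L\<close> exchanges \<open>M\<close> with its inverse, hence \<open>B\<close>
  with \<open>Bs\<close>, and it fixes their product because it also reverses the order. So
  \<open>L\<close> maps \<Phi> to its inverse \<Psi>, which says that \<Phi> lies in the group
  attached to \<open>L\<close>; differentiating \<open>\<Phi> \<Psi> = 1\<close> puts
  \<open>A + F\<close> into the Lie algebra.\<close>

lemma F_skew_under_antiautomorphism:
  assumes L: "bounded_linear L" "\<And>x y. L (x * y) = L y * L x" "L 1 = 1"
    and LA: "L A = - A" and LG: "\<And>x. L (G (cvec x)) = - G (cvec x)"
  shows "L (F (of_real t, cvec x)) = - F (of_real t, cvec x)"
proof -
  note lin = linear_cmul[OF bounded_linear.linear[OF L(1)]] linear_neg[OF bounded_linear.linear[OF L(1)]]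
    linear_add[OF bounded_linear.linear[OF L(1)]]
  have Le: "L (exp y) = exp (L y)" for y by (rule linear_exp[OF L(1) antihom_power[OF L(2,3)]])
  have LM: "L (P.M (cvec u)) = P.Minv (cvec u)" "L (P.Minv (cvec u)) = P.M (cvec u)" for u
    by (simp_all add: P.M_def P.Minv_def L(2) Le lin LA LG)
  have shift: "cvec u + cvec v = cvec (u + v)" for u v :: "real^'b" by (simp add: cvec_simps)
  have LMc: "L (P.Mc l (cvec u)) = Mi l (cvec u)" for l u
  proof (induction l rule: int_induct[of _ 0])
    case (step1 i)
    then show ?case by (simp add: P.Mc_step Mi_step shift L(2) LM)
  next
    case (step2 i)
    then show ?case using Mc_step_back[of "i - 1" "cvec u"] Mi_step_back[of "i - 1" "cvec u"]
      by (simp add: shift L(2) LM)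
  qed (simp add: L(3) Mi_0)
  have LMi: "L (Mi l (cvec u)) = P.Mc l (cvec u)" for l u
  proof (induction l rule: int_induct[of _ 0])
    case (step1 i)
    then show ?case by (simp add: Mi_step P.Mc_step shift L(2) LM)
  next
    case (step2 i)
    then show ?case using Mi_step_back[of "i - 1" "cvec u"] Mc_step_back[of "i - 1" "cvec u"]
      by (simp add: shift L(2) LM)
  qed (simp add: L(3) Mi_0)
  note id = bounded_linear_ident
  have LB: "L (B (of_real t, cvec x)) = Bs (of_real t, cvec x)" for t x
    using linear_B(1)[OF L(1), of t x] linear_B(2)[OF id, of t x]
    by (simp add: L(2) Le lin LA LMc)
  have LBs: "L (Bs (of_real t, cvec x)) = B (of_real t, cvec x)" for t x
    using linear_B(2)[OF L(1), of t x] linear_B(1)[OF id, of t x]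
    by (simp add: L(2) Le lin LA LMi)
  have LY: "L (Y (of_real t, cvec x)) = Y (of_real t, cvec x)" for t x
    unfolding Y_def by (simp add: L lin LB LBs linear_diff[OF bounded_linear.linear[OF L(1)]])
  have LR: "L (R (of_real t, cvec x)) = R (of_real t, cvec x)" for t x
    unfolding R_def by (simp add: linear_rsqrt[OF L(1) antihom_power[OF L(2,3)] norm_products_le(2)[OF real_points]] LY)
  have L\<Phi>: "L (\<Phi> (of_real t, cvec x)) = \<Psi> (of_real t, cvec x)" for t x
    by (simp add: \<Phi>_def \<Psi>_def L(2) LR LB)
  have L\<Psi>: "L (\<Psi> (of_real t, cvec x)) = \<Phi> (of_real t, cvec x)" for t x
    by (simp add: \<Phi>_def \<Psi>_def L(2) LR LBs)
  let ?p = "(of_real t, cvec x) :: complex \<times> (complex^'b)"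
  define \<Psi>d where "\<Psi>d = Bsd ?p * R ?p + Bs ?p * Rd ?p"
  have L\<Phi>d: "L (\<Phi>d ?p) = \<Psi>d"
    using bounded_linear.has_vector_derivative[OF L(1) vector_derivative_\<Phi>[of "x - t *\<^sub>R \<mu>" t]]
      vector_derivative_\<Psi>[of "x - t *\<^sub>R \<mu>" t] vector_derivative_unique_at by (fastforce simp: L\<Phi> \<Psi>d_def)
  have "fhol \<mu> (\<lambda>w. 1) (\<lambda>w. \<Phi>d w * \<Psi> w + \<Phi> w * (Bsd w * R w + Bs w * Rd w)) S"
    by (rule fhol_cong[OF fhol_mult[OF fhol_\<Phi> fhol_\<Psi>] open_strip2]) (simp_all add: \<Phi>_\<Psi>)
  from fhol_unique[OF this fhol_const real_points[of t x]]
  have z: "\<Phi>d ?p * \<Psi> ?p + \<Phi> ?p * \<Psi>d = 0" by (simp add: \<Psi>d_def)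
  have "L (A + F ?p) = \<Phi> ?p * \<Psi>d" by (simp add: A_plus_F L(2) L\<Phi>d L\<Psi>)
  also have "\<dots> = - (A + F ?p)" using z by (simp add: A_plus_F add_eq_0_iff)
  finally show ?thesis by (simp add: lin LA)
qed

end

section \<open>Existence of equivariant embeddings and the Lie algebras\<close>

text \<open>The matrix over \<open>x\<close> leads to the fibre over \<open>x + \<mu>\<close>, where
  the flow line from \<open>(0, x)\<close> is at time one; hence the shifted argument there.\<close>

definition poincare_embedding ::
  "'n::finite opmat \<Rightarrow> (complex^'d \<Rightarrow> 'n opmat) \<Rightarrow> real^'d \<Rightarrow> (complex \<times> (complex^'d) \<Rightarrow> 'n opmat) \<Rightarrow>
   (complex \<times> (complex^'d) \<Rightarrow> 'n opmat) \<Rightarrow> bool" where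
  "poincare_embedding A G \<mu> F \<Phi> \<longleftrightarrow>
     (\<forall>x. \<Phi> (0, cvec x) = 1 \<and> \<Phi> (1, cvec (x + \<mu>)) = exp A * exp (G (cvec x))) \<and>
     (\<forall>x t. ((\<lambda>t. \<Phi> (of_real t, cvec (x + t *\<^sub>R \<mu>))) has_vector_derivative
        (A + F (of_real t, cvec (x + t *\<^sub>R \<mu>))) * \<Phi> (of_real t, cvec (x + t *\<^sub>R \<mu>))) (at t))"

definition strip_periodic :: "real \<Rightarrow> (complex \<times> (complex^'d) \<Rightarrow> 'b) \<Rightarrow> bool" where
  "strip_periodic k F \<longleftrightarrow> (\<forall>a z. (a, z) \<in> strip2 k \<longrightarrow> F (a + 1, z) = F (a, z)) \<and>
     (\<forall>a z j. F (a, z + axis j 1) = F (a, z))"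

definition small_datum :: "real \<Rightarrow> real \<Rightarrow> (complex^'d \<Rightarrow> 'n::finite opmat) \<Rightarrow> bool" where
  "small_datum h \<epsilon> G \<longleftrightarrow> 0 \<le> \<epsilon> \<and> holo1 G (strip1 h) \<and> (\<forall>z\<in>strip1 h. norm (G z) \<le> \<epsilon>) \<and>
     (\<forall>z j. G (z + axis j 1) = G z)"

text \<open>All maps \<open>L\<close> compatible with the datum are treated at once, for one and the
  same \<open>F\<close>: an algebra such as the real skew matrices imposes an automorphism and an
  antiautomorphism simultaneously.\<close>

definition equivariant_embedding ::
  "'n::finite opmat \<Rightarrow> real \<Rightarrow> real \<Rightarrow> real^'d \<Rightarrow> (complex^'d \<Rightarrow> 'n opmat) \<Rightarrow> (complex \<times> (complex^'d) \<Rightarrow> 'n opmat) \<Rightarrow>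
   (complex \<times> (complex^'d) \<Rightarrow> 'n opmat) \<Rightarrow> (complex \<times> (complex^'d) \<Rightarrow> 'n opmat) \<Rightarrow> bool" where
  "equivariant_embedding A h b \<mu> G F \<Phi> \<Psi> \<longleftrightarrow>
     (\<exists>p. fhol \<mu> F p (strip2 (h / (1 + l1norm \<mu>)))) \<and>
     (\<forall>w\<in>strip2 (h / (1 + l1norm \<mu>)). norm (F w) \<le> b) \<and>
     strip_periodic (h / (1 + l1norm \<mu>)) F \<and> poincare_embedding A G \<mu> F \<Phi> \<and>
     (\<forall>t x. \<Phi> (of_real t, cvec x) * \<Psi> (of_real t, cvec x) = 1) \<and>
     (\<forall>L. bounded_linear L \<longrightarrow> (\<forall>x y. L (x * y) = L x * L y) \<longrightarrow> L 1 = 1 \<longrightarrow> L A = A \<longrightarrow>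
        (\<forall>x. L (G (cvec x)) = G (cvec x)) \<longrightarrow>
        (\<forall>t x. L (F (of_real t, cvec x)) = F (of_real t, cvec x) \<and>
           L (\<Phi> (of_real t, cvec x)) = \<Phi> (of_real t, cvec x))) \<and>
     (\<forall>L. bounded_linear L \<longrightarrow> (\<forall>x y. L (x * y) = L y * L x) \<longrightarrow> L 1 = 1 \<longrightarrow> L A = - A \<longrightarrow>
        (\<forall>x. L (G (cvec x)) = - G (cvec x)) \<longrightarrow>
        (\<forall>t x. L (F (of_real t, cvec x)) = - F (of_real t, cvec x)))"

lemma equivariant_embedding_exists:
  fixes A :: "'n::finite opmat"
  assumes h: "h > 0"
  shows "\<exists>e c. 0 < e \<and> 0 \<le> c \<and> (\<forall>(\<mu>::real^'d) G \<epsilon>. small_datum h \<epsilon> G \<longrightarrow> \<epsilon> < e \<longrightarrow>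
     (\<exists>F \<Phi> \<Psi>. equivariant_embedding A h (c * \<epsilon>) \<mu> G F \<Phi> \<Psi>))"
proof -
  define \<tau> where "\<tau> = optr_bound TYPE('n)"
  have \<tau>: "\<tau> \<ge> 1" by (simp add: \<tau>_def optr_bound_def)
  \<comment> \<open>A common bound for \<open>A\<close> and \<open>- optr A\<close>, as the two
    cocycles share their constants; \<delta> below does the same for \<open>G\<close>.\<close>
  define \<alpha> where "\<alpha> = \<tau> * norm A"
  have \<alpha>: "norm A \<le> \<alpha>" "norm (- optr A) \<le> \<alpha>" "\<alpha> \<ge> 0"
    using \<tau> norm_optr_le[of A] by (auto simp: \<alpha>_def \<tau>_def mult_le_cancel_right1)
  obtain \<rho> :: "complex \<Rightarrow> complex" where \<rho>: "\<rho> holomorphic_on UNIV" "strip_decay \<rho>"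
    "\<And>t. isum (\<lambda>l. \<rho> (t - of_int l)) = 1"
    "\<And>n::int. \<rho> (of_int n) = (if n = 0 then 1 else 0)" "\<And>x::real. \<rho> (of_real x) \<in> \<real>"
    by (rule cardinal_partition_of_unity) blast
  obtain C1 where C1: "C1 \<ge> 0" "\<And>t. \<bar>Im t\<bar> \<le> h \<Longrightarrow> cmod (\<rho> t) \<le> C1 * exp (- (2 * \<alpha> + 3) * cmod t)"
    by (rule strip_decayE[OF \<rho>(2)]) blast
  obtain C2 where C2: "C2 \<ge> 0" "\<And>t. \<bar>Im t\<bar> \<le> h \<Longrightarrow> cmod (deriv \<rho> t) \<le> C2 * exp (- (2 * \<alpha> + 3) * cmod t)"
    by (rule strip_decayE[OF strip_decay_deriv[OF \<rho>(2,1)]]) blast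
  define C where "C = C1 + C2"
  have C: "C \<ge> 0" "\<And>t. \<bar>Im t\<bar> < h \<Longrightarrow> cmod (\<rho> t) \<le> C * exp (- (2 * \<alpha> + 3) * cmod t)"
    "\<And>t. \<bar>Im t\<bar> < h \<Longrightarrow> cmod (deriv \<rho> t) \<le> C * exp (- (2 * \<alpha> + 3) * cmod t)"
  proof -
    show "C \<ge> 0" using C1 C2 by (simp add: C_def)
    fix t assume t: "\<bar>Im t\<bar> < h"
    have e: "C1 * exp (- (2 * \<alpha> + 3) * cmod t) \<le> C * exp (- (2 * \<alpha> + 3) * cmod t)"
      "C2 * exp (- (2 * \<alpha> + 3) * cmod t) \<le> C * exp (- (2 * \<alpha> + 3) * cmod t)"
      using C1 C2 by (auto simp: C_def intro!: mult_right_mono)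
    show "cmod (\<rho> t) \<le> C * exp (- (2 * \<alpha> + 3) * cmod t)" using C1(2)[of t] t e(1) by linarith
    show "cmod (deriv \<rho> t) \<le> C * exp (- (2 * \<alpha> + 3) * cmod t)" using C2(2)[of t] t e(2) by linarith
  qed
  define m where "m = (1 + \<alpha>) * exp (\<alpha> * (1 + h))"
  define D where "D = optr_bound TYPE('n) * ((1 + \<alpha>) * (2 * (C * exp ((2 * \<alpha> + 3) * (1 + h)) * isum wt)))"
  define D2 where "D2 = D * (2 * m + D)"
  have w0: "isum wt \<ge> 0"
    unfolding isum_def by (rule suminf_nonneg[OF zsummable_D[OF zsummable_wt]]) (simp add: wt_def)
  have D2: "D2 \<ge> 0" using C(1) w0 \<alpha> by (simp add: D2_def D_def m_def optr_bound_def)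
  \<comment> \<open>Yields \<open>\<delta> * (D2 + 1) \<le> 1 / 2\<close>, which contains both
    \<open>\<delta> \<le> 1\<close> and \<open>D2 * \<delta> \<le> 1 / 2\<close>, also when
    \<open>D2 = 0\<close>.\<close>
  define e where "e = 1 / (2 * \<tau> * (D2 + 1))"
  define c where "c = D2 * (31 + 6 * \<alpha>) * \<tau>"
  have e: "e > 0" using \<tau> D2 by (simp add: e_def)
  have c: "c \<ge> 0" using \<tau> D2 \<alpha> by (simp add: c_def)
  show ?thesis
  proof (rule exI[of _ e], rule exI[of _ c], intro conjI e c allI impI)
    fix \<mu> :: "real^'d" and G :: "complex^'d \<Rightarrow> 'n opmat" and \<epsilon> :: real
    assume G: "small_datum h \<epsilon> G" and \<epsilon>e: "\<epsilon> < e"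
    have \<epsilon>: "0 \<le> \<epsilon>" "\<epsilon> < e" and hG: "holo1 G (strip1 h)" and nG: "\<forall>z\<in>strip1 h. norm (G z) \<le> \<epsilon>"
      and per: "\<forall>z j. G (z + axis j 1) = G z"
      using G \<epsilon>e by (auto simp: small_datum_def)
    define \<delta> where "\<delta> = \<tau> * \<epsilon>"
    have \<delta>0: "0 \<le> \<delta>" using \<epsilon> \<tau> by (simp add: \<delta>_def)
    have "\<tau> * \<epsilon> \<le> \<tau> * e" using \<epsilon> \<tau> by simp
    also have "\<dots> = 1 / (2 * (D2 + 1))" using \<tau> by (simp add: e_def)
    finally have \<delta>e: "\<delta> * (D2 + 1) \<le> 1 / 2" using D2 by (simp add: \<delta>_def field_simps)
    have \<delta>1: "\<delta> \<le> 1" "D2 * \<delta> \<le> 1 / 2"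
      using \<delta>e mult_nonneg_nonneg[OF \<delta>0 D2] \<delta>0 by (simp_all add: algebra_simps)
    have P: "small_cocycle A G h \<alpha> \<delta>"
    proof
      show "norm (G z) \<le> \<delta>" if "z \<in> strip1 h" for z
      proof -
        have "norm (G z) \<le> \<epsilon>" using nG that by blast
        also have "\<epsilon> \<le> \<delta>" using \<tau> \<epsilon> by (simp add: \<delta>_def mult_le_cancel_right1)
        finally show ?thesis .
      qed
    qed (use h \<alpha> \<delta>0 \<delta>1 hG in auto)
    have Q: "small_cocycle (- optr A) (\<lambda>z. - optr (G z)) h \<alpha> \<delta>"
    proof
      show "norm (- optr (G z)) \<le> \<delta>" if "z \<in> strip1 h" for z
      proof -
        have "norm (G z) \<le> \<epsilon>" using nG that by blast
        then have "\<tau> * norm (G z) \<le> \<delta>" using \<tau> unfolding \<delta>_def by (intro mult_left_mono) auto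
        then show ?thesis using norm_optr_le[of "G z"] by (simp add: \<tau>_def)
      qed
      show "holo1 (\<lambda>z. - optr (G z)) (strip1 h)"
        unfolding holo1_def
      proof
        fix z :: "complex^'d" assume "z \<in> strip1 h"
        then obtain E where E: "(G has_derivative E) (at z)" "\<forall>c v. E (cscaleV c v) = csm c * E v"
          using hG unfolding holo1_def by blast
        have "((\<lambda>z. - optr (G z)) has_derivative (\<lambda>v. - optr (E v))) (at z)"
          by (intro has_derivative_minus bounded_linear.has_derivative[OF bounded_linear_optr] E)
        then show "\<exists>D. ((\<lambda>z. - optr (G z)) has_derivative D) (at z) \<and> (\<forall>c v. D (cscaleV c v) = csm c * D v)"
          using E(2) by (intro exI[of _ "\<lambda>v. - optr (E v)"]) (simp add: optr_csm_mult)
      qed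
    qed (use h \<alpha> \<delta>0 \<delta>1 in auto)
    interpret E: embedding A G \<mu> h \<alpha> \<delta> \<rho> C
    proof (intro embedding.intro P Q embedding_axioms.intro \<rho>)
      show "small_cocycle.rapid h \<alpha> C \<rho>" "small_cocycle.rapid h \<alpha> C (deriv \<rho>)"
        using C by (simp_all add: small_cocycle.rapid_def[OF P])
    qed (use per in auto)
    have ED2: "E.D2 = D2" by (simp add: E.D2_def E.D_def E.m_def D2_def D_def m_def)
    interpret E: small_embedding A G \<mu> h \<alpha> \<delta> \<rho> C
      by unfold_locales (use \<delta>1 ED2 in simp)
    have um: "untwist \<mu> (1, cvec (x + \<mu>)) = cvec x" "untwist \<mu> (0, cvec x) = cvec x" for x
      using E.untwist_real[of 1 "x + \<mu>"] E.untwist_real[of 0 x] by simp_all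
    have emb: "poincare_embedding A G \<mu> E.F E.\<Phi>"
      unfolding poincare_embedding_def
    proof (intro conjI allI)
      show "E.\<Phi> (0, cvec x) = 1" for x
        using E.\<Phi>_of_int[of 0 "cvec x"] E.real_points[of 0 x] by simp
      show "E.\<Phi> (1, cvec (x + \<mu>)) = exp A * exp (G (cvec x))" for x
        using E.\<Phi>_of_int[of 1 "cvec (x + \<mu>)"] E.real_points[of 1 "x + \<mu>"]
        by (simp add: um E.P.Mc_1 E.P.M_def)
      show "((\<lambda>t. E.\<Phi> (of_real t, cvec (x + t *\<^sub>R \<mu>))) has_vector_derivative
        (A + E.F (of_real t, cvec (x + t *\<^sub>R \<mu>))) * E.\<Phi> (of_real t, cvec (x + t *\<^sub>R \<mu>))) (at t)" for x t
        using E.vector_derivative_\<Phi>[of x t] E.flow_equation[OF E.real_points] by simp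
    qed
    have bound: "norm (E.F w) \<le> c * \<epsilon>" if "w \<in> strip2 (h / (1 + l1norm \<mu>))" for w
      using E.norm_F_le[OF that] by (simp add: ED2 c_def \<delta>_def mult.assoc)
    have sp: "strip_periodic (h / (1 + l1norm \<mu>)) E.F"
      unfolding strip_periodic_def using E.F_step E.F_axis by blast
    have inv: "\<forall>t x. E.\<Phi> (of_real t, cvec x) * E.\<Psi> (of_real t, cvec x) = 1"
      using E.\<Phi>_\<Psi>[OF E.real_points] by blast
    show "\<exists>F \<Phi> \<Psi>. equivariant_embedding A h (c * \<epsilon>) \<mu> G F \<Phi> \<Psi>"
    proof (rule exI[of _ E.F], rule exI[of _ E.\<Phi>], rule exI[of _ E.\<Psi>], unfold equivariant_embedding_def, intro conjI)
      show "\<forall>L. bounded_linear L \<longrightarrow> (\<forall>x y. L (x * y) = L x * L y) \<longrightarrow> L 1 = 1 \<longrightarrow> L A = A \<longrightarrow>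
           (\<forall>x. L (G (cvec x)) = G (cvec x)) \<longrightarrow>
           (\<forall>t x. L (E.F (of_real t, cvec x)) = E.F (of_real t, cvec x) \<and>
              L (E.\<Phi> (of_real t, cvec x)) = E.\<Phi> (of_real t, cvec x))"
        using E.F_fixed_by_automorphism by blast
      show "\<forall>L. bounded_linear L \<longrightarrow> (\<forall>x y. L (x * y) = L y * L x) \<longrightarrow> L 1 = 1 \<longrightarrow> L A = - A \<longrightarrow>
           (\<forall>x. L (G (cvec x)) = - G (cvec x)) \<longrightarrow>
           (\<forall>t x. L (E.F (of_real t, cvec x)) = - E.F (of_real t, cvec x))"
        using E.F_skew_under_antiautomorphism by blast
    qed (use E.fhol_F emb bound sp inv in auto)
  qed
qed

section \<open>Conjugation, transposition and the symplectic adjoint\<close>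

lift_definition ocnj :: "'n::finite opmat \<Rightarrow> 'n opmat" is "\<lambda>M. \<chi> i j. cnj (M $ i $ j)" .

lemma ocnj_mult: "ocnj (x * y) = ocnj x * ocnj y"
  by transfer (simp add: matrix_matrix_mult_def vec_eq_iff)

lemma ocnj_1 [simp]: "ocnj 1 = 1"
  by transfer (simp add: mat_def vec_eq_iff)

lemma bounded_linear_ocnj: "bounded_linear (ocnj :: 'n::finite opmat \<Rightarrow> _)"
proof (rule bounded_linear_intro)
  show "ocnj (x + y) = ocnj x + ocnj y" for x y :: "'n opmat" by transfer (simp add: vec_eq_iff)
  show "ocnj (r *\<^sub>R x) = r *\<^sub>R ocnj x" for r and x :: "'n opmat" by transfer (simp add: vec_eq_iff)
  fix x :: "'n opmat"
  have "norm (ocnj x) \<le> (\<Sum>i\<in>(UNIV::'n set). \<Sum>j\<in>(UNIV::'n set). norm (mat_of (ocnj x) $ i $ j))"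
    by (rule norm_opmat_le_sum)
  also have "\<dots> \<le> (\<Sum>i\<in>(UNIV::'n set). \<Sum>j\<in>(UNIV::'n set). norm x)"
    using norm_entry_le[of x] by (intro sum_mono) (simp add: ocnj.rep_eq)
  finally show "norm (ocnj x) \<le> norm x * (real CARD('n) * real CARD('n))" by (simp add: mult_ac)
qed

lemma real_mat_iff: "real_mat (mat_of x) \<longleftrightarrow> ocnj x = x"
  unfolding real_mat_def by transfer (simp add: vec_eq_iff complex_eq_iff) 

lemma skew_iff: "transpose (mat_of x) = - mat_of x \<longleftrightarrow> optr x = - x"
  by transfer simp

lemma skew_hermitian_iff: "ctranspose (mat_of x) = - mat_of x \<longleftrightarrow> ocnj (optr x) = - x"
  by transfer (simp add: ctranspose_def transpose_def)

definition oJ :: "'n::enum opmat" where "oJ = opmat_of symp_J"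

lemma idx_bij: "bij_betw (idx :: 'n::enum \<Rightarrow> nat) UNIV {..<CARD('n)}"
proof -
  let ?e = "enum_class.enum :: 'n list"
  have len: "length ?e = CARD('n)" by (simp add: card_UNIV_length_enum)
  have nth: "bij_betw (\<lambda>k. ?e ! k) {..<CARD('n)} UNIV"
    using bij_betw_nth[of ?e, OF enum_distinct refl refl] by (simp only: len enum_UNIV)
  have idx: "idx (?e ! k) = k" if "k < CARD('n)" for k
    unfolding idx_def using that by (intro the_equality) (auto simp: len nth_eq_iff_index_eq[OF enum_distinct])
  have inv: "?e ! idx a = a \<and> idx a < CARD('n)" for a :: 'n
  proof -
    have "a \<in> (\<lambda>k. ?e ! k) ` {..<CARD('n)}" using bij_betw_imp_surj_on[OF nth] by simp
    then obtain k where "a = ?e ! k" "k < CARD('n)" by auto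
    then show ?thesis using idx by simp
  qed
  show ?thesis
    by (rule bij_betw_byWitness[where f'="\<lambda>k. ?e ! k"]) (use inv idx in auto)
qed

text \<open>Row \<open>i\<close> of \<open>J\<close> has a single nonzero entry, in the column
  \<open>p\<close> whose index is shifted by half the size. Shifting twice returns to
  \<open>i\<close>, and of the two entries met on the way one is 1 and the other -1.\<close>

lemma oJ_square:
  assumes "even CARD('n)"
  shows "(oJ :: 'n::enum opmat) * oJ = - 1"
proof -
  define m where "m = CARD('n) div 2"
  have n: "CARD('n) = 2 * m" using assms by (simp add: m_def)
  have m0: "m > 0" using n by (metis gr0I mult_0_right zero_less_card_finite less_irrefl)
  have bij: "bij_betw (idx :: 'n \<Rightarrow> nat) UNIV {..<2 * m}" using idx_bij[where 'n='n] by (simp only: n)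
  have lt: "idx i < 2 * m" for i :: 'n using bij by (auto simp: bij_betw_def)
  have inj: "idx i = idx j \<longleftrightarrow> i = j" for i j :: 'n using bij by (auto simp: bij_betw_def inj_on_def)
  have "(symp_J ** symp_J) $ i $ k = (- mat 1 :: 'n cmat) $ i $ k" for i k :: 'n
  proof -
    define s where "s = (if idx i < m then idx i + m else idx i - m)"
    have "s < 2 * m" using lt[of i] by (auto simp: s_def)
    then obtain p :: 'n where p: "idx p = s" using bij by (metis bij_betw_def imageE lessThan_iff)
    have entry: "symp_J $ i $ j = (if idx j = idx i + m then 1 else if idx i = idx j + m then -1 else 0)"
      for i j :: 'n
      by (simp add: symp_J_def m_def)
    have J: "symp_J $ i $ j = (if j = p then (if idx i < m then 1 else -1) else 0)" for j :: 'n
    proof -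
      have jp: "j = p \<longleftrightarrow> idx j = s" using inj[of j p] p by simp
      show ?thesis unfolding entry jp s_def using lt[of i] lt[of j] by (cases "idx i < m") auto
    qed
    have "(symp_J ** symp_J) $ i $ k = (if idx i < m then 1 else -1) * symp_J $ p $ k"
      unfolding matrix_matrix_mult_def by (simp add: J if_distrib[of "\<lambda>x. x * _"] cong: if_cong)
    also have "\<dots> = (- mat 1 :: 'n cmat) $ i $ k"
    proof -
      have ik: "mat 1 $ i $ k = (if idx i = idx k then 1 else (0::complex))"
        using inj[of i k] by (simp add: mat_def)
      show ?thesis
        unfolding entry p s_def using lt[of i] lt[of k] m0 ik by (cases "idx i < m") auto
    qed
    finally show ?thesis .
  qed
  then have "(symp_J ** symp_J :: 'n cmat) = - mat 1" by (simp add: vec_eq_iff)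
  then show ?thesis unfolding oJ_def by (simp add: times_opmat_def one_opmat_def uminus_opmat_def)
qed

text \<open>Multiplication by the invertible \<open>oJ\<close> turns the defining equation into
  skewness for the symplectic adjoint, which sends \<open>x\<close> to
  \<open>J x^T J^(-1) = - J x^T J\<close> and is an antiautomorphism.\<close>

lemma symplectic_iff:
  fixes x :: "'n::enum opmat"
  assumes "even CARD('n)"
  shows "transpose (mat_of x) ** symp_J + symp_J ** mat_of x = 0 \<longleftrightarrow> - (oJ * optr x * oJ) = - x"
proof -
  have J: "mat_of oJ = symp_J" by (simp add: oJ_def)
  have "transpose (mat_of x) ** symp_J + symp_J ** mat_of x = mat_of (optr x * oJ + oJ * x)"
    by (simp add: J plus_opmat.rep_eq times_opmat.rep_eq optr.rep_eq)
  also have "\<dots> = 0 \<longleftrightarrow> optr x * oJ + oJ * x = 0"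
    by (metis mat_of_inverses(1) zero_opmat.rep_eq)
  also have "\<dots> \<longleftrightarrow> oJ * (optr x * oJ + oJ * x) = 0"
  proof
    assume "oJ * (optr x * oJ + oJ * x) = 0"
    then have "(oJ * oJ) * (optr x * oJ + oJ * x) = 0" by (simp add: mult.assoc)
    then have "- (optr x * oJ + oJ * x) = 0" by (simp only: oJ_square[OF assms] mult_minus1)
    then show "optr x * oJ + oJ * x = 0" by (simp only: neg_equal_0_iff_equal)
  qed simp
  also have "oJ * (optr x * oJ + oJ * x) = oJ * optr x * oJ - x"
    by (simp add: distrib_left oJ_square[OF assms] flip: mult.assoc)
  finally show ?thesis by simp
qed

lemma opmat_of_mexp: "opmat_of (mexp M) = exp (opmat_of M)"
proof -
  have p: "mpow M k = mat_of (opmat_of M ^ k)" for k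
    by (induction k) (simp_all add: one_opmat.rep_eq times_opmat.rep_eq)
  have "mexp M = (\<Sum>k. mat_of (opmat_of M ^ k /\<^sub>R fact k))"
    unfolding mexp_def by (simp add: p scaleR_opmat.rep_eq divide_inverse)
  also have "\<dots> = mat_of (exp (opmat_of M))"
    unfolding exp_def by (rule bounded_linear.suminf[OF bounded_linear_mat_of summable_exp_generic, symmetric])
  finally show ?thesis by simp
qed

section \<open>Liouville's formula\<close>

definition mtrace :: "complex^'n::finite^'n \<Rightarrow> complex" where
  "mtrace M = (\<Sum>i\<in>UNIV. M $ i $ i)"

text \<open>A permutation other than the identity moves at least two points. After one factor has
  been differentiated, an off-diagonal entry of the identity matrix remains and annihilates the
  product; the diagonal product alone survives and yields the trace.\<close>

lemma has_vector_derivative_det_at_mat_1: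
  fixes N :: "real \<Rightarrow> complex^'n::finite^'n"
  assumes N: "(N has_vector_derivative M) (at t)" and N1: "N t = mat 1"
  shows "((\<lambda>s. det (N s)) has_vector_derivative mtrace M) (at t)"
proof -
  have entry: "((\<lambda>s. N s $ i $ j) has_derivative (\<lambda>h. h *\<^sub>R M $ i $ j)) (at t)" for i j
    using bounded_linear.has_derivative[OF bounded_linear_compose[OF bounded_linear_vec_nth bounded_linear_vec_nth]
        N[unfolded has_vector_derivative_def], of i j] by simp
  let ?P = "{p. p permutes (UNIV :: 'n set)}"
  have "((\<lambda>s. det (N s)) has_derivative (\<lambda>h. \<Sum>p\<in>?P. of_int (sign p) *
     (\<Sum>i\<in>UNIV. (h *\<^sub>R M $ i $ p i) * (\<Prod>j\<in>UNIV - {i}. N t $ j $ p j)))) (at t)"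
    unfolding det_def by (intro has_derivative_sum has_derivative_mult_right has_derivative_prod entry)
  moreover have "(\<Sum>p\<in>?P. of_int (sign p) *
     (\<Sum>i\<in>UNIV. (h *\<^sub>R M $ i $ p i) * (\<Prod>j\<in>UNIV - {i}. N t $ j $ p j))) = h *\<^sub>R mtrace M" for h
  proof -
    have z: "(\<Prod>j\<in>UNIV - {i}. N t $ j $ p j) = 0" if p: "p permutes (UNIV :: 'n set)" "p \<noteq> id" for p i
    proof -
      obtain k where k: "p k \<noteq> k" using p(2) by (auto simp: fun_eq_iff)
      \<comment> \<open>Both \<open>k\<close> and \<open>p k\<close> are moved by \<open>p\<close>,
        and at least one of them differs from \<open>i\<close>.\<close>
      define j where "j = (if k = i then p k else k)"
      have "j \<noteq> i" "p j \<noteq> j"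
        using k injD[OF permutes_inj[OF p(1)]] by (auto simp: j_def)
      then have "N t $ j $ p j = 0" "j \<in> UNIV - {i}" by (auto simp: N1 mat_def)
      then show ?thesis by (meson finite prod_zero)
    qed
    have "(\<Sum>p\<in>?P. of_int (sign p) *
     (\<Sum>i\<in>UNIV. (h *\<^sub>R M $ i $ p i) * (\<Prod>j\<in>UNIV - {i}. N t $ j $ p j)))
      = (\<Sum>p\<in>{id}. of_int (sign p) *
     (\<Sum>i\<in>UNIV. (h *\<^sub>R M $ i $ p i) * (\<Prod>j\<in>UNIV - {i}. N t $ j $ p j)))"
      by (rule sum.mono_neutral_right) (auto simp: permutes_id z)
    also have "\<dots> = h *\<^sub>R mtrace M"
      by (simp add: N1 mat_def mtrace_def scaleR_sum_right)
    finally show ?thesis .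
  qed
  ultimately show ?thesis by (simp add: has_vector_derivative_def)
qed

text \<open>Liouville's formula; writing the solution as \<open>(X s X(t)\<^sup>-\<^sup>1) X(t)\<close> reduces it to the
  derivative of the determinant at the identity.\<close>

lemma liouville:
  fixes X Xi :: "real \<Rightarrow> 'n::finite opmat"
  assumes X: "(X has_vector_derivative M * X t) (at t)" and inv: "X t * Xi t = 1"
  shows "((\<lambda>s. det (mat_of (X s))) has_vector_derivative mtrace (mat_of M) * det (mat_of (X t))) (at t)"
proof -
  define N where "N s = mat_of (X s * Xi t)" for s
  have "((\<lambda>s. X s * Xi t) has_vector_derivative M * X t * Xi t) (at t)"
    by (rule bounded_linear.has_vector_derivative[OF bounded_linear_mult_left X])
  then have "(N has_vector_derivative mat_of M) (at t)"
    using bounded_linear.has_vector_derivative[OF bounded_linear_mat_of] inv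
    unfolding N_def by (metis mult.assoc mult_1_right)
  moreover have "N t = mat 1" using inv by (simp add: N_def one_opmat.rep_eq)
  ultimately have "((\<lambda>s. det (N s)) has_vector_derivative mtrace (mat_of M)) (at t)"
    by (rule has_vector_derivative_det_at_mat_1)
  from bounded_linear.has_vector_derivative[OF bounded_linear_mult_left[of "det (mat_of (X t))"] this]
  have "((\<lambda>s. det (N s) * det (mat_of (X t))) has_vector_derivative mtrace (mat_of M) * det (mat_of (X t))) (at t)" .
  moreover have "det (N s) * det (mat_of (X t)) = det (mat_of (X s))" for s
  proof -
    have "X s * Xi t * X t = X s" using opmat_inverse_commute[OF inv] by (simp add: mult.assoc)
    then show ?thesis by (metis N_def det_mul times_opmat.rep_eq)
  qed
  ultimately show ?thesis by simp
qed

text \<open>By Liouville's formula the determinant is constant along \<open>exp (t A)\<close>; it is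
  1 at \<open>t = 0\<close>.\<close>

lemma det_exp_traceless:
  fixes A :: "'n::finite opmat"
  assumes "mtrace (mat_of A) = 0"
  shows "det (mat_of (exp A)) = 1"
proof -
  have "((\<lambda>t. det (mat_of (exp (t *\<^sub>R A)))) has_vector_derivative 0) (at t within UNIV)" for t
  proof -
    have "((\<lambda>t. exp (t *\<^sub>R A)) has_vector_derivative A * exp (t *\<^sub>R A)) (at t)"
      by (rule exp_scaleR_has_vector_derivative_left)
    from liouville[OF this, of "\<lambda>t. exp (- (t *\<^sub>R A))"] show ?thesis
      by (simp add: exp_minus_inverse assms)
  qed
  then obtain c where "\<And>t. det (mat_of (exp (t *\<^sub>R A))) = c"
    using has_vector_derivative_zero_constant[of UNIV "\<lambda>t. det (mat_of (exp (t *\<^sub>R A)))"] by auto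
  from this[of 0] this[of 1] show ?thesis by (simp add: one_opmat.rep_eq)
qed

text \<open>Removing the trace from the generator multiplies a real solution by a scalar function,
  which is trivial at time one because the determinant is.\<close>

lemma traceless_correction:
  fixes X Xi W :: "real \<Rightarrow> 'n::finite opmat"
  assumes X: "\<And>t. (X has_vector_derivative (A + W t) * X t) (at t)" and inv: "\<And>t. X t * Xi t = 1"
    and X0: "X 0 = 1" and X1: "det (mat_of (X 1)) = 1"
    and A: "mtrace (mat_of A) = 0" and W: "\<And>t. Im (mtrace (mat_of (W t))) = 0"
    and real: "\<And>t. Im (det (mat_of (X t))) = 0"
  shows "\<exists>X'. X' 0 = 1 \<and> X' 1 = X 1 \<and> (\<forall>t. (X' has_vector_derivative
     (A + (W t - csm (mtrace (mat_of (W t)) / of_nat CARD('n)))) * X' t) (at t))"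
proof -
  define f where "f t = Re (mtrace (mat_of (W t)))" for t
  define v where "v t = Re (det (mat_of (X t)))" for t
  define r where "r = - 1 / (2 * real CARD('n))"
  have mt: "mtrace (mat_of (A + W t)) = of_real (f t)" for t
  proof -
    have "mtrace (mat_of (A + W t)) = mtrace (mat_of A) + mtrace (mat_of (W t))"
      by (simp add: mtrace_def plus_opmat.rep_eq sum.distrib)
    then show ?thesis using W[of t] A by (simp add: f_def complex_eq_iff)
  qed
  have dX: "det (mat_of (X t)) = of_real (v t)" for t
    using real[of t] by (simp add: v_def complex_eq_iff)
  have v: "(v has_field_derivative f t * v t) (at t)" for t
    using bounded_linear.has_vector_derivative[OF bounded_linear_Re liouville[where X=X and Xi=Xi and t=t, OF X inv]]
    unfolding v_def[abs_def] mt by (simp add: has_real_derivative_iff_has_vector_derivative)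
  have v0: "v t \<noteq> 0" for t
  proof
    assume "v t = 0"
    then have "det (mat_of (X t)) * det (mat_of (Xi t)) = 0" by (simp add: dX)
    moreover have "det (mat_of (X t)) * det (mat_of (Xi t)) = 1"
      using arg_cong[OF inv[of t], of "\<lambda>x. det (mat_of x)"] by (simp add: times_opmat.rep_eq one_opmat.rep_eq det_mul)
    ultimately show False by simp
  qed
  \<comment> \<open>This is \<open>|v|\<close> to the power \<open>- 1 / n\<close>, with logarithmic
    derivative \<open>- f / n\<close>. Squaring first makes the base of \<open>powr\<close> positive
    without a discussion of the sign of \<open>v\<close>.\<close>
  define s where "s t = ((v t)\<^sup>2) powr r" for t
  have s: "(s has_field_derivative s t * (- f t / real CARD('n))) (at t)" for t
  proof -
    have p: "(v t)\<^sup>2 > 0" using v0[of t] by simp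
    have "((\<lambda>t. (v t)\<^sup>2) has_field_derivative 2 * f t * (v t)\<^sup>2) (at t)"
      by (rule derivative_eq_intros v refl)+ (simp add: power2_eq_square)
    from DERIV_powr[OF this p DERIV_const[of r]]
    have "(s has_field_derivative s t * (2 * f t * (v t)\<^sup>2 * r / (v t)\<^sup>2)) (at t)"
      by (simp add: s_def[abs_def])
    moreover have "2 * f t * (v t)\<^sup>2 * r / (v t)\<^sup>2 = - f t / real CARD('n)" using v0[of t] by (simp add: r_def)
    ultimately show ?thesis by simp
  qed
  show ?thesis
  proof (intro exI[of _ "\<lambda>t. s t *\<^sub>R X t"] conjI allI)
    have "v 0 = 1" "v 1 = 1" using X0 X1 by (simp_all add: v_def one_opmat.rep_eq)
    then have "s 0 = 1" "s 1 = 1" by (simp_all add: s_def)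
    then show "s 0 *\<^sub>R X 0 = 1" "s 1 *\<^sub>R X 1 = X 1" using X0 by simp_all
    fix t
    have c: "csm (mtrace (mat_of (W t)) / of_nat CARD('n)) * x = (f t / real CARD('n)) *\<^sub>R x" for x :: "'n opmat"
    proof -
      have "mtrace (mat_of (W t)) / of_nat CARD('n) = of_real (f t / real CARD('n))"
        using W[of t] by (simp add: f_def complex_eq_iff)
      then show ?thesis by (simp only: csm_of_real) (simp add: of_real_def)
    qed
    have "((\<lambda>t. s t *\<^sub>R X t) has_vector_derivative s t *\<^sub>R ((A + W t) * X t) + (s t * (- f t / real CARD('n))) *\<^sub>R X t) (at t)"
      by (rule has_vector_derivative_scaleR[OF s X])
    moreover have "s t *\<^sub>R ((A + W t) * X t) + (s t * (- f t / real CARD('n))) *\<^sub>R X t =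
       (A + (W t - csm (mtrace (mat_of (W t)) / of_nat CARD('n)))) * (s t *\<^sub>R X t)"
      by (simp add: distrib_right left_diff_distrib c algebra_simps)
    ultimately show "((\<lambda>t. s t *\<^sub>R X t) has_vector_derivative
       (A + (W t - csm (mtrace (mat_of (W t)) / of_nat CARD('n)))) * (s t *\<^sub>R X t)) (at t)" by simp
  qed
qed

text \<open>The projection onto trace zero along the scalar matrices. It is complex linear, so the
  corrected generator remains holomorphic.\<close>

definition traceless :: "'n::finite opmat \<Rightarrow> 'n opmat" where
  "traceless x = x - csm (mtrace (mat_of x) / of_nat CARD('n))"

lemma bounded_linear_traceless: "bounded_linear (traceless :: 'n::finite opmat \<Rightarrow> _)"
proof -
  have "bounded_linear (\<lambda>x::'n opmat. mtrace (mat_of x) / of_nat CARD('n))"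
    unfolding mtrace_def
    by (intro bounded_linear_divide[THEN bounded_linear_compose] bounded_linear_sum
        bounded_linear_compose[OF bounded_linear_vec_nth] bounded_linear_mat_of)
  from bounded_linear_sub[OF bounded_linear_ident bounded_linear_compose[OF bounded_linear_csm this]]
  show ?thesis by (simp add: traceless_def[abs_def])
qed

lemma traceless_csm_mult: "traceless (csm c * x) = csm c * traceless x"
proof -
  have "mtrace (mat_of (csm c * x)) = c * mtrace (mat_of x)"
    by (simp add: mtrace_def mat_of_csm_mult sum_distrib_left)
  then show ?thesis by (simp add: traceless_def right_diff_distrib csm_mult flip: times_divide_eq_right)
qed

lemma mtrace_traceless: "mtrace (mat_of (traceless x)) = 0"
proof -
  have "mat_of (csm c :: 'n opmat) = mat c" for c and x :: "'n::finite opmat" by (rule csm.rep_eq)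
  then show ?thesis
    by (simp add: traceless_def mtrace_def minus_opmat.rep_eq sum_subtractf csm.rep_eq mat_def)
qed

section \<open>The embedding theorem\<close>

lemma lie_alg_iff:
  fixes x :: "'n::enum opmat"
  shows "mat_of x \<in> lie_alg LSL \<longleftrightarrow> ocnj x = x \<and> mtrace (mat_of x) = 0"
    and "mat_of x \<in> lie_alg LO \<longleftrightarrow> ocnj x = x \<and> optr x = - x"
    and "mat_of x \<in> lie_alg LSO \<longleftrightarrow> ocnj x = x \<and> optr x = - x"
    and "mat_of x \<in> lie_alg LU \<longleftrightarrow> ocnj (optr x) = - x"
    and "even CARD('n) \<Longrightarrow> mat_of x \<in> lie_alg LSP \<longleftrightarrow> ocnj x = x \<and> - (oJ * optr x * oJ) = - x"
  using symplectic_iff[of x]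
  by (simp_all add: real_mat_iff skew_iff skew_hermitian_iff mtrace_def)

lemma det_mat_of_ocnj: "det (mat_of (ocnj x)) = cnj (det (mat_of x))"
  by (simp add: det_def ocnj.rep_eq)

text \<open>The solution is asserted separately for each \<open>x\<close>: in the trace-free case it
  is \<Phi> times a scalar that is constructed along one real flow line at a time.\<close>

definition lie_embedding ::
  "lie_kind \<Rightarrow> 'n::enum opmat \<Rightarrow> real \<Rightarrow> real \<Rightarrow> real^'d \<Rightarrow> (complex^'d \<Rightarrow> 'n opmat) \<Rightarrow>
   (complex \<times> (complex^'d) \<Rightarrow> 'n opmat) \<Rightarrow> bool" where
  "lie_embedding k A h b \<mu> G F \<longleftrightarrow>
     (\<exists>p. fhol \<mu> F p (strip2 (h / (1 + l1norm \<mu>)))) \<and>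
     (\<forall>w\<in>strip2 (h / (1 + l1norm \<mu>)). norm (F w) \<le> b) \<and>
     strip_periodic (h / (1 + l1norm \<mu>)) F \<and>
     (\<forall>t x. mat_of (F (of_real t, cvec x)) \<in> lie_alg k) \<and>
     (\<forall>x. \<exists>X. X 0 = 1 \<and> X 1 = exp A * exp (G (cvec x)) \<and>
       (\<forall>t. (X has_vector_derivative (A + F (of_real t, cvec (x + t *\<^sub>R \<mu>))) * X t) (at t)))"

lemma lie_embedding_exists:
  fixes A :: "'n::enum opmat"
  assumes even: "k = LSP \<Longrightarrow> even CARD('n)" and A: "mat_of A \<in> lie_alg k" and h: "h > 0"
  shows "\<exists>e c. 0 < e \<and> 0 \<le> c \<and> (\<forall>(\<mu>::real^'d) G \<epsilon>. small_datum h \<epsilon> G \<longrightarrow> \<epsilon> < e \<longrightarrow>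
     (\<forall>x. mat_of (G (cvec x)) \<in> lie_alg k) \<longrightarrow> (\<exists>F. lie_embedding k A h (c * \<epsilon>) \<mu> G F))"
proof -
  obtain e c where e: "0 < e" and c: "0 \<le> c" and ec: "\<forall>(\<mu>::real^'d) G \<epsilon>. small_datum h \<epsilon> G \<longrightarrow> \<epsilon> < e \<longrightarrow>
     (\<exists>F \<Phi> \<Psi>. equivariant_embedding A h (c * \<epsilon>) \<mu> G F \<Phi> \<Psi>)"
    using equivariant_embedding_exists[OF h, of A] by blast
  obtain K where K: "K > 0" "\<And>x::'n opmat. norm (traceless x) \<le> norm x * K"
    using bounded_linear.pos_bounded[OF bounded_linear_traceless] by blast
  show ?thesis
  \<comment> \<open>Removing the trace may enlarge the norm of \<open>F\<close> by the factor
    \<open>K\<close>.\<close>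
  proof (rule exI[of _ e], rule exI[of _ "if k = LSL then c * K else c"], intro conjI allI impI)
    show "0 \<le> (if k = LSL then c * K else c)" using c K by simp
    fix \<mu> :: "real^'d" and G :: "complex^'d \<Rightarrow> 'n opmat" and \<epsilon> :: real
    assume small: "small_datum h \<epsilon> G" "\<epsilon> < e" and G: "\<forall>x. mat_of (G (cvec x)) \<in> lie_alg k"
    define S where "S = (strip2 (h / (1 + l1norm \<mu>)) :: (complex \<times> (complex^'d)) set)"
    obtain F \<Phi> \<Psi> where FF: "equivariant_embedding A h (c * \<epsilon>) \<mu> G F \<Phi> \<Psi>"
      using ec small by blast
    note FF = FF[unfolded equivariant_embedding_def, folded S_def]
    obtain p where p: "fhol \<mu> F p S" using FF by (elim conjE exE)
    have F: "\<forall>w\<in>S. norm (F w) \<le> c * \<epsilon>" "strip_periodic (h / (1 + l1norm \<mu>)) F"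
      and emb: "poincare_embedding A G \<mu> F \<Phi>"
      and inv: "\<forall>t x. \<Phi> (of_real t, cvec x) * \<Psi> (of_real t, cvec x) = 1"
      using FF by - (elim conjE, assumption)+
    have "\<forall>L. bounded_linear L \<longrightarrow> (\<forall>x y. L (x * y) = L x * L y) \<longrightarrow> L 1 = 1 \<longrightarrow> L A = A \<longrightarrow>
        (\<forall>x. L (G (cvec x)) = G (cvec x)) \<longrightarrow>
        (\<forall>t x. L (F (of_real t, cvec x)) = F (of_real t, cvec x) \<and>
           L (\<Phi> (of_real t, cvec x)) = \<Phi> (of_real t, cvec x))"
      using FF by (elim conjE)
    note hom = this[rule_format]
    have "\<forall>L. bounded_linear L \<longrightarrow> (\<forall>x y. L (x * y) = L y * L x) \<longrightarrow> L 1 = 1 \<longrightarrow> L A = - A \<longrightarrow>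
        (\<forall>x. L (G (cvec x)) = - G (cvec x)) \<longrightarrow>
        (\<forall>t x. L (F (of_real t, cvec x)) = - F (of_real t, cvec x))"
      using FF by (elim conjE)
    note anti = this[rule_format]
    define X where "X x t = \<Phi> (of_real t, cvec (x + t *\<^sub>R \<mu>))" for x t
    have X: "X x 0 = 1" "X x 1 = exp A * exp (G (cvec x))"
      "(X x has_vector_derivative (A + F (of_real t, cvec (x + t *\<^sub>R \<mu>))) * X x t) (at t)" for x t
      using emb unfolding poincare_embedding_def X_def[abs_def] by simp_all
    have ocnj: "ocnj (F (of_real t, cvec x)) = F (of_real t, cvec x) \<and> ocnj (\<Phi> (of_real t, cvec x)) = \<Phi> (of_real t, cvec x)"
      if "ocnj A = A" "\<And>x. ocnj (G (cvec x)) = G (cvec x)" for t x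
      by (rule hom[OF bounded_linear_ocnj ocnj_mult ocnj_1 that])
    have optr: "optr (F (of_real t, cvec x)) = - F (of_real t, cvec x)"
      if "optr A = - A" "\<And>x. optr (G (cvec x)) = - G (cvec x)" for t x
      by (rule anti[OF bounded_linear_optr optr_mult optr_1 that])
    show "\<exists>F. lie_embedding k A h ((if k = LSL then c * K else c) * \<epsilon>) \<mu> G F"
    proof (cases "k = LSL")
      case False
      have "mat_of (F (of_real t, cvec x)) \<in> lie_alg k" for t x
      proof (cases k)
        case LSL
        then show ?thesis using False by simp
      next
        case LO
        then show ?thesis using A G ocnj optr by (simp only: lie_alg_iff)
      next
        case LSO
        then show ?thesis using A G ocnj optr by (simp only: lie_alg_iff)
      next
        case LU
        \<comment> \<open>For the unitary algebra the symmetry of the datum is the composition of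
          conjugation and transposition, again a real linear antiautomorphism.\<close>
        have "ocnj (optr (F (of_real t, cvec x))) = - F (of_real t, cvec x)"
          by (rule anti[OF bounded_linear_compose[OF bounded_linear_ocnj bounded_linear_optr]])
            (use A G LU in \<open>simp_all add: lie_alg_iff optr_mult ocnj_mult del: lie_alg.simps\<close>)
        then show ?thesis using LU by (simp only: lie_alg_iff)
      next
        case LSP
        note J = oJ_square[OF even[OF LSP]]
        have "- (oJ * optr (F (of_real t, cvec x)) * oJ) = - F (of_real t, cvec x)"
        proof (rule anti)
          show "bounded_linear (\<lambda>y::'n opmat. - (oJ * optr y * oJ))"
            by (intro bounded_linear_minus bounded_linear_compose[OF bounded_linear_mult_left]
                bounded_linear_compose[OF bounded_linear_mult_right] bounded_linear_optr)
          show "- (oJ * optr (x * y) * oJ) = - (oJ * optr y * oJ) * - (oJ * optr x * oJ)" for x y :: "'n opmat"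
          proof -
            have "- (oJ * optr y * oJ) * - (oJ * optr x * oJ) = oJ * optr y * (oJ * oJ) * optr x * oJ"
              by (simp add: mult.assoc)
            then show ?thesis by (simp add: J optr_mult mult.assoc)
          qed
          show "- (oJ * optr 1 * oJ) = (1 :: 'n opmat)" by (simp add: J)
        qed (use A G LSP lie_alg_iff(5)[OF even[OF LSP]] in \<open>simp_all del: lie_alg.simps\<close>)
        then show ?thesis using A G LSP ocnj by (simp only: lie_alg_iff(5)[OF even[OF LSP]])
      qed
      then have "lie_embedding k A h (c * \<epsilon>) \<mu> G F"
        unfolding lie_embedding_def S_def[symmetric] using p F X by blast
      then show ?thesis using False by auto
    next
      case True
      have cA: "ocnj A = A" "mtrace (mat_of A) = 0" and cG: "\<And>x. ocnj (G (cvec x)) = G (cvec x)" "\<And>x. mtrace (mat_of (G (cvec x))) = 0"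
        using A G True by (simp_all only: lie_alg_iff)
      have Im0: "Im (mtrace (mat_of y)) = 0" "Im (det (mat_of y)) = 0" if "ocnj y = y" for y :: "'n opmat"
      proof -
        have "real_mat (mat_of y)" using that by (simp add: real_mat_iff)
        then show "Im (mtrace (mat_of y)) = 0" by (simp add: real_mat_def mtrace_def)
        have "cnj (det (mat_of y)) = det (mat_of y)" using det_mat_of_ocnj[of y] that by simp
        then show "Im (det (mat_of y)) = 0" by (simp add: complex_eq_iff)
      qed
      have "\<exists>X. X 0 = 1 \<and> X 1 = exp A * exp (G (cvec x)) \<and>
          (\<forall>t. (X has_vector_derivative (A + traceless (F (of_real t, cvec (x + t *\<^sub>R \<mu>)))) * X t) (at t))" for x
      proof -
        have "det (mat_of (X x 1)) = 1"
          unfolding X(2) by (simp add: times_opmat.rep_eq det_mul det_exp_traceless cA cG)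
        then have "\<exists>X'. X' 0 = 1 \<and> X' 1 = X x 1 \<and> (\<forall>t. (X' has_vector_derivative
           (A + (F (of_real t, cvec (x + t *\<^sub>R \<mu>)) -
              csm (mtrace (mat_of (F (of_real t, cvec (x + t *\<^sub>R \<mu>)))) / of_nat CARD('n)))) * X' t) (at t))"
          by (intro traceless_correction[where Xi="\<lambda>t. \<Psi> (of_real t, cvec (x + t *\<^sub>R \<mu>))"] X(3,1) cA(2))
            (use ocnj[OF cA(1) cG(1)] Im0 inv in \<open>auto simp: X_def\<close>)
        then show ?thesis unfolding X(2) traceless_def .
      qed
      moreover have "fhol \<mu> (\<lambda>w. traceless (F w)) (\<lambda>w. traceless (p w)) S"
        by (rule fhol_linear[OF p bounded_linear_traceless traceless_csm_mult])
      moreover have "norm (traceless (F w)) \<le> c * K * \<epsilon>" if "w \<in> S" for w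
        using order_trans[OF K(2) mult_right_mono[of "norm (F w)" "c * \<epsilon>" K]] F(1) that K(1) by (simp add: mult_ac)
      moreover have "strip_periodic (h / (1 + l1norm \<mu>)) (\<lambda>w. traceless (F w))"
        using F(2) by (simp add: strip_periodic_def)
      moreover have "mat_of (traceless (F (of_real t, cvec x))) \<in> lie_alg k" for t x
      proof -
        let ?y = "F (of_real t, cvec x)"
        have y: "ocnj ?y = ?y" using ocnj[OF cA(1) cG(1)] by blast
        \<comment> \<open>The trace is real at real points, so the subtracted multiple of the
          identity is fixed by conjugation.\<close>
        have "mtrace (mat_of ?y) / of_nat CARD('n) = of_real (Re (mtrace (mat_of ?y)) / real CARD('n))"
          using Im0(1)[OF y] by (simp add: complex_eq_iff)
        then have "traceless ?y = ?y - (Re (mtrace (mat_of ?y)) / real CARD('n)) *\<^sub>R 1"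
          unfolding traceless_def by (simp only: csm_of_real) (simp add: of_real_def)
        then have "ocnj (traceless ?y) = traceless ?y"
          using y by (simp add: linear_diff[OF bounded_linear.linear[OF bounded_linear_ocnj]]
              linear_cmul[OF bounded_linear.linear[OF bounded_linear_ocnj]])
        then show ?thesis unfolding True lie_alg_iff(1) by (simp add: mtrace_traceless)
      qed
      ultimately have "lie_embedding k A h (c * K * \<epsilon>) \<mu> G (\<lambda>w. traceless (F w))"
        unfolding lie_embedding_def S_def[symmetric] by blast
      then show ?thesis using True by auto
    qed
  qed (rule e)
qed

section \<open>Return to matrices with the prescribed norm\<close>

lemma opmat_of_cscaleM: "opmat_of (cscaleM c M) = csm c * opmat_of M"
proof -
  have "mat_of (csm c * opmat_of M) = cscaleM c M"
    by (simp add: vec_eq_iff mat_of_csm_mult cscaleM_def)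
  then show ?thesis by (metis mat_of_inverses(1))
qed

theorem theorem1p1:
  fixes k :: lie_kind and A :: "'n::enum cmat" and h :: real
  assumes "k = LSP \<Longrightarrow> even CARD('n)"
    and "A \<in> lie_alg k"
    and "h > 0"
  shows "\<exists>eps c :: real \<Rightarrow> real. (\<forall>s. eps s > 0 \<and> c s > 0) \<and>
    (\<forall>(mu::real^'d) G Gc. rat_indep mu \<longrightarrow> (\<forall>x. G x \<in> lie_alg k) \<longrightarrow> comega1 h G Gc \<longrightarrow>
       (SUP z\<in>strip1 h. norm (Gc z)) < eps (l1norm mu) \<longrightarrow>
       (\<exists>At F Fc. At \<in> lie_alg k \<and> (\<forall>\<theta>. F \<theta> \<in> lie_alg k) \<and>
          comega2 (h / (1 + l1norm mu)) F Fc \<and>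
          (SUP w\<in>strip2 (h / (1 + l1norm mu)). norm (Fc w))
              \<le> c (l1norm mu) * sqrt (SUP z\<in>strip1 h. norm (Gc z)) \<and>
          (\<forall>x. \<exists>\<Phi> :: real \<Rightarrow> 'n cmat. \<Phi> 0 = mat 1 \<and>
              (\<forall>t. (\<Phi> has_vector_derivative ((At + F (t, x + t *\<^sub>R mu)) ** \<Phi> t)) (at t)) \<and>
              \<Phi> 1 = mexp A ** mexp (G x))))"
proof -
  have A: "mat_of (opmat_of A) \<in> lie_alg k" using assms(2) by simp
  obtain e c where e: "0 < e" and c: "0 \<le> c" and ec: "\<forall>(\<mu>::real^'d) G \<epsilon>. small_datum h \<epsilon> G \<longrightarrow> \<epsilon> < e \<longrightarrow>
     (\<forall>x. mat_of (G (cvec x)) \<in> lie_alg k) \<longrightarrow> (\<exists>F. lie_embedding k (opmat_of A) h (c * \<epsilon>) \<mu> G F)"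
    using lie_embedding_exists[OF assms(1) A assms(3), where 'd='d] by blast
  obtain Ko where Ko: "Ko > 0" "\<And>M::'n cmat. norm (opmat_of M) \<le> norm M * Ko"
    using bounded_linear.pos_bounded[OF bounded_linear_opmat_of] by blast
  obtain Km where Km: "Km > 0" "\<And>x::'n opmat. norm (mat_of x) \<le> norm x * Km"
    using bounded_linear.pos_bounded[OF bounded_linear_mat_of] by blast
  \<comment> \<open>\<open>Ko\<close> and \<open>Km\<close> convert between the operator norm and
    the prescribed one; the summand 1 keeps the constant positive when \<open>c = 0\<close>.\<close>
  define c' where "c' = c * Ko * Km + 1"
  have c': "c' > 0" using c Ko Km by (simp add: c'_def add_nonneg_pos)
  show ?thesis
  \<comment> \<open>Constant functions of \<open>|\<mu>|\<close> serve, because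
    \<open>lie_embedding_exists\<close> fixes its constants ahead of \<mu>. The minimum with 1
    ensures \<open>\<epsilon>0 \<le> sqrt \<epsilon>0\<close>.\<close>
  proof (rule exI[of _ "\<lambda>_. min 1 (e / Ko)"], rule exI[of _ "\<lambda>_. c'"], intro conjI allI impI)
    show "0 < min 1 (e / Ko)" using e Ko by simp
    show "0 < c'" by (rule c')
    fix \<mu> :: "real^'d" and G :: "real^'d \<Rightarrow> 'n cmat" and Gc
    assume Glie: "\<forall>x. G x \<in> lie_alg k" and G: "comega1 h G Gc"
      and small: "(SUP z\<in>strip1 h. norm (Gc z)) < min 1 (e / Ko)"
    define \<epsilon>0 where "\<epsilon>0 = (SUP z\<in>strip1 h. norm (Gc z))"
    have bdd: "bdd_above ((\<lambda>z. norm (Gc z)) ` strip1 h)"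
      using G by (intro bounded_imp_bdd_above) (simp add: comega1_def bounded_norm_comp)
    have le: "norm (Gc z) \<le> \<epsilon>0" if "z \<in> strip1 h" for z
      unfolding \<epsilon>0_def using bdd that by (rule cSUP_upper2) simp
    have z0: "(0::complex^'d) \<in> strip1 h" using assms(3) by (simp add: strip1_def)
    have \<epsilon>0: "0 \<le> \<epsilon>0" using le[OF z0] norm_ge_zero order_trans by blast
    have \<epsilon>1: "\<epsilon>0 \<le> 1" and \<epsilon>e: "\<epsilon>0 * Ko < e" using small Ko by (auto simp: \<epsilon>0_def field_simps)
    define Go where "Go z = opmat_of (Gc z)" for z
    have Gcv: "Gc (cvec x) = G x" for x using G by (simp add: comega1_def)
    define S where "S = (strip2 (h / (1 + l1norm \<mu>)) :: (complex \<times> (complex^'d)) set)"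
    have l: "l1norm \<mu> \<ge> 0" by (rule l1norm_nonneg)
    have "holo1 Go (strip1 h)"
      unfolding holo1_def
    proof
      fix z :: "complex^'d" assume "z \<in> strip1 h"
      then obtain D where D: "(Gc has_derivative D) (at z)" "\<forall>c v. D (cscaleV c v) = cscaleM c (D v)"
        using G unfolding comega1_def holo_on1_def by blast
      then show "\<exists>D. (Go has_derivative D) (at z) \<and> (\<forall>c v. D (cscaleV c v) = csm c * D v)"
        unfolding Go_def[abs_def] using bounded_linear.has_derivative[OF bounded_linear_opmat_of D(1)]
        by (intro exI[of _ "\<lambda>v. opmat_of (D v)"]) (simp add: opmat_of_cscaleM)
    qed
    moreover have "\<forall>z\<in>strip1 h. norm (Go z) \<le> \<epsilon>0 * Ko"
      unfolding Go_def using order_trans[OF Ko(2) mult_right_mono[OF le]] Ko(1) by simp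
    moreover have "\<forall>z j. Go (z + axis j 1) = Go z" using G by (simp add: Go_def comega1_def)
    ultimately have "small_datum h (\<epsilon>0 * Ko) Go" using \<epsilon>0 Ko(1) by (simp add: small_datum_def)
    moreover have "\<forall>x. mat_of (Go (cvec x)) \<in> lie_alg k" using Glie by (simp add: Go_def Gcv)
    ultimately obtain F where FF: "lie_embedding k (opmat_of A) h (c * (\<epsilon>0 * Ko)) \<mu> Go F"
      using ec \<epsilon>e by blast
    then obtain p where F: "fhol \<mu> F p S" "\<And>w. w \<in> S \<Longrightarrow> norm (F w) \<le> c * (\<epsilon>0 * Ko)"
        "strip_periodic (h / (1 + l1norm \<mu>)) F" "\<And>t x. mat_of (F (of_real t, cvec x)) \<in> lie_alg k"
        "\<And>x. \<exists>X. X 0 = 1 \<and> X 1 = exp (opmat_of A) * exp (Go (cvec x)) \<and>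
          (\<forall>t. (X has_vector_derivative (opmat_of A + F (of_real t, cvec (x + t *\<^sub>R \<mu>))) * X t) (at t))"
      unfolding S_def lie_embedding_def by blast
    \<comment> \<open>Periodicity in time is known on the strip, whereas \<open>comega2\<close> asks
      for it at all complex arguments. The strip is invariant under the shifts, so extension by 0 is
      periodic, and holomorphy concerns the open strip alone.\<close>
    define Fc where "Fc w = (if w \<in> S then mat_of (F w) else 0)" for w
    have real: "(of_real t, cvec x) \<in> S" for t x
      using assms(3) l by (simp add: S_def strip2_def cvec_def)
    have Fc_le: "norm (Fc w) \<le> c * Ko * Km * \<epsilon>0" if "w \<in> S" for w
      using order_trans[OF Km(2) mult_right_mono[OF F(2)[OF that], of Km]] Km(1) that by (simp add: Fc_def mult_ac)
    have Fc: "comega2 (h / (1 + l1norm \<mu>)) (\<lambda>(t, x). mat_of (F (of_real t, cvec x))) Fc"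
      unfolding comega2_def
    proof (intro conjI allI)
      show "holo_on2 Fc (strip2 (h / (1 + l1norm \<mu>)))"
        unfolding holo_on2_def
      proof
        fix w :: "complex \<times> (complex^'d)" assume "w \<in> strip2 (h / (1 + l1norm \<mu>))"
        then have w: "w \<in> S" by (simp add: S_def)
        then obtain D where D: "(F has_derivative D) (at w)" "\<And>c v. D (smul c v) = csm c * D v"
          using F(1) unfolding fhol_def by blast
        have "(Fc has_derivative (\<lambda>v. mat_of (D v))) (at w)"
        proof (rule has_derivative_transform_within_open)
          show "((\<lambda>w. mat_of (F w)) has_derivative (\<lambda>v. mat_of (D v))) (at w)"
            by (rule bounded_linear.has_derivative[OF bounded_linear_mat_of D(1)])
        qed (use w open_strip2 in \<open>auto simp: Fc_def S_def\<close>)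
        moreover have "mat_of (D (c * a, cscaleV c v)) = cscaleM c (mat_of (D (a, v)))" for c a v
          using D(2)[of c "(a, v)"] by (simp add: smul_def vec_eq_iff mat_of_csm_mult cscaleM_def)
        ultimately show "\<exists>D. (Fc has_derivative D) (at w) \<and>
            (\<forall>c a v. D (c * a, cscaleV c v) = cscaleM c (D (a, v)))" by blast
      qed
      show "bounded (Fc ` strip2 (h / (1 + l1norm \<mu>)))"
        using Fc_le unfolding bounded_iff S_def by blast
      show "Fc (of_real t, cvec x) = (case (t, x) of (t, x) \<Rightarrow> mat_of (F (of_real t, cvec x)))" for t x
        using real by (simp add: Fc_def)
      show "Fc (a + 1, z) = Fc (a, z)" "Fc (a, z + axis j 1) = Fc (a, z)" for a z j
        using F(3) by (simp_all add: Fc_def S_def strip_periodic_def)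
    qed
    have "(SUP w\<in>S. norm (Fc w)) \<le> c * Ko * Km * \<epsilon>0"
      using real Fc_le by (intro cSUP_least) auto
    also have "\<dots> \<le> c' * sqrt \<epsilon>0"
    proof (rule mult_mono)
      show "\<epsilon>0 \<le> sqrt \<epsilon>0"
        using mult_left_mono[OF \<epsilon>1 \<epsilon>0] by (intro real_le_rsqrt) (simp add: power2_eq_square)
    qed (use c' \<epsilon>0 in \<open>auto simp: c'_def\<close>)
    finally have SUP: "(SUP w\<in>strip2 (h / (1 + l1norm \<mu>)). norm (Fc w)) \<le> c' * sqrt (SUP z\<in>strip1 h. norm (Gc z))"
      by (simp add: S_def \<epsilon>0_def)
    have sol: "\<exists>\<Phi> :: real \<Rightarrow> 'n cmat. \<Phi> 0 = mat 1 \<and>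
        (\<forall>t. (\<Phi> has_vector_derivative ((A + (case (t, x + t *\<^sub>R \<mu>) of (t, x) \<Rightarrow> mat_of (F (of_real t, cvec x)))) ** \<Phi> t)) (at t)) \<and>
        \<Phi> 1 = mexp A ** mexp (G x)" for x
    proof -
      obtain X where X: "X 0 = 1" "X 1 = exp (opmat_of A) * exp (Go (cvec x))"
        "\<And>t. (X has_vector_derivative (opmat_of A + F (of_real t, cvec (x + t *\<^sub>R \<mu>))) * X t) (at t)"
        using F(5) by blast
      show ?thesis
      proof (intro exI[of _ "\<lambda>t. mat_of (X t)"] conjI allI)
        show "mat_of (X 0) = mat 1" by (simp add: X one_opmat.rep_eq)
        have "exp (opmat_of A) * exp (Go (cvec x)) = opmat_of (mexp A) * opmat_of (mexp (G x))"
          by (simp add: Go_def Gcv opmat_of_mexp)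
        then show "mat_of (X 1) = mexp A ** mexp (G x)" by (simp add: X times_opmat.rep_eq)
        fix t
        show "((\<lambda>t. mat_of (X t)) has_vector_derivative ((A + (case (t, x + t *\<^sub>R \<mu>) of (t, x) \<Rightarrow> mat_of (F (of_real t, cvec x)))) ** mat_of (X t))) (at t)"
          using bounded_linear.has_vector_derivative[OF bounded_linear_mat_of X(3)[of t]]
          by (simp add: times_opmat.rep_eq plus_opmat.rep_eq)
      qed
    qed
    show "\<exists>At F Fc. At \<in> lie_alg k \<and> (\<forall>\<theta>. F \<theta> \<in> lie_alg k) \<and>
          comega2 (h / (1 + l1norm \<mu>)) F Fc \<and>
          (SUP w\<in>strip2 (h / (1 + l1norm \<mu>)). norm (Fc w)) \<le> c' * sqrt (SUP z\<in>strip1 h. norm (Gc z)) \<and>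
          (\<forall>x. \<exists>\<Phi> :: real \<Rightarrow> 'n cmat. \<Phi> 0 = mat 1 \<and>
              (\<forall>t. (\<Phi> has_vector_derivative ((At + F (t, x + t *\<^sub>R \<mu>)) ** \<Phi> t)) (at t)) \<and>
              \<Phi> 1 = mexp A ** mexp (G x))"
      by (rule exI[of _ A], rule exI[of _ "\<lambda>(t, x). mat_of (F (of_real t, cvec x))"], rule exI[of _ Fc],
          intro conjI allI Fc SUP sol assms(2)) (use F(4) in auto)
  qed
qed

end
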